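(* Let $K$ and $L$ be index sets. For each $N$, let $(\mathbf{A}_k)_{k\in K}$ be a family of $N\times N$ complex random matrices and $(\mathbf{M}_\ell)_{\ell\in L}$ a family of $N\times N$ deterministic complex matrices, satisfying: (a) for every deterministic $N\times N$ unitary $\mathbf{U}$, $(\mathbf{A}_k)_{k\in K}\overset{\text{law}}{=}(\mathbf{U}\mathbf{A}_k\mathbf{U}^* )_{k\in K}$; (b) for each $k\in K$ and $p,q\ge1$, $\frac1N\operatorname{Tr}(\mathbf{A}_k\mathbf{A}_k^* )^p$ is bounded in $L^q$ uniformly in $N$; (c) for each $k,k'\in K$, in $L^2$, $\frac1N\operatorname{Tr}\mathbf{A}_k\mathbf{A}_{k'}-\frac1N\operatorname{Tr}\mathbf{A}_k\cdot\frac1N\operatorname{Tr}\mathbf{A}_{k'}\to\tau(k,k')$ and $\frac1N\operatorname{Tr}\mathbf{A}_k\mathbf{A}_{k'}^*-\frac1N\operatorname{Tr}\mathbf{A}_k\cdot\frac1N\operatorname{Tr}\mathbf{A}_{k'}^*\to\tau(k,\overline{k'})$, with deterministic limits; (d) for each $\ell,\ell'\in L$, $\frac1N\operatorname{Tr}\mathbf{M}_\ell\mathbf{M}_{\ell'}-\frac1N\operatorname{Tr}\mathbf{M}_\ell\cdot\frac1N\operatorname{Tr}\mathbf{M}_{\ell'}\to\eta_{\ell\ell'}$ and $\frac1N\operatorname{Tr}\mathbf{M}_\ell\mathbf{M}_{\ell'}^*-\frac1N\operatorname{Tr}\mathbf{M}_\ell\cdot\frac1N\operatorname{Tr}\mathbf{M}_{\ell'}^*\to\beta_{\ell\ell'}$;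 (e) the finite-dimensional marginal distributions of $\big(\operatorname{Tr}\mathbf{A}_k-\mathbb{E}\operatorname{Tr}\mathbf{A}_k\big)_{k\in K}$ converge to those of a centered random vector $(\mathcal{T}_k)_{k\in K}$, and for each $\ell\in L$ there is $\alpha_\ell\in\mathbb{C}$ with $\lim_{N\to\infty}\frac1N\operatorname{Tr}\mathbf{M}_\ell=\alpha_\ell$. Then the finite-dimensional marginal distributions of $\big(\operatorname{Tr}(\mathbf{A}_k\mathbf{M}_\ell)-\mathbb{E}\operatorname{Tr}(\mathbf{A}_k\mathbf{M}_\ell)\big)_{k\in K,\ell\in L}$ converge to those of $\big(\mathcal{G}_{k,\ell}+\alpha_\ell\mathcal{T}_k\big)_{k\in K,\ell\in L}$, where $(\mathcal{G}_{k,\ell})$ is a complex centered Gaussian vector independent of $(\mathcal{T}_k)_{k\in K}$ with covariance $\mathbb{E}[\mathcal{G}_{k,\ell}\mathcal{G}_{k',\ell'}]=\eta_{\ell\ell'}\tau(k,k')$ and $\mathbb{E}[\mathcal{G}_{k,\ell}\overline{\mathcal{G}_{k',\ell'}}]=\beta_{\ell\ell'}\tau(k,\overline{k'})$.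
   Context: All matrices are $N\times N$ and implicitly depend on $N$; $\tau(k,\overline{k'})$ is notation for the second limit in (c). *)

theory Defs
  imports "HOL-Probability.Probability"
begin

text \<open>N x N complex matrices are represented as functions nat => nat => complex;
  only the entries with indices < N are meaningful.  All operations below
  are relative to the dimension N.\<close>

type_synonym cmat = "nat \<Rightarrow> nat \<Rightarrow> complex"

definition msk :: "nat \<Rightarrow> cmat \<Rightarrow> cmat" where
  "msk N X = (\<lambda>i j. if i < N \<and> j < N then X i j else 0)"

definition mmult :: "nat \<Rightarrow> cmat \<Rightarrow> cmat \<Rightarrow> cmat" where
  "mmult N X Y = (\<lambda>i j. if i < N \<and> j < N then (\<Sum>l<N. X i l * Y l j) else 0)"

definition madj :: "cmat \<Rightarrow> cmat" where
  "madj X = (\<lambda>i j. cnj (X j i))"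

definition idm :: "nat \<Rightarrow> cmat" where
  "idm N = (\<lambda>i j. if i < N \<and> j < N \<and> i = j then 1 else 0)"

fun mpow :: "nat \<Rightarrow> cmat \<Rightarrow> nat \<Rightarrow> cmat" where
  "mpow N X 0 = idm N"
| "mpow N X (Suc p) = mmult N X (mpow N X p)"

definition mtr :: "nat \<Rightarrow> cmat \<Rightarrow> complex" where
  "mtr N X = (\<Sum>i<N. X i i)"

definition unitary :: "nat \<Rightarrow> cmat \<Rightarrow> bool" where
  "unitary N U \<longleftrightarrow> mmult N U (madj U) = idm N \<and> mmult N (madj U) U = idm N"

definition fam_space :: "('k \<Rightarrow> cmat) measure" where
  "fam_space = PiM UNIV (\<lambda>_. PiM UNIV (\<lambda>_. PiM UNIV (\<lambda>_. borel)))"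

definition l2_conv :: "(nat \<Rightarrow> 'a measure) \<Rightarrow> (nat \<Rightarrow> 'a \<Rightarrow> complex) \<Rightarrow> complex \<Rightarrow> bool" where
  "l2_conv \<Omega> X c \<longleftrightarrow>
     (\<forall>N\<ge>1. integrable (\<Omega> N) (\<lambda>\<omega>. (cmod (X N \<omega> - c))\<^sup>2)) \<and>
     ((\<lambda>N. \<integral>\<omega>. (cmod (X N \<omega> - c))\<^sup>2 \<partial>\<Omega> N) \<longlonglongrightarrow> 0)"

definition restr :: "'i set \<Rightarrow> ('i \<Rightarrow> complex) \<Rightarrow> ('i \<Rightarrow> complex)" where
  "restr F v = (\<lambda>i. if i \<in> F then v i else 0)"

definition fdd_conv :: "(nat \<Rightarrow> 'a measure) \<Rightarrow> (nat \<Rightarrow> 'i \<Rightarrow> 'a \<Rightarrow> complex)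
     \<Rightarrow> 'b measure \<Rightarrow> ('i \<Rightarrow> 'b \<Rightarrow> complex) \<Rightarrow> bool" where
  "fdd_conv \<Omega> X P Y \<longleftrightarrow>
     (\<forall>F (f :: ('i \<Rightarrow> complex) \<Rightarrow> real). finite F \<longrightarrow> continuous_on UNIV f \<longrightarrow> bounded (range f) \<longrightarrow>
        ((\<lambda>N. \<integral>\<omega>. f (restr F (\<lambda>i. X N i \<omega>)) \<partial>\<Omega> N)
           \<longlonglongrightarrow> (\<integral>\<omega>. f (restr F (\<lambda>i. Y i \<omega>)) \<partial>P)))"

definition centered_gaussian_rv :: "'a measure \<Rightarrow> ('a \<Rightarrow> real) \<Rightarrow> bool" where
  "centered_gaussian_rv M X \<longleftrightarrow> X \<in> borel_measurable M \<and>
     (\<exists>\<sigma>\<ge>0. distr M borel X =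
        (if \<sigma> = 0 then return borel 0 else density lborel (normal_density 0 \<sigma>)))"

text \<open>A complex centered Gaussian family: the real and imaginary parts are jointly
  (real) Gaussian and centered, i.e. every finite real linear combination of them
  is a centered real Gaussian variable.\<close>
definition complex_centered_gaussian :: "'a measure \<Rightarrow> ('i \<Rightarrow> 'a \<Rightarrow> complex) \<Rightarrow> bool" where
  "complex_centered_gaussian M G \<longleftrightarrow>
     (\<forall>i. G i \<in> borel_measurable M) \<and>
     (\<forall>F (a :: 'i \<Rightarrow> real) (b :: 'i \<Rightarrow> real). finite F \<longrightarrow>
        centered_gaussian_rv M (\<lambda>\<omega>. \<Sum>i\<in>F. a i * Re (G i \<omega>) + b i * Im (G i \<omega>)))"

end

theory Submission
  imports Defs "HOL-Library.Function_Algebras"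
begin

text \<open>
  Only the invariance under the rotations \<open>exp (t X)\<close> is used, no Weingarten calculus. Differentiating
  at \<open>t = 0\<close> and summing over matrix units gives loop equations. Write \<open>B\<^sub>i\<close>, \<open>Q\<^sub>i\<close> for the centred
  versions of the random and deterministic matrices and \<open>Y = \<Sum>\<^sub>i Tr (Q\<^sub>i B\<^sub>i)\<close>, arranged to be real.
  For a bounded conjugation invariant \<open>h\<close>, for instance any function of the traces, one obtains
  \<open>N E (h Tr (Q\<^sub>i B\<^sub>i) e^(i s Y)) = i s \<Sum>\<^sub>j E (h (Tr (Q\<^sub>j Q\<^sub>i B\<^sub>i B\<^sub>j) - Tr (Q\<^sub>i B\<^sub>i Q\<^sub>j B\<^sub>j)) e^(i s Y))\<close>.
  Further loop equations show that, after division by \<open>N\<close>, the first trace concentrates at the product of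
  the normalised traces of \<open>Q\<^sub>j Q\<^sub>i\<close> and \<open>B\<^sub>i B\<^sub>j\<close> and the second one vanishes. Hence
  \<open>s \<mapsto> E (h e^(i s Y))\<close> satisfies \<open>\<phi>' = - s V \<phi>\<close> up to a vanishing error, so
  \<open>E (h e^(i Y)) - e^(- V / 2) E h \<longlonglongrightarrow> 0\<close>: the centred part is asymptotically Gaussian and asymptotically
  independent of the traces, and \<open>Tr (A M) - E Tr (A M)\<close> is the sum of that part and
  \<open>(Tr M / N) (Tr A - E Tr A)\<close>. The variance \<open>V\<close> is nonnegative because characteristic functions are
  bounded by one, and this yields the limiting Gaussian family.
\<close>

section \<open>Weak convergence from a separating algebra of test functions\<close>

text \<open>The obstacle is size. No operator norm is assumed bounded: the random matrices have only
  bounded normalised moments, and the deterministic ones, once centred, only a Hilbert--Schmidt norm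
  of order \<open>sqrt N\<close>. So the crucial estimates put Hilbert--Schmidt norms on the
  deterministic factors and operator norms on the random ones, and majorise the latter by the
  Schatten 8-norm \<open>kap\<close>. Its fourth moment is O(\<open>sqrt N\<close>), hence o(N), and
  this makes the fluctuation errors decay like N^(-1/4). The limit of the traces is arbitrary and
  known only through bounded continuous functions. Hence the test functions are products of such
  functions of the traces with exponentials of linear forms in the centred part. These linear forms
  must be real for the exponentials to stay bounded, whereas the calculus is complex linear. The
  real part of a trace is therefore written as half the trace plus half its conjugate, which doubles
  the index set by adding the adjoint matrices.\<close>

lemma fun_separate:
  fixes x y :: "'a \<Rightarrow> 'b::t2_space"
  assumes "x \<noteq> y"
  shows "\<exists>U V. open U \<and> open V \<and> x \<in> U \<and> y \<in> V \<and> U \<inter> V = {}"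
proof -
  obtain i where i: "x i \<noteq> y i" using assms by auto
  obtain U V where UV: "open U" "open V" "x i \<in> U" "y i \<in> V" "U \<inter> V = {}"
    using hausdorff[OF i] by blast
  have "open ((\<lambda>v. v i) -` U)" "open ((\<lambda>v. v i) -` V)"
    by (intro open_vimage UV continuous_on_product_coordinates)+
  then show ?thesis using UV by (intro exI[of _ "(\<lambda>v. v i) -` U"] exI[of _ "(\<lambda>v. v i) -` V"]) auto
qed

text \<open>The three instances have to be declared in this order, because an arity of \<open>fun\<close> for
  \<open>t0_space\<close> is already inherited from \<open>metric_space\<close>.\<close>

instance "fun" :: (type, t2_space) t0_space
  by standard (meson fun_separate disjoint_iff)

instance "fun" :: (type, t2_space) t1_space
  by standard (meson fun_separate disjoint_iff)

instance "fun" :: (type, t2_space) t2_space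
  by standard (rule fun_separate)

lemma continuous_on_coord: "continuous_on UNIV (\<lambda>v::'i \<Rightarrow> complex. v i)"
  by (rule continuous_on_product_coordinates)

lemma continuous_on_fun_family: "(\<And>i. continuous_on S (\<lambda>x. f x i)) \<Longrightarrow> continuous_on S f"
  by (rule continuous_on_coordinatewise_then_product)

text \<open>Over an uncountable index type the Borel sets of the function space exceed the product
  sigma-algebra, so continuity of \<open>f\<close> alone does not give product measurability. As
  \<open>restr F\<close> sees finitely many coordinates, \<open>f\<close> is pulled back along an
  enumeration of \<open>F\<close> to functions on \<open>nat\<close>, where both sigma-algebras
  agree.\<close>

lemma restr_measurable:
  fixes f :: "('i \<Rightarrow> complex) \<Rightarrow> real"
  assumes F: "finite F" and X: "\<And>i. i \<in> F \<Longrightarrow> X i \<in> borel_measurable M" and f: "continuous_on UNIV f"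
  shows "(\<lambda>\<omega>. f (restr F (\<lambda>i. X i \<omega>))) \<in> borel_measurable M"
proof -
  obtain h where h: "bij_betw h F {0..<card F}" using ex_bij_betw_finite_nat[OF F] by blast
  define g where "g = inv_into F h"
  have gh: "g (h i) = i" "h i < card F" if "i \<in> F" for i
    using h that by (auto simp: g_def bij_betw_def)
  have gF: "g m \<in> F" if "m < card F" for m
    using bij_betw_inv_into[OF h] that by (auto simp: g_def bij_betw_def)
  define emb :: "(nat \<Rightarrow> complex) \<Rightarrow> 'i \<Rightarrow> complex" where "emb v i = (if i \<in> F then v (h i) else 0)" for v i
  have "continuous_on UNIV emb"
  proof (rule continuous_on_fun_family)
    show "continuous_on UNIV (\<lambda>v. emb v i)" for i
      by (cases "i \<in> F") (simp_all add: emb_def continuous_on_coord)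
  qed
  then have "continuous_on UNIV (f \<circ> emb)"
    by (rule continuous_on_compose) (rule continuous_on_subset[OF f subset_UNIV])
  then have fe: "f \<circ> emb \<in> borel_measurable (PiM UNIV (\<lambda>_. borel))"
    using borel_measurable_continuous_onI measurable_cong_sets[OF sets_PiM_equal_borel refl] by blast
  \<comment> \<open>The sequence is padded with zeros beyond \<open>card F\<close>, positions that
    \<open>emb\<close> never reads.\<close>
  have "(\<lambda>\<omega> m. if m < card F then X (g m) \<omega> else 0) \<in> measurable M (PiM UNIV (\<lambda>_::nat. borel :: complex measure))"
  proof (rule measurable_PiM_single')
    show "(\<lambda>\<omega>. if m < card F then X (g m) \<omega> else 0) \<in> borel_measurable M" for m
      using X[OF gF] by (cases "m < card F") auto
  qed (auto simp: space_PiM)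
  from measurable_compose[OF this fe] show ?thesis
    by (rule measurable_cong[THEN iffD1, rotated])
       (auto simp: emb_def restr_def gh fun_eq_iff intro!: arg_cong[where f = f])
qed

definition polybox :: "'i set \<Rightarrow> real \<Rightarrow> ('i \<Rightarrow> complex) set" where
  "polybox F r = {v. (\<forall>i\<in>F. cmod (v i) \<le> r) \<and> (\<forall>i. i \<notin> F \<longrightarrow> v i = 0)}"

text \<open>The set is a product of discs and singletons, one factor for every index, so Tychonoff's
  theorem applies whatever the size of the index type.\<close>

lemma compact_polybox: "compact (polybox F r)"
proof -
  have "polybox F r = PiE UNIV (\<lambda>i. if i \<in> F then cball 0 r else {0})"
    by (auto simp: polybox_def PiE_def Pi_def split: if_splits)
  moreover have "compactin (product_topology (\<lambda>_. euclidean) UNIV) (PiE UNIV (\<lambda>i. if i \<in> F then cball 0 r else {0 :: complex}))"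
    unfolding compactin_PiE by (auto simp: compactin_euclidean_iff)
  ultimately show ?thesis
    by (simp add: euclidean_product_topology compactin_euclidean_iff)
qed

lemma clamp_lipschitz: "\<bar>max (- B) (min B x) - max (- B) (min B y)\<bar> \<le> \<bar>x - y\<bar>" for x y B :: real
  by linarith

text \<open>Uniform approximation on a compact set says nothing about the approximant elsewhere;
  composing it with a polynomial close to the truncation at level \<open>B\<close> stays in the algebra
  and makes it globally bounded.\<close>
lemma bounded_Stone_Weierstrass:
  fixes \<A> :: "(('i \<Rightarrow> complex) \<Rightarrow> real) set"
  assumes const: "\<And>c. (\<lambda>_. c) \<in> \<A>"
    and add: "\<And>p q. p \<in> \<A> \<Longrightarrow> q \<in> \<A> \<Longrightarrow> (\<lambda>v. p v + q v) \<in> \<A>"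
    and mult: "\<And>p q. p \<in> \<A> \<Longrightarrow> q \<in> \<A> \<Longrightarrow> (\<lambda>v. p v * q v) \<in> \<A>"
    and cont: "\<And>p. p \<in> \<A> \<Longrightarrow> continuous_on UNIV p"
    and bdd: "\<And>p. p \<in> \<A> \<Longrightarrow> bounded (range p)"
    and sep: "\<And>v w. v \<in> polybox F r \<Longrightarrow> w \<in> polybox F r \<Longrightarrow> v \<noteq> w \<Longrightarrow> \<exists>p\<in>\<A>. p v \<noteq> p w"
    and f: "continuous_on UNIV f" "\<And>v. \<bar>f v\<bar> \<le> B" and e: "e > 0"
  shows "\<exists>p\<in>\<A>. (\<forall>v\<in>polybox F r. \<bar>f v - p v\<bar> \<le> 2 * e) \<and> (\<forall>v. \<bar>p v\<bar> \<le> B + e)"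
proof -
  \<comment> \<open>The locale is over Hausdorff types, which is what the instances for
    \<open>fun\<close> declared above provide.\<close>
  interpret function_ring_on \<A> "polybox F r"
    by unfold_locales (auto intro: compact_polybox const add mult sep continuous_on_subset[OF cont subset_UNIV])
  obtain p where p: "p \<in> \<A>" "\<And>v. v \<in> polybox F r \<Longrightarrow> \<bar>f v - p v\<bar> < e"
    using Stone_Weierstrass_basic[OF continuous_on_subset[OF f(1) subset_UNIV] e] by blast
  obtain m where m: "\<And>v. \<bar>p v\<bar> \<le> m"
    using bdd[OF p(1)] by (auto simp: bounded_iff)
  define cl where "cl x = max (- B) (min B x)" for x :: real
  have "continuous_on {-m..m} cl" unfolding cl_def by (intro continuous_intros)
  then obtain g where g: "real_polynomial_function g" "\<And>x. x \<in> {-m..m} \<Longrightarrow> \<bar>cl x - g x\<bar> < e"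
    using Stone_Weierstrass_real_polynomial_function[OF compact_Icc _ e] by blast
  have "(\<lambda>v. g (p v)) \<in> \<A>"
    using g(1)
  proof induction
    case (linear g)
    obtain c where "g = (\<lambda>x. x * c)" using real_bounded_linear linear by blast
    then show ?case using mult[OF p(1) const[of c]] by simp
  qed (auto intro: const add mult)
  moreover have c: "\<bar>cl (p v) - g (p v)\<bar> < e" for v using g(2)[of "p v"] m[of v] by (auto simp: abs_le_iff)
  moreover have "\<bar>f v - g (p v)\<bar> \<le> 2 * e" if "v \<in> polybox F r" for v
  proof -
    \<comment> \<open>Clamping fixes the values of \<open>f\<close> and does not increase distances,
      so the clamped \<open>p\<close> is still \<open>e\<close>-close to \<open>f\<close> on the
      box.\<close>
    have "cl (f v) = f v" using f(2)[of v] by (auto simp: cl_def abs_le_iff)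
    then have "\<bar>f v - cl (p v)\<bar> \<le> \<bar>f v - p v\<bar>" using clamp_lipschitz[of B "f v" "p v"] by (simp add: cl_def)
    then show ?thesis using p(2)[OF that] c[of v] by linarith
  qed
  moreover have "\<bar>g (p v)\<bar> \<le> B + e" for v
  proof -
    have "\<bar>cl (p v)\<bar> \<le> B" using f(2)[of v] by (auto simp: cl_def)
    then show ?thesis using c[of v] by linarith
  qed
  ultimately show ?thesis by (intro bexI[of _ "\<lambda>v. g (p v)"] conjI ballI allI)
qed

text \<open>While all coordinates stay in the box the integrands differ by at most
  \<open>2 * e\<close>; on the complement, of probability at most \<open>e\<close>, only the sup
  bounds \<open>B\<close> and \<open>B + e\<close> are available.\<close>

lemma (in prob_space) expectation_approx:
  assumes F: "finite F" and X: "\<And>i. i \<in> F \<Longrightarrow> X i \<in> borel_measurable M"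
    and fp: "continuous_on UNIV f" "continuous_on UNIV p" "\<And>v. \<bar>f v\<bar> \<le> B" "\<And>v. \<bar>p v\<bar> \<le> B + e"
      "\<And>v. v \<in> polybox F r \<Longrightarrow> \<bar>f v - p v\<bar> \<le> 2 * e"
    and e: "0 \<le> e" "prob {\<omega>\<in>space M. \<exists>i\<in>F. cmod (X i \<omega>) > r} \<le> e"
  shows "\<bar>(\<integral>\<omega>. f (restr F (\<lambda>i. X i \<omega>)) \<partial>M) - (\<integral>\<omega>. p (restr F (\<lambda>i. X i \<omega>)) \<partial>M)\<bar> \<le> 2 * e + (2 * B + e) * e"
proof -
  let ?X = "\<lambda>\<omega>. restr F (\<lambda>i. X i \<omega>)"
  define bad where "bad = {\<omega>\<in>space M. \<exists>i\<in>F. cmod (X i \<omega>) > r}"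
  have bad: "bad \<in> sets M"
  proof -
    have "bad = (\<Union>i\<in>F. {\<omega>\<in>space M. cmod (X i \<omega>) > r})" by (auto simp: bad_def)
    then show ?thesis using F X by (auto intro!: sets.finite_UN borel_measurable_less)
  qed
  have B: "0 \<le> B" using fp(3)[of undefined] by linarith
  have m: "(\<lambda>\<omega>. f (?X \<omega>)) \<in> borel_measurable M" "(\<lambda>\<omega>. p (?X \<omega>)) \<in> borel_measurable M"
    by (intro restr_measurable F X fp; assumption)+
  have i: "integrable M (\<lambda>\<omega>. f (?X \<omega>))" "integrable M (\<lambda>\<omega>. p (?X \<omega>))"
    using fp by (auto intro!: integrable_const_bound[where B = "B + e"] m AE_I2 order_trans[OF fp(3)] simp: e)
  have "\<bar>(\<integral>\<omega>. f (?X \<omega>) \<partial>M) - (\<integral>\<omega>. p (?X \<omega>) \<partial>M)\<bar> = \<bar>\<integral>\<omega>. f (?X \<omega>) - p (?X \<omega>) \<partial>M\<bar>"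
    using i by simp
  also have "\<dots> \<le> (\<integral>\<omega>. \<bar>f (?X \<omega>) - p (?X \<omega>)\<bar> \<partial>M)" by (rule integral_abs_bound)
  also have "\<dots> \<le> (\<integral>\<omega>. 2 * e + (2 * B + e) * indicator bad \<omega> \<partial>M)"
  proof (rule integral_mono)
    show "integrable M (\<lambda>\<omega>. 2 * e + (2 * B + e) * indicator bad \<omega>)" using bad by (simp add: emeasure_eq_measure)
    fix \<omega> assume \<omega>: "\<omega> \<in> space M"
    show "\<bar>f (?X \<omega>) - p (?X \<omega>)\<bar> \<le> 2 * e + (2 * B + e) * indicator bad \<omega>"
    proof (cases "\<omega> \<in> bad")
      case True
      then show ?thesis using fp(3)[of "?X \<omega>"] fp(4)[of "?X \<omega>"] e(1) by simp
    next
      case False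
      then have "?X \<omega> \<in> polybox F r" using \<omega> by (auto simp: bad_def polybox_def restr_def not_less)
      then show ?thesis using fp(5) False by simp
    qed
  qed (use i in auto)
  also have "\<dots> = 2 * e + (2 * B + e) * prob bad" using bad prob_space by (simp add: emeasure_eq_measure)
  also have "\<dots> \<le> 2 * e + (2 * B + e) * e" using e B by (intro add_left_mono mult_left_mono) (auto simp: bad_def)
  finally show ?thesis .
qed

section \<open>Tightness and weak convergence from a separating algebra\<close>

lemma (in prob_space) tight_single:
  fixes Y :: "'a \<Rightarrow> complex"
  assumes Y: "Y \<in> borel_measurable M" and e: "e > 0"
  shows "\<exists>r. prob {\<omega>\<in>space M. cmod (Y \<omega>) > r} \<le> e"
proof -
  have "(\<lambda>n. prob {\<omega>\<in>space M. cmod (Y \<omega>) > real n}) \<longlonglongrightarrow> prob (\<Inter>n. {\<omega>\<in>space M. cmod (Y \<omega>) > real n})"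
    by (rule finite_Lim_measure_decseq) (use Y in \<open>auto simp: decseq_def\<close>)
  moreover have "(\<Inter>n. {\<omega>\<in>space M. cmod (Y \<omega>) > real n}) = {}"
  proof -
    have "\<exists>n. \<not> real n < cmod (Y \<omega>)" for \<omega>
      using real_arch_simple[of "cmod (Y \<omega>)"] by (auto simp: not_less)
    then show ?thesis by blast
  qed
  ultimately have "(\<lambda>n. prob {\<omega>\<in>space M. cmod (Y \<omega>) > real n}) \<longlonglongrightarrow> 0" by simp
  from order_tendstoD(2)[OF this e] have "\<forall>\<^sub>F n in sequentially. prob {\<omega>\<in>space M. cmod (Y \<omega>) > real n} \<le> e"
    by eventually_elim simp
  then show ?thesis by (meson eventually_sequentially order_refl)
qed

lemma (in prob_space) tight_union:
  assumes F: "finite F" and X: "\<And>i. i \<in> F \<Longrightarrow> X i \<in> borel_measurable M"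
    and b: "\<And>i. i \<in> F \<Longrightarrow> prob {\<omega>\<in>space M. cmod (X i \<omega>) > \<rho> i} \<le> e / real (card F)"
    and r: "\<And>i. i \<in> F \<Longrightarrow> \<rho> i \<le> r" and e: "0 \<le> e"
  shows "prob {\<omega>\<in>space M. \<exists>i\<in>F. cmod (X i \<omega>) > r} \<le> e"
proof -
  have "{\<omega>\<in>space M. \<exists>i\<in>F. cmod (X i \<omega>) > r} \<subseteq> (\<Union>i\<in>F. {\<omega>\<in>space M. cmod (X i \<omega>) > \<rho> i})"
    using r by force
  then have "prob {\<omega>\<in>space M. \<exists>i\<in>F. cmod (X i \<omega>) > r} \<le> prob (\<Union>i\<in>F. {\<omega>\<in>space M. cmod (X i \<omega>) > \<rho> i})"
    by (intro finite_measure_mono) (use F X in \<open>auto intro!: sets.finite_UN borel_measurable_less\<close>)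
  also have "\<dots> \<le> (\<Sum>i\<in>F. prob {\<omega>\<in>space M. cmod (X i \<omega>) > \<rho> i})"
    by (intro finite_measure_subadditive_finite F) (use X in \<open>auto intro!: borel_measurable_less\<close>)
  also have "\<dots> \<le> (\<Sum>i\<in>F. e / real (card F))" by (intro sum_mono b)
  also have "\<dots> \<le> e" using e by simp
  finally show ?thesis .
qed

text \<open>Tightness puts the laws, up to small probability, on one compact box, where the algebra
  is uniformly dense; the global bound on the approximant controls the rest. The limit law joins the
  same box because a single law is always tight.\<close>

lemma weak_convergence_algebra:
  fixes \<Omega> :: "nat \<Rightarrow> 'a measure" and X :: "nat \<Rightarrow> 'i \<Rightarrow> 'a \<Rightarrow> complex" and P :: "'b measure"
    and Y :: "'i \<Rightarrow> 'b \<Rightarrow> complex" and \<A> :: "(('i \<Rightarrow> complex) \<Rightarrow> real) set" and f :: "('i \<Rightarrow> complex) \<Rightarrow> real"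
  assumes F: "finite F"
    and \<Omega>: "\<And>N. N \<ge> 1 \<Longrightarrow> prob_space (\<Omega> N)"
    and X: "\<And>N i. N \<ge> 1 \<Longrightarrow> i \<in> F \<Longrightarrow> X N i \<in> borel_measurable (\<Omega> N)"
    and P: "prob_space P" and Y: "\<And>i. i \<in> F \<Longrightarrow> Y i \<in> borel_measurable P"
    and tight: "\<And>i e. i \<in> F \<Longrightarrow> e > 0 \<Longrightarrow>
      \<exists>r. \<forall>\<^sub>F N in sequentially. measure (\<Omega> N) {\<omega>\<in>space (\<Omega> N). cmod (X N i \<omega>) > r} \<le> e"
    and const: "\<And>c. (\<lambda>_. c) \<in> \<A>"
    and add: "\<And>p q. p \<in> \<A> \<Longrightarrow> q \<in> \<A> \<Longrightarrow> (\<lambda>v. p v + q v) \<in> \<A>"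
    and mult: "\<And>p q. p \<in> \<A> \<Longrightarrow> q \<in> \<A> \<Longrightarrow> (\<lambda>v. p v * q v) \<in> \<A>"
    and cont: "\<And>p. p \<in> \<A> \<Longrightarrow> continuous_on UNIV p"
    and bdd: "\<And>p. p \<in> \<A> \<Longrightarrow> bounded (range p)"
    and sep: "\<And>v w. (\<And>i. i \<notin> F \<Longrightarrow> v i = 0) \<Longrightarrow> (\<And>i. i \<notin> F \<Longrightarrow> w i = 0) \<Longrightarrow> v \<noteq> w \<Longrightarrow> \<exists>p\<in>\<A>. p v \<noteq> p w"
    and conv: "\<And>p. p \<in> \<A> \<Longrightarrow>
      (\<lambda>N. \<integral>\<omega>. p (restr F (\<lambda>i. X N i \<omega>)) \<partial>\<Omega> N) \<longlonglongrightarrow> (\<integral>\<omega>. p (restr F (\<lambda>i. Y i \<omega>)) \<partial>P)"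
    and f: "continuous_on UNIV f" "bounded (range f)"
  shows "(\<lambda>N. \<integral>\<omega>. f (restr F (\<lambda>i. X N i \<omega>)) \<partial>\<Omega> N) \<longlonglongrightarrow> (\<integral>\<omega>. f (restr F (\<lambda>i. Y i \<omega>)) \<partial>P)"
proof (rule tendstoI)
  fix \<epsilon> :: real assume \<epsilon>: "\<epsilon> > 0"
  interpret P: prob_space P by (rule P)
  obtain B where B: "\<And>v. \<bar>f v\<bar> \<le> B" using f(2) by (auto simp: bounded_iff)
  have B0: "0 \<le> B" using B[of undefined] by linarith
  \<comment> \<open>With \<open>d\<close> as below, \<open>2 * d + e\<close> equals
    \<open>e * (4 * B + 5 + 2 * e)\<close>. For \<open>e \<le> 1\<close> this is less than
    \<open>e * (4 * B + 8)\<close>, which the quotient keeps at most \<epsilon>.\<close>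
  define e where "e = min 1 (\<epsilon> / (4 * B + 8))"
  have e: "0 < e" "e \<le> 1" "e * (4 * B + 8) \<le> \<epsilon>"
  proof -
    have "e \<le> \<epsilon> / (4 * B + 8)" by (simp add: e_def)
    then show "e * (4 * B + 8) \<le> \<epsilon>" using B0 by (simp add: pos_le_divide_eq)
  qed (use \<epsilon> B0 in \<open>auto simp: e_def\<close>)
  \<comment> \<open>The share of each coordinate in the union bound. For empty \<open>F\<close> it
    is 0, and then nothing is claimed about it.\<close>
  define e' where "e' = e / real (card F)"
  have e': "e' > 0" if "i \<in> F" for i
  proof -
    have "0 < real (card F)" using that F by (auto simp: card_gt_0_iff)
    then show ?thesis using e(1) by (simp add: e'_def)
  qed
  have "\<exists>r. \<forall>i\<in>F. \<forall>\<^sub>F N in sequentially. measure (\<Omega> N) {\<omega>\<in>space (\<Omega> N). cmod (X N i \<omega>) > r i} \<le> e'"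
    using tight e' by (intro bchoice) blast
  then obtain \<rho> where \<rho>: "\<And>i. i \<in> F \<Longrightarrow> \<forall>\<^sub>F N in sequentially. measure (\<Omega> N) {\<omega>\<in>space (\<Omega> N). cmod (X N i \<omega>) > \<rho> i} \<le> e'" by blast
  have "\<exists>r. \<forall>i\<in>F. measure P {\<omega>\<in>space P. cmod (Y i \<omega>) > r i} \<le> e'"
    using P.tight_single[OF Y e'] by (intro bchoice) blast
  then obtain \<rho>' where \<rho>': "\<And>i. i \<in> F \<Longrightarrow> measure P {\<omega>\<in>space P. cmod (Y i \<omega>) > \<rho>' i} \<le> e'" by blast
  define r where "r = (\<Sum>i\<in>F. \<bar>\<rho> i\<bar> + \<bar>\<rho>' i\<bar>)"
  have "\<bar>\<rho> i\<bar> + \<bar>\<rho>' i\<bar> \<le> r" if "i \<in> F" for i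
    unfolding r_def using that F by (intro member_le_sum) auto
  then have r: "\<rho> i \<le> r" "\<rho>' i \<le> r" if "i \<in> F" for i
    using that by fastforce+
  obtain p where p: "p \<in> \<A>" "\<And>v. v \<in> polybox F r \<Longrightarrow> \<bar>f v - p v\<bar> \<le> 2 * e" "\<And>v. \<bar>p v\<bar> \<le> B + e"
  proof -
    have "\<exists>p\<in>\<A>. p v \<noteq> p w" if "v \<in> polybox F r" "w \<in> polybox F r" "v \<noteq> w" for v w
      using that by (intro sep) (auto simp: polybox_def)
    from bounded_Stone_Weierstrass[OF const add mult cont bdd this f(1) B e(1)] show ?thesis
      using that by blast
  qed
  define d where "d = 2 * e + (2 * B + e) * e"
  have d: "2 * d + e < \<epsilon>"
  proof -
    have "2 * d + e = e * (4 * B + 5 + 2 * e)" by (simp add: d_def algebra_simps)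
    also have "\<dots> < e * (4 * B + 8)" using e by (intro mult_strict_left_mono) auto
    finally show ?thesis using e(3) by linarith
  qed
  have Yd: "\<bar>(\<integral>\<omega>. f (restr F (\<lambda>i. Y i \<omega>)) \<partial>P) - (\<integral>\<omega>. p (restr F (\<lambda>i. Y i \<omega>)) \<partial>P)\<bar> \<le> d"
    unfolding d_def
    by (rule P.expectation_approx[where r = r, OF F Y f(1) cont[OF p(1)] B p(3,2)])
       (use e \<rho>' r in \<open>auto intro!: P.tight_union[OF F Y, where \<rho> = \<rho>'] simp: e'_def\<close>)
  have "\<forall>\<^sub>F N in sequentially. \<forall>i\<in>F. measure (\<Omega> N) {\<omega>\<in>space (\<Omega> N). cmod (X N i \<omega>) > \<rho> i} \<le> e'"
    using \<rho> F by (simp add: eventually_ball_finite)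
  moreover have "\<forall>\<^sub>F N in sequentially. dist (\<integral>\<omega>. p (restr F (\<lambda>i. X N i \<omega>)) \<partial>\<Omega> N) (\<integral>\<omega>. p (restr F (\<lambda>i. Y i \<omega>)) \<partial>P) < e"
    using tendstoD[OF conv[OF p(1)] e(1)] .
  moreover note eventually_ge_at_top[of "1::nat"]
  ultimately show "\<forall>\<^sub>F N in sequentially. dist (\<integral>\<omega>. f (restr F (\<lambda>i. X N i \<omega>)) \<partial>\<Omega> N) (\<integral>\<omega>. f (restr F (\<lambda>i. Y i \<omega>)) \<partial>P) < \<epsilon>"
  proof eventually_elim
    case (elim N)
    interpret N: prob_space "\<Omega> N" by (rule \<Omega>[OF elim(3)])
    have "\<bar>(\<integral>\<omega>. f (restr F (\<lambda>i. X N i \<omega>)) \<partial>\<Omega> N) - (\<integral>\<omega>. p (restr F (\<lambda>i. X N i \<omega>)) \<partial>\<Omega> N)\<bar> \<le> d"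
      unfolding d_def
      by (rule N.expectation_approx[where r = r, OF F X[OF elim(3)] f(1) cont[OF p(1)] B p(3,2)])
         (use e elim r in \<open>auto intro!: N.tight_union[OF F X[OF elim(3)], where \<rho> = \<rho>] simp: e'_def\<close>)
    with Yd elim(2) d show ?case unfolding dist_real_def by linarith
  qed
qed

section \<open>Test functions mixing a given algebra with trigonometric functions\<close>

definition trig_phase :: "'i set \<Rightarrow> ('i \<Rightarrow> complex) \<Rightarrow> ('i \<Rightarrow> complex) \<Rightarrow> real" where
  "trig_phase G c v = (\<Sum>i\<in>G. Re (c i * v i))"

text \<open>Sines and cosines replace characters because Stone--Weierstrass is applied to real
  functions. Complex coefficients in \<open>trig_phase\<close> yield every real linear form in the
  real and imaginary parts, and phases add, so the product-to-sum formulas close the set under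
  multiplication. The factor \<open>h\<close> tests the coordinates outside
  \<open>G\<close>.\<close>

inductive_set trig_algebra :: "(('i \<Rightarrow> complex) \<Rightarrow> real) set \<Rightarrow> 'i set \<Rightarrow> (('i \<Rightarrow> complex) \<Rightarrow> real) set"
  for \<H> G where
  cos: "h \<in> \<H> \<Longrightarrow> (\<lambda>v. h v * cos (trig_phase G c v)) \<in> trig_algebra \<H> G"
| sin: "h \<in> \<H> \<Longrightarrow> (\<lambda>v. h v * sin (trig_phase G c v)) \<in> trig_algebra \<H> G"
| add: "p \<in> trig_algebra \<H> G \<Longrightarrow> q \<in> trig_algebra \<H> G \<Longrightarrow> (\<lambda>v. p v + q v) \<in> trig_algebra \<H> G"

lemma trig_phase_lin:
  "trig_phase G (\<lambda>i. c i + d i) v = trig_phase G c v + trig_phase G d v"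
  "trig_phase G (\<lambda>i. c i - d i) v = trig_phase G c v - trig_phase G d v"
  "trig_phase G (\<lambda>i. 0) v = 0"
  by (simp_all add: trig_phase_def algebra_simps sum.distrib sum_subtractf)

lemma continuous_trig_phase: "continuous_on UNIV (trig_phase G c)"
  unfolding trig_phase_def by (intro continuous_intros continuous_on_coord)

lemma trig_algebra_mult:
  assumes \<H>: "\<And>c. (\<lambda>_. c) \<in> \<H>" "\<And>h k. h \<in> \<H> \<Longrightarrow> k \<in> \<H> \<Longrightarrow> (\<lambda>v. h v * k v) \<in> \<H>"
    and p: "p \<in> trig_algebra \<H> G" and q: "q \<in> trig_algebra \<H> G"
  shows "(\<lambda>v. p v * q v) \<in> trig_algebra \<H> G"
proof -
  let ?L = "trig_phase G"
  have half: "(\<lambda>v. h v * k v / 2) \<in> \<H>" "(\<lambda>v. - (h v * k v / 2)) \<in> \<H>" if "h \<in> \<H>" "k \<in> \<H>" for h k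
    using \<H>(2)[OF \<H>(2)[OF that] \<H>(1)[of "1/2"]] \<H>(2)[OF \<H>(2)[OF that] \<H>(1)[of "-1/2"]] by simp_all
  have *: "(\<lambda>v. p v * (k v * cos (?L d v))) \<in> trig_algebra \<H> G \<and> (\<lambda>v. p v * (k v * sin (?L d v))) \<in> trig_algebra \<H> G"
    if k: "k \<in> \<H>" for k d
    using p
  proof induction
    case (cos h c)
    have "(\<lambda>v. h v * cos (?L c v) * (k v * cos (?L d v)))
      = (\<lambda>v. (h v * k v / 2) * cos (?L (\<lambda>i. c i - d i) v) + (h v * k v / 2) * cos (?L (\<lambda>i. c i + d i) v))"
      by (simp add: trig_phase_lin cos_add cos_diff algebra_simps fun_eq_iff)
    moreover have "(\<lambda>v. h v * cos (?L c v) * (k v * sin (?L d v)))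
      = (\<lambda>v. (h v * k v / 2) * sin (?L (\<lambda>i. c i + d i) v) + (- (h v * k v / 2)) * sin (?L (\<lambda>i. c i - d i) v))"
      by (simp add: trig_phase_lin sin_add sin_diff algebra_simps fun_eq_iff)
    ultimately show ?case
      by (simp only:) (intro conjI trig_algebra.add trig_algebra.cos trig_algebra.sin half cos k)
  next
    case (sin h c)
    have "(\<lambda>v. h v * sin (?L c v) * (k v * cos (?L d v)))
      = (\<lambda>v. (h v * k v / 2) * sin (?L (\<lambda>i. c i - d i) v) + (h v * k v / 2) * sin (?L (\<lambda>i. c i + d i) v))"
      by (simp add: trig_phase_lin sin_add sin_diff algebra_simps fun_eq_iff)
    moreover have "(\<lambda>v. h v * sin (?L c v) * (k v * sin (?L d v)))
      = (\<lambda>v. (h v * k v / 2) * cos (?L (\<lambda>i. c i - d i) v) + (- (h v * k v / 2)) * cos (?L (\<lambda>i. c i + d i) v))"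
      by (simp add: trig_phase_lin cos_add cos_diff algebra_simps fun_eq_iff)
    ultimately show ?case
      by (simp only:) (intro conjI trig_algebra.add trig_algebra.cos trig_algebra.sin half sin k)
  next
    case (add p q)
    then show ?case by (simp add: distrib_right trig_algebra.add)
  qed
  show ?thesis using q
    by induction (use * in \<open>auto simp: distrib_left intro: trig_algebra.add\<close>)
qed

text \<open>A hybrid of Levy's continuity theorem and the definition of weak convergence:
  coordinates in \<open>G\<close> are tested by characters, the others by \<H>. With
  \<open>G = F\<close> and the constants as \<H> it is the continuity theorem for tight sequences;
  with a product on the limit side, \<open>conv\<close> expresses asymptotic independence.\<close>

theorem weak_convergence_trig:
  fixes \<Omega> :: "nat \<Rightarrow> 'a measure" and X :: "nat \<Rightarrow> 'i \<Rightarrow> 'a \<Rightarrow> complex" and P :: "'b measure"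
    and Y :: "'i \<Rightarrow> 'b \<Rightarrow> complex" and \<H> :: "(('i \<Rightarrow> complex) \<Rightarrow> real) set" and f :: "('i \<Rightarrow> complex) \<Rightarrow> real"
  assumes F: "finite F" "G \<subseteq> F"
    and \<Omega>: "\<And>N. N \<ge> 1 \<Longrightarrow> prob_space (\<Omega> N)"
    and X: "\<And>N i. N \<ge> 1 \<Longrightarrow> i \<in> F \<Longrightarrow> X N i \<in> borel_measurable (\<Omega> N)"
    and P: "prob_space P" and Y: "\<And>i. i \<in> F \<Longrightarrow> Y i \<in> borel_measurable P"
    and tight: "\<And>i e. i \<in> F \<Longrightarrow> e > 0 \<Longrightarrow>
      \<exists>r. \<forall>\<^sub>F N in sequentially. measure (\<Omega> N) {\<omega>\<in>space (\<Omega> N). cmod (X N i \<omega>) > r} \<le> e"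
    and const: "\<And>c. (\<lambda>_. c) \<in> \<H>"
    and mult: "\<And>h k. h \<in> \<H> \<Longrightarrow> k \<in> \<H> \<Longrightarrow> (\<lambda>v. h v * k v) \<in> \<H>"
    and cont: "\<And>h. h \<in> \<H> \<Longrightarrow> continuous_on UNIV h"
    and bdd: "\<And>h. h \<in> \<H> \<Longrightarrow> bounded (range h)"
    and sep: "\<And>v w i. i \<in> F - G \<Longrightarrow> v i \<noteq> w i \<Longrightarrow> \<exists>h\<in>\<H>. h v \<noteq> h w"
    and conv: "\<And>h c. h \<in> \<H> \<Longrightarrow>
      (\<lambda>N. \<integral>\<omega>. complex_of_real (h (restr F (\<lambda>i. X N i \<omega>))) * iexp (trig_phase G c (\<lambda>i. X N i \<omega>)) \<partial>\<Omega> N)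
        \<longlonglongrightarrow> (\<integral>\<omega>. complex_of_real (h (restr F (\<lambda>i. Y i \<omega>))) * iexp (trig_phase G c (\<lambda>i. Y i \<omega>)) \<partial>P)"
    and f: "continuous_on UNIV f" "bounded (range f)"
  shows "(\<lambda>N. \<integral>\<omega>. f (restr F (\<lambda>i. X N i \<omega>)) \<partial>\<Omega> N) \<longlonglongrightarrow> (\<integral>\<omega>. f (restr F (\<lambda>i. Y i \<omega>)) \<partial>P)"
proof (rule weak_convergence_algebra[OF F(1) \<Omega> X P Y tight, where \<A> = "trig_algebra \<H> G"])
  let ?A = "trig_algebra \<H> G"
  have bm: "bounded (range (\<lambda>v. h v * g v))" if h: "bounded (range h)" and g: "\<And>v. \<bar>g v\<bar> \<le> 1" for h g :: "('i \<Rightarrow> complex) \<Rightarrow> real"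
  proof -
    obtain b where b: "\<And>v. \<bar>h v\<bar> \<le> b" using h by (auto simp: bounded_iff)
    have "\<bar>h v * g v\<bar> \<le> b * 1" for v
      unfolding abs_mult using b[of v] g[of v] by (intro mult_mono) auto
    then show ?thesis by (auto simp: bounded_iff)
  qed
  show cA: "continuous_on UNIV p" if "p \<in> ?A" for p using that
  proof induction
    case (add p q)
    show ?case by (rule continuous_on_add[OF add(3,4)])
  qed (intro continuous_on_mult cont continuous_on_cos continuous_on_sin continuous_trig_phase; assumption)+
  show bA: "bounded (range p)" if "p \<in> ?A" for p using that
  proof induction
    case (add p q)
    show ?case using bounded_plus_comp[OF add(3,4)] .
  qed (rule bm, erule bdd, simp)+
  show "(\<lambda>_. c) \<in> ?A" for c
    using trig_algebra.cos[OF const[of c], of G "\<lambda>_. 0"] by (simp add: trig_phase_lin)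
  show "(\<lambda>v. p v * q v) \<in> ?A" if "p \<in> ?A" "q \<in> ?A" for p q
    using trig_algebra_mult[OF const mult that] .
  show "\<exists>p\<in>?A. p v \<noteq> p w" if z: "\<And>i. i \<notin> F \<Longrightarrow> v i = 0" "\<And>i. i \<notin> F \<Longrightarrow> w i = 0" and ne: "v \<noteq> w" for v w
  proof -
    obtain i where i: "v i \<noteq> w i" using ne by auto
    then have iF: "i \<in> F" using z by metis
    show ?thesis
    proof (cases "i \<in> G")
      case False
      with iF have "i \<in> F - G" by simp
      from sep[of i v w, OF this i] obtain h where h: "h \<in> \<H>" "h v \<noteq> h w" by blast
      then show ?thesis using trig_algebra.cos[OF h(1), of G "\<lambda>_. 0"] by (auto simp: trig_phase_lin)
    next
      case True
      \<comment> \<open>The coefficient normalises the difference of the two phases to 1. Angles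
        differing by 1 cannot share both cosine and sine, since \<open>cos 1\<close> is not
        1.\<close>
      define c where "c = (\<lambda>j. if j = i then 1 / (v i - w i) else 0)"
      have fG: "finite G" using F finite_subset by blast
      have "trig_phase G c v - trig_phase G c w = (\<Sum>j\<in>G. if j = i then 1 else 0)"
        unfolding trig_phase_def sum_subtractf[symmetric]
      proof (intro sum.cong refl)
        fix j
        have "Re (c j * v j) - Re (c j * w j) = Re (c j * (v j - w j))"
          by (simp only: right_diff_distrib minus_complex.simps)
        also have "c j * (v j - w j) = (if j = i then 1 else 0)" using i by (simp add: c_def)
        finally show "Re (c j * v j) - Re (c j * w j) = (if j = i then 1 else 0)" by simp
      qed
      then have L: "trig_phase G c v = trig_phase G c w + 1" using True fG by simp
      have "(\<lambda>v. 1 * cos (trig_phase G c v)) \<in> ?A" "(\<lambda>v. 1 * sin (trig_phase G c v)) \<in> ?A"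
        by (intro trig_algebra.intros const)+
      moreover have "cos (trig_phase G c v) \<noteq> cos (trig_phase G c w) \<or> sin (trig_phase G c v) \<noteq> sin (trig_phase G c w)"
      proof (rule ccontr)
        assume "\<not> ?thesis"
        then have "cos (trig_phase G c v - trig_phase G c w) = 1" by (simp add: cos_diff)
        then have "cos 1 = (1::real)" using L by simp
        then show False using cos_monotone_0_pi[of 0 1] pi_gt3 by simp
      qed
      ultimately show ?thesis by (metis (no_types, lifting) mult_1)
    qed
  qed
  have integ: "integrable M (\<lambda>\<omega>. p (restr F (\<lambda>i. Z i \<omega>)))"
    if M: "prob_space M" "\<And>i. i \<in> F \<Longrightarrow> Z i \<in> borel_measurable M" and p: "p \<in> ?A" for M :: "'m measure" and Z p
  proof -
    interpret M: prob_space M by (rule M)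
    obtain b where "\<And>v. \<bar>p v\<bar> \<le> b" using bA[OF p] by (auto simp: bounded_iff)
    then show ?thesis
      by (intro M.integrable_const_bound[where B = b]) (auto intro!: restr_measurable F(1) M(2) cA p)
  qed
  \<comment> \<open>Splits the complex integrals of \<open>conv\<close> into those of the cosine and
    sine generators of the real algebra.\<close>
  have ri: "integrable M (\<lambda>\<omega>. complex_of_real (h (restr F (\<lambda>i. Z i \<omega>))) * iexp (trig_phase G c (\<lambda>i. Z i \<omega>)))
     \<and> (\<integral>\<omega>. h (restr F (\<lambda>i. Z i \<omega>)) * cos (trig_phase G c (restr F (\<lambda>i. Z i \<omega>))) \<partial>M)
       = Re (\<integral>\<omega>. complex_of_real (h (restr F (\<lambda>i. Z i \<omega>))) * iexp (trig_phase G c (\<lambda>i. Z i \<omega>)) \<partial>M)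
     \<and> (\<integral>\<omega>. h (restr F (\<lambda>i. Z i \<omega>)) * sin (trig_phase G c (restr F (\<lambda>i. Z i \<omega>))) \<partial>M)
       = Im (\<integral>\<omega>. complex_of_real (h (restr F (\<lambda>i. Z i \<omega>))) * iexp (trig_phase G c (\<lambda>i. Z i \<omega>)) \<partial>M)"
    if M: "prob_space M" "\<And>i. i \<in> F \<Longrightarrow> Z i \<in> borel_measurable M" and h: "h \<in> \<H>" for M :: "'m measure" and Z h c
  proof -
    let ?R = "\<lambda>\<omega>. restr F (\<lambda>i. Z i \<omega>)"
    have tp: "trig_phase G c (?R \<omega>) = trig_phase G c (\<lambda>i. Z i \<omega>)" for \<omega>
      using F(2) unfolding trig_phase_def by (intro sum.cong refl) (auto simp: restr_def)
    let ?g = "\<lambda>\<omega>. complex_of_real (h (?R \<omega>)) * iexp (trig_phase G c (\<lambda>i. Z i \<omega>))"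
    have c: "integrable M (\<lambda>\<omega>. h (?R \<omega>) * cos (trig_phase G c (?R \<omega>)))"
      and s: "integrable M (\<lambda>\<omega>. h (?R \<omega>) * sin (trig_phase G c (?R \<omega>)))"
      using integ[OF M trig_algebra.cos[OF h, where G = G and c = c]] integ[OF M trig_algebra.sin[OF h, where G = G and c = c]] by simp_all
    have g: "?g \<omega> = of_real (h (?R \<omega>) * cos (trig_phase G c (?R \<omega>))) + \<i> * of_real (h (?R \<omega>) * sin (trig_phase G c (?R \<omega>)))" for \<omega>
      unfolding tp by (simp add: complex_eq_iff flip: cis_conv_exp)
    have "integrable M ?g" unfolding g
      using c s by (intro Bochner_Integration.integrable_add integrable_mult_right) (simp_all del: of_real_mult)
    moreover have "(\<integral>\<omega>. ?g \<omega> \<partial>M) = of_real (\<integral>\<omega>. h (?R \<omega>) * cos (trig_phase G c (?R \<omega>)) \<partial>M) + \<i> * of_real (\<integral>\<omega>. h (?R \<omega>) * sin (trig_phase G c (?R \<omega>)) \<partial>M)"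
      unfolding g using c s by (simp del: of_real_mult)
    ultimately show ?thesis by simp
  qed
  show "(\<lambda>N. \<integral>\<omega>. p (restr F (\<lambda>i. X N i \<omega>)) \<partial>\<Omega> N) \<longlonglongrightarrow> (\<integral>\<omega>. p (restr F (\<lambda>i. Y i \<omega>)) \<partial>P)" if "p \<in> ?A" for p
    using that
  proof induction
    case (cos h c)
    have "\<forall>\<^sub>F N in sequentially. Re (\<integral>\<omega>. complex_of_real (h (restr F (\<lambda>i. X N i \<omega>))) * iexp (trig_phase G c (\<lambda>i. X N i \<omega>)) \<partial>\<Omega> N)
        = (\<integral>\<omega>. h (restr F (\<lambda>i. X N i \<omega>)) * cos (trig_phase G c (restr F (\<lambda>i. X N i \<omega>))) \<partial>\<Omega> N)"
      using eventually_ge_at_top[of "1::nat"] by eventually_elim (use ri[OF \<Omega> X cos] in simp)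
    from Lim_transform_eventually[OF tendsto_Re[OF conv[OF cos]] this] show ?case
      using ri[OF P Y cos] by simp
  next
    case (sin h c)
    have "\<forall>\<^sub>F N in sequentially. Im (\<integral>\<omega>. complex_of_real (h (restr F (\<lambda>i. X N i \<omega>))) * iexp (trig_phase G c (\<lambda>i. X N i \<omega>)) \<partial>\<Omega> N)
        = (\<integral>\<omega>. h (restr F (\<lambda>i. X N i \<omega>)) * sin (trig_phase G c (restr F (\<lambda>i. X N i \<omega>))) \<partial>\<Omega> N)"
      using eventually_ge_at_top[of "1::nat"] by eventually_elim (use ri[OF \<Omega> X sin] in simp)
    from Lim_transform_eventually[OF tendsto_Im[OF conv[OF sin]] this] show ?case
      using ri[OF P Y sin] by simp
  next
    case (add p q)
    have "\<forall>\<^sub>F N in sequentially. (\<integral>\<omega>. p (restr F (\<lambda>i. X N i \<omega>)) \<partial>\<Omega> N) + (\<integral>\<omega>. q (restr F (\<lambda>i. X N i \<omega>)) \<partial>\<Omega> N)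
        = (\<integral>\<omega>. p (restr F (\<lambda>i. X N i \<omega>)) + q (restr F (\<lambda>i. X N i \<omega>)) \<partial>\<Omega> N)"
      using eventually_ge_at_top[of "1::nat"]
      by eventually_elim (use integ[OF \<Omega> X add(1)] integ[OF \<Omega> X add(2)] in simp)
    from Lim_transform_eventually[OF tendsto_add[OF add(3,4)] this] show ?case
      using integ[OF P Y add(1)] integ[OF P Y add(2)] by simp
  qed
qed (auto intro: f trig_algebra.add)

section \<open>Gaussian families with prescribed covariance\<close>

text \<open>Symmetric elimination of one index at a time, as in the Cholesky decomposition: either
  the pivot \<open>k x x\<close> vanishes, and positivity kills its whole row, or the Schur
  complement is again positive semidefinite.\<close>

lemma psd_factorization:
  fixes k :: "'j \<Rightarrow> 'j \<Rightarrow> real"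
  assumes "finite J" "\<And>i j. i \<in> J \<Longrightarrow> j \<in> J \<Longrightarrow> k i j = k j i"
    "\<And>r. 0 \<le> (\<Sum>i\<in>J. \<Sum>j\<in>J. r i * r j * k i j)"
  shows "\<exists>(n::nat) v. \<forall>i\<in>J. \<forall>j\<in>J. k i j = (\<Sum>m<n. v i m * v j m)"
  using assms
proof (induction J arbitrary: k)
  case (insert x J)
  have ex: "(\<Sum>i\<in>insert x J. \<Sum>j\<in>insert x J. r i * r j * k i j)
      = (r x)\<^sup>2 * k x x + 2 * r x * (\<Sum>j\<in>J. r j * k j x) + (\<Sum>i\<in>J. \<Sum>j\<in>J. r i * r j * k i j)" for r
  proof -
    have "(\<Sum>j\<in>J. r x * r j * k x j) = r x * (\<Sum>j\<in>J. r j * k j x)"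
      using insert.prems(1)[of x] by (simp add: sum_distrib_left mult.assoc)
    moreover have "(\<Sum>i\<in>J. r i * r x * k i x) = r x * (\<Sum>j\<in>J. r j * k j x)"
      by (simp add: sum_distrib_left mult_ac)
    ultimately show ?thesis
      using insert.hyps by (simp add: sum.distrib power2_eq_square algebra_simps)
  qed
  have sumx: "(\<Sum>i\<in>J. f i) = (\<Sum>i\<in>J. g i)" if "\<And>i. i \<in> J \<Longrightarrow> f i = g i" for f g :: "'j \<Rightarrow> real"
    using that by (rule sum.cong[OF refl])
  have xJ: "i \<noteq> x" if "i \<in> J" for i using that insert.hyps by auto
  have kxx: "0 \<le> k x x"
    using insert.prems(2)[of "\<lambda>i. if i = x then 1 else 0"] unfolding ex
    using xJ by (simp add: sumx[where g = "\<lambda>_. 0"])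
  show ?case
  proof (cases "k x x = 0")
    case True
    have kx: "k i x = 0" if i: "i \<in> J" for i
    proof (rule ccontr)
      assume ne: "k i x \<noteq> 0"
      \<comment> \<open>With this value the form equals -1 at \<open>?r\<close>, so a nonzero entry
        contradicts positivity.\<close>
      define t where "t = - (k i i + 1) / (2 * k i x)"
      let ?r = "\<lambda>j. if j = x then t else if j = i then 1 else (0::real)"
      have "(\<Sum>j\<in>J. ?r j * k j x) = (\<Sum>j\<in>J. if j = i then k i x else 0)"
        using xJ by (intro sumx) auto
      moreover have "(\<Sum>a\<in>J. \<Sum>b\<in>J. ?r a * ?r b * k a b) = (\<Sum>a\<in>J. \<Sum>b\<in>J. if b = i then (if a = i then k i i else 0) else 0)"
        using xJ by (intro sumx) auto
      ultimately have "0 \<le> 2 * t * k i x + k i i"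
        using insert.prems(2)[of ?r] i insert.hyps True unfolding ex by simp
      then show False using ne by (simp add: t_def field_simps)
    qed
    have "\<exists>(n::nat) v. \<forall>i\<in>J. \<forall>j\<in>J. k i j = (\<Sum>m<n. v i m * v j m)"
    proof (rule insert.IH)
      show "0 \<le> (\<Sum>i\<in>J. \<Sum>j\<in>J. r i * r j * k i j)" for r
      proof -
        have "(\<Sum>i\<in>J. \<Sum>j\<in>J. (r(x := 0)) i * (r(x := 0)) j * k i j) = (\<Sum>i\<in>J. \<Sum>j\<in>J. r i * r j * k i j)"
          using xJ by (intro sumx) auto
        then show ?thesis using insert.prems(2)[of "r(x := 0)"] unfolding ex by simp
      qed
    qed (use insert.prems in auto)
    then obtain n :: nat and v where v: "\<forall>i\<in>J. \<forall>j\<in>J. k i j = (\<Sum>m<n. v i m * v j m)" by blast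
    have z: "k i j = 0" if "i \<in> insert x J" "j \<in> insert x J" "i = x \<or> j = x" for i j
      using that kx True insert.prems(1)[of x j] by auto
    have "k i j = (\<Sum>m<n. (v(x := \<lambda>_. 0)) i m * (v(x := \<lambda>_. 0)) j m)"
      if "i \<in> insert x J" "j \<in> insert x J" for i j
      using that z[OF that] v by (cases "i = x \<or> j = x") auto
    then show ?thesis by blast
  next
    case False
    then have pos: "0 < k x x" using kxx by simp
    define k' where "k' i j = k i j - k i x * k j x / k x x" for i j
    have "\<exists>(n::nat) v. \<forall>i\<in>J. \<forall>j\<in>J. k' i j = (\<Sum>m<n. v i m * v j m)"
    proof (rule insert.IH)
      show "0 \<le> (\<Sum>i\<in>J. \<Sum>j\<in>J. r i * r j * k' i j)" for r
      proof -
        define S where "S = (\<Sum>j\<in>J. r j * k j x)"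
        \<comment> \<open>This value at \<open>x\<close> minimises the quadratic form over that
          coordinate, and the minimum is the form of the Schur complement \<open>k'\<close>.\<close>
        let ?r = "r(x := - S / k x x)"
        have 1: "(\<Sum>j\<in>J. ?r j * k j x) = S"
          unfolding S_def using xJ by (intro sumx) auto
        have 2: "(\<Sum>i\<in>J. \<Sum>j\<in>J. ?r i * ?r j * k i j) = (\<Sum>i\<in>J. \<Sum>j\<in>J. r i * r j * k i j)"
          using xJ by (intro sumx) auto
        have "(\<Sum>i\<in>J. \<Sum>j\<in>J. r i * r j * k' i j) = (\<Sum>i\<in>J. \<Sum>j\<in>J. r i * r j * k i j) - S * S / k x x"
        proof -
          have "(\<Sum>i\<in>J. \<Sum>j\<in>J. r i * r j * (k i x * k j x / k x x)) = S * S / k x x"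
            unfolding S_def sum_product sum_divide_distrib by (intro sum.cong refl) (simp add: mult_ac)
          then show ?thesis by (simp add: k'_def right_diff_distrib sum_subtractf)
        qed
        moreover have "0 \<le> (- S / k x x)\<^sup>2 * k x x + 2 * (- S / k x x) * S + (\<Sum>i\<in>J. \<Sum>j\<in>J. r i * r j * k i j)"
          using insert.prems(2)[of ?r] unfolding ex 1 2 by simp
        moreover have "(- S / k x x)\<^sup>2 * k x x + 2 * (- S / k x x) * S = - (S * S / k x x)"
          using pos by (simp add: power2_eq_square field_simps)
        ultimately show ?thesis by linarith
      qed
    qed (use insert.prems in \<open>auto simp: k'_def\<close>)
    then obtain n :: nat and v where v: "\<forall>i\<in>J. \<forall>j\<in>J. k' i j = (\<Sum>m<n. v i m * v j m)" by blast
    \<comment> \<open>The pivot contributes one new column, with index \<open>n\<close>; the old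
      columns vanish at \<open>x\<close>.\<close>
    define w where "w i m = (if i = x then (if m = n then sqrt (k x x) else 0) else if m = n then k i x / sqrt (k x x) else v i m)" for i m
    have "k i j = (\<Sum>m<Suc n. w i m * w j m)" if "i \<in> insert x J" "j \<in> insert x J" for i j
    proof -
      have J: "(\<Sum>m<n. w i m * w j m) = (if i = x \<or> j = x then 0 else k' i j)"
        using that v by (auto simp: w_def intro!: sum.neutral sum.cong)
      show ?thesis
        unfolding sum.lessThan_Suc J using that pos insert.prems(1)[of i j]
        by (auto simp: w_def k'_def real_sqrt_mult_self)
    qed
    then show ?thesis by blast
  qed
qed auto

text \<open>The variance of \<open>Re (\<Sum>\<^sub>i c\<^sub>i g\<^sub>i)\<close> when \<open>E g\<^sub>i g\<^sub>j = \<Gamma> i j\<close> and \<open>E g\<^sub>i (cnj g\<^sub>j) = \<Delta> i j\<close>.\<close>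
definition gauss_form :: "('i \<Rightarrow> 'i \<Rightarrow> complex) \<Rightarrow> ('i \<Rightarrow> 'i \<Rightarrow> complex) \<Rightarrow> 'i set \<Rightarrow> ('i \<Rightarrow> complex) \<Rightarrow> real" where
  "gauss_form \<Gamma> \<Delta> F c = (\<Sum>i\<in>F. \<Sum>j\<in>F. Re (c i * c j * \<Gamma> i j + c i * cnj (c j) * \<Delta> i j)) / 2"

lemma trig_phase_measurable:
  assumes "\<And>i. i \<in> F \<Longrightarrow> X i \<in> borel_measurable M"
  shows "(\<lambda>\<omega>. trig_phase F c (\<lambda>i. X i \<omega>)) \<in> borel_measurable M"
  unfolding trig_phase_def using assms by (auto intro!: borel_measurable_sum)

text \<open>Real and imaginary parts are treated as real coordinates indexed by
  \<open>F \<times> UNIV\<close>. Their covariance \<open>k\<close> is positive semidefinite by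
  \<open>psd\<close>, and a factorisation of it exhibits the law as a linear image of independent
  standard normals.\<close>

lemma finite_gaussian:
  fixes \<Gamma> \<Delta> :: "'i \<Rightarrow> 'i \<Rightarrow> complex"
  assumes F: "finite F" and sym: "\<And>i j. \<Gamma> i j = \<Gamma> j i" "\<And>i j. \<Delta> i j = cnj (\<Delta> j i)"
    and psd: "\<And>c. 0 \<le> gauss_form \<Gamma> \<Delta> F c"
  shows "\<exists>M. sets M = sets (PiM F (\<lambda>_. borel :: complex measure)) \<and> prob_space M \<and>
    (\<forall>c. (\<integral>g. iexp (trig_phase F c g) \<partial>M) = of_real (exp (- gauss_form \<Gamma> \<Delta> F c / 2)))"
proof -
  \<comment> \<open>\<open>Re (u b * z)\<close> is the real part of \<open>z\<close> for
    \<open>False\<close> and the imaginary part for \<open>True\<close>. The formula for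
    \<open>k\<close> comes from Re x Re y = (Re (x y) + Re (x cnj y)) / 2.\<close>
  define u :: "bool \<Rightarrow> complex" where "u b = (if b then - \<i> else 1)" for b
  define k where "k p q = Re (u (snd p) * u (snd q) * \<Gamma> (fst p) (fst q) + u (snd p) * cnj (u (snd q)) * \<Delta> (fst p) (fst q)) / 2" for p q
  define coef where "coef r i = of_real (r (i, False)) + of_real (r (i, True)) * u True" for r :: "'i \<times> bool \<Rightarrow> real" and i
  have bs: "(\<Sum>p\<in>F \<times> UNIV. f p) = (\<Sum>i\<in>F. f (i, False) + f (i, True))" for f :: "'i \<times> bool \<Rightarrow> real"
    using F by (simp add: sum.cartesian_product' UNIV_bool)
  have quad: "(\<Sum>p\<in>F \<times> UNIV. \<Sum>q\<in>F \<times> UNIV. r p * r q * k p q) = gauss_form \<Gamma> \<Delta> F (coef r)" for r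
    unfolding bs sum.distrib[symmetric] gauss_form_def sum_divide_distrib
    by (intro sum.cong refl) (simp add: k_def coef_def u_def algebra_simps add_divide_distrib diff_divide_distrib)
  have ksym: "k p q = k q p" for p q
    unfolding k_def sym(1)[of "fst p" "fst q"] sym(2)[of "fst p" "fst q"] by (simp add: algebra_simps)
  obtain n :: nat and v where v: "\<And>p q. p \<in> F \<times> UNIV \<Longrightarrow> q \<in> F \<times> UNIV \<Longrightarrow> k p q = (\<Sum>m<n. v p m * v q m)"
    using psd_factorization[of "F \<times> UNIV" k] F ksym quad psd by auto
  let ?S = "PiM {..<n} (\<lambda>_. std_normal_distribution)"
  interpret std: prob_space std_normal_distribution by (rule prob_space_normal_density) simp
  interpret product_prob_space "\<lambda>_::nat. std_normal_distribution" "{..<n}" ..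
  have pS: "prob_space ?S" by (rule P.prob_space_axioms) 
  define G where "G \<xi> = (\<lambda>i\<in>F. \<Sum>m<n. of_real (\<xi> m) * Complex (v (i, False) m) (v (i, True) m))" for \<xi> :: "nat \<Rightarrow> real"
  have xm: "(\<lambda>\<xi>. \<xi> m) \<in> borel_measurable ?S" if "m < n" for m
  proof -
    have "(\<lambda>\<xi>. \<xi> m) \<in> measurable ?S std_normal_distribution"
      using that by (intro measurable_component_singleton) simp
    moreover have "measurable ?S std_normal_distribution = measurable ?S (borel :: real measure)"
      by (rule measurable_cong_sets) simp_all
    ultimately show ?thesis by simp
  qed
  have Gm: "G \<in> measurable ?S (PiM F (\<lambda>_. borel))"
    unfolding G_def by (intro measurable_restrict borel_measurable_sum borel_measurable_times borel_measurable_const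
      measurable_compose[OF xm borel_measurable_of_real]) auto
  have "(\<integral>g. iexp (trig_phase F c g) \<partial>distr ?S (PiM F (\<lambda>_. borel)) G) = of_real (exp (- gauss_form \<Gamma> \<Delta> F c / 2))" for c
  proof -
    \<comment> \<open>The coordinates of \<open>c\<close> in the basis \<open>u\<close>, chosen so
      that \<open>coef r = c\<close>.\<close>
    define r where "r p = (if snd p then - Im (c (fst p)) else Re (c (fst p)))" for p :: "'i \<times> bool"
    define w where "w m = (\<Sum>p\<in>F \<times> UNIV. r p * v p m)" for m
    have cr: "coef r = c" by (auto simp: coef_def r_def u_def complex_eq_iff fun_eq_iff)
    have ph: "trig_phase F c (G \<xi>) = (\<Sum>m<n. w m * \<xi> m)" for \<xi>
    proof -
      have "trig_phase F c (G \<xi>) = (\<Sum>i\<in>F. \<Sum>m<n. \<xi> m * (r (i, False) * v (i, False) m + r (i, True) * v (i, True) m))"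
        unfolding trig_phase_def
        by (intro sum.cong refl) (simp add: G_def r_def sum_distrib_left algebra_simps sum.distrib sum_negf sum_subtractf)
      also have "\<dots> = (\<Sum>m<n. \<Sum>i\<in>F. \<xi> m * (r (i, False) * v (i, False) m + r (i, True) * v (i, True) m))"
        by (rule sum.swap)
      finally show ?thesis unfolding w_def bs by (simp add: sum_distrib_left mult.commute)
    qed
    have ww: "(\<Sum>m<n. (w m)\<^sup>2) = gauss_form \<Gamma> \<Delta> F c"
    proof -
      have "(\<Sum>m<n. (w m)\<^sup>2) = (\<Sum>m<n. \<Sum>p\<in>F \<times> UNIV. \<Sum>q\<in>F \<times> UNIV. r p * r q * (v p m * v q m))"
        unfolding w_def power2_eq_square sum_product by (simp add: mult_ac)
      also have "\<dots> = (\<Sum>p\<in>F \<times> UNIV. \<Sum>q\<in>F \<times> UNIV. \<Sum>m<n. r p * r q * (v p m * v q m))"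
        by (subst sum.swap, intro sum.cong refl, rule sum.swap)
      also have "\<dots> = (\<Sum>p\<in>F \<times> UNIV. \<Sum>q\<in>F \<times> UNIV. r p * r q * k p q)"
        by (intro sum.cong refl) (simp add: v sum_distrib_left)
      finally show ?thesis by (simp add: quad cr)
    qed
    have "(\<integral>g. iexp (trig_phase F c g) \<partial>distr ?S (PiM F (\<lambda>_. borel)) G) = (\<integral>\<xi>. iexp (trig_phase F c (G \<xi>)) \<partial>?S)"
    proof (rule integral_distr[OF Gm])
      have "(\<lambda>g. trig_phase F c (\<lambda>i. g i)) \<in> borel_measurable (PiM F (\<lambda>_. borel))"
        by (rule trig_phase_measurable) (rule measurable_component_singleton)
      then show "(\<lambda>g. iexp (trig_phase F c g)) \<in> borel_measurable (PiM F (\<lambda>_. borel))" by simp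
    qed
    also have "\<dots> = (\<integral>\<xi>. (\<Prod>m<n. iexp (w m * \<xi> m)) \<partial>?S)"
      unfolding ph by (simp add: exp_sum sum_distrib_left)
    also have "\<dots> = (\<Prod>m<n. (\<integral>x. iexp (w m * x) \<partial>std_normal_distribution))"
      by (rule product_integral_prod) (auto intro!: std.integrable_iexp)
    also have "\<dots> = (\<Prod>m<n. complex_of_real (exp (- (w m)\<^sup>2 / 2)))"
      using char_std_normal_distribution unfolding char_def fun_eq_iff by simp
    also have "\<dots> = of_real (exp (- gauss_form \<Gamma> \<Delta> F c / 2))"
      unfolding ww[symmetric] by (simp add: sum_divide_distrib exp_sum flip: of_real_prod sum_negf)
    finally show ?thesis .
  qed
  moreover have "prob_space (distr ?S (PiM F (\<lambda>_. borel)) G)" by (rule prob_space.prob_space_distr[OF pS Gm])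
  ultimately show ?thesis by (intro exI[of _ "distr ?S (PiM F (\<lambda>_. borel)) G"]) simp
qed

text \<open>The convergence criterion is applied to a constant sequence, which equals its limit.
  With \<open>G = F\<close> the characters alone separate points.\<close>

lemma charfun_determines_expectation:
  fixes M M' :: "('i \<Rightarrow> complex) measure"
  assumes F: "finite F" and M: "prob_space M" "sets M = sets (PiM F (\<lambda>_. borel))"
    and M': "prob_space M'" "sets M' = sets (PiM F (\<lambda>_. borel))"
    and eq: "\<And>c. (\<integral>g. iexp (trig_phase F c g) \<partial>M) = (\<integral>g. iexp (trig_phase F c g) \<partial>M')"
    and f: "continuous_on UNIV f" "bounded (range f)"
  shows "(\<integral>g. f (restr F g) \<partial>M) = (\<integral>g. f (restr F g) \<partial>M' :: real)"
proof -
  have m: "(\<lambda>g. g i) \<in> borel_measurable M" "(\<lambda>g. g i) \<in> borel_measurable M'" if "i \<in> F" for i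
    unfolding measurable_cong_sets[OF M(2) refl] measurable_cong_sets[OF M'(2) refl]
    using that by (auto intro: measurable_component_singleton)
  have "(\<lambda>N::nat. \<integral>g. f (restr F (\<lambda>i. g i)) \<partial>M) \<longlonglongrightarrow> (\<integral>g. f (restr F (\<lambda>i. g i)) \<partial>M')"
  proof (rule weak_convergence_trig[where \<H> = "range (\<lambda>c _. c)" and G = F and \<Omega> = "\<lambda>_. M" and X = "\<lambda>_ i g. g i"])
    fix i and e :: real assume "i \<in> F" "e > 0"
    then show "\<exists>r. \<forall>\<^sub>F N in sequentially. measure M {\<omega> \<in> space M. cmod (\<omega> i) > r} \<le> e"
      using prob_space.tight_single[OF M(1) m(1)] by simp
  qed (use F M M' m eq f in auto)
  then show ?thesis by (simp add: LIMSEQ_const_iff)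
qed

text \<open>Closed boxes are stable under intersection and generate the product sigma-algebra, and
  the indicator of a closed box is a limit of bounded continuous functions, whose integrals agree
  already.\<close>

lemma charfun_unique:
  fixes M M' :: "('i \<Rightarrow> complex) measure"
  assumes F: "finite F" and M: "prob_space M" "sets M = sets (PiM F (\<lambda>_. borel))"
    and M': "prob_space M'" "sets M' = sets (PiM F (\<lambda>_. borel))"
    and eq: "\<And>c. (\<integral>g. iexp (trig_phase F c g) \<partial>M) = (\<integral>g. iexp (trig_phase F c g) \<partial>M')"
  shows "M = M'"
proof -
  define E where "E = {{f \<in> (\<Pi>\<^sub>E i\<in>F. (UNIV :: complex set)). \<forall>i\<in>j. f i \<in> A i} | A j. j \<in> {F} \<and> A \<in> Pi j (\<lambda>_. Collect closed)}"
  have E: "E = {PiE F A | A. \<forall>i\<in>F. closed (A i)}"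
    unfolding E_def by (auto simp: Pi_def PiE_def)
  have sb: "sigma UNIV (Collect closed) = (borel :: complex measure)" by (rule borel_eq_closed[symmetric])
  have "sets (\<Pi>\<^sub>M i\<in>F. sigma UNIV (Collect closed)) = sets (sigma (\<Pi>\<^sub>E i\<in>F. (UNIV :: complex set)) E)"
    unfolding E_def by (rule sets_PiM_sigma) (use F in \<open>auto intro!: exI[of _ "{UNIV}"]\<close>)
  then have sE: "sets (PiM F (\<lambda>_. borel :: complex measure)) = sigma_sets (PiE F (\<lambda>_. UNIV)) E"
    unfolding sb by (subst (asm) sets_measure_of) (auto simp: E)
  show ?thesis
  proof (rule measure_eqI_generator_eq[where E = E and \<Omega> = "PiE F (\<lambda>_. UNIV)" and A = "\<lambda>_. PiE F (\<lambda>_. UNIV)"])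
    show "Int_stable E"
    proof (rule Int_stableI)
      fix a b assume "a \<in> E" "b \<in> E"
      then obtain A B where "a = PiE F A" "b = PiE F B" "\<forall>i\<in>F. closed (A i)" "\<forall>i\<in>F. closed (B i)" by (auto simp: E)
      then show "a \<inter> b \<in> E" unfolding E by (auto simp: PiE_Int intro!: exI[of _ "\<lambda>i. A i \<inter> B i"])
    qed
    show "sets M = sigma_sets (PiE F (\<lambda>_. UNIV)) E" "sets M' = sigma_sets (PiE F (\<lambda>_. UNIV)) E"
      using M M' sE by auto
    fix X assume "X \<in> E"
    then obtain A where X: "X = PiE F A" and A: "\<And>i. i \<in> F \<Longrightarrow> closed (A i)" by (auto simp: E)
    show "emeasure M X = emeasure M' X"
    \<comment> \<open>The distance to the empty set is 0 by convention, so the functions \<phi>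
      below would not tend to its indicator.\<close>
    proof (cases "\<exists>i\<in>F. A i = {}")
      case True
      then have "X = {}" by (auto simp: X PiE_eq_empty_iff)
      then show ?thesis by simp
    next
      case False
      define \<phi> where "\<phi> n i z = max 0 (1 - real n * infdist z (A i))" for n i and z :: complex
      have \<phi>01: "0 \<le> \<phi> n i z" "\<phi> n i z \<le> 1" for n i z
        by (auto simp: \<phi>_def infdist_nonneg)
      have \<phi>lim: "(\<lambda>n. \<phi> n i z) \<longlonglongrightarrow> indicator (A i) z" if i: "i \<in> F" for i z
      proof (cases "z \<in> A i")
        case True
        then show ?thesis by (simp add: \<phi>_def)
      next
        case out: False
        then have pos: "infdist z (A i) > 0"
          using A[OF i] False i in_closed_iff_infdist_zero[of "A i" z] infdist_nonneg[of z "A i"] by auto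
        obtain m :: nat where m: "1 / infdist z (A i) \<le> real m" using real_arch_simple by blast
        have "\<forall>\<^sub>F n in sequentially. \<phi> n i z = 0"
          using eventually_ge_at_top[of m]
        proof eventually_elim
          case (elim n)
          then have "1 / infdist z (A i) \<le> real n" using m by linarith
          then show ?case using pos by (simp add: \<phi>_def divide_le_eq)
        qed
        then show ?thesis using out by (simp add: tendsto_eventually)
      qed
      define f where "f n v = (\<Prod>i\<in>F. \<phi> n i (v i))" for n and v :: "'i \<Rightarrow> complex"
      have fc: "continuous_on UNIV (f n)" for n
      proof -
        have "continuous_on UNIV (\<lambda>z. \<phi> n i z)" for i
          unfolding \<phi>_def by (intro continuous_intros)
        then show ?thesis unfolding f_def
          by (intro continuous_on_prod continuous_on_compose2[OF _ continuous_on_coord]) auto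
      qed
      have f01: "0 \<le> f n v" "f n v \<le> 1" for n v
        unfolding f_def by (auto intro!: prod_nonneg prod_le_1 simp: \<phi>01)
      have fb: "bounded (range (f n))" for n
        by (rule boundedI[where B = 1]) (use f01 in auto)
      have fr: "f n (restr F v) = f n v" for n v
        unfolding f_def restr_def by (intro prod.cong) auto
      have lim: "(\<lambda>n. \<integral>g. f n (restr F g) \<partial>L) \<longlonglongrightarrow> measure L X"
        if L: "prob_space L" "sets L = sets (PiM F (\<lambda>_. borel))" for L
      proof -
        interpret L: prob_space L by (rule L)
        have m: "(\<lambda>g. g i) \<in> borel_measurable L" if "i \<in> F" for i
          unfolding measurable_cong_sets[OF L(2) refl] using that by (auto intro: measurable_component_singleton)
        have XL: "X \<in> sets L" unfolding L(2) X using F A by (intro sets_PiM_I_finite) auto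
        have spL: "space L = PiE F (\<lambda>_. UNIV)" using sets_eq_imp_space_eq[OF L(2)] by (simp add: space_PiM)
        have "(\<lambda>n. \<integral>g. f n (restr F g) \<partial>L) \<longlonglongrightarrow> (\<integral>g. indicator X g \<partial>L)"
        proof (rule integral_dominated_convergence[where w = "\<lambda>_. 1"])
          show "(\<lambda>g. f n (restr F g)) \<in> borel_measurable L" for n
            by (rule restr_measurable[OF F m fc])
          show "AE g in L. (\<lambda>n. f n (restr F g)) \<longlonglongrightarrow> indicator X g"
          proof (rule AE_I2)
            fix g assume "g \<in> space L"
            then have "indicator X g = (\<Prod>i\<in>F. indicator (A i) (g i) :: real)"
              using F by (auto simp: X spL indicator_def PiE_def Pi_def)
            moreover have "(\<lambda>n. f n g) \<longlonglongrightarrow> (\<Prod>i\<in>F. indicator (A i) (g i))"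
              unfolding f_def by (intro tendsto_prod \<phi>lim)
            ultimately show "(\<lambda>n. f n (restr F g)) \<longlonglongrightarrow> indicator X g" unfolding fr by simp
          qed
        qed (use XL f01 in \<open>auto simp: abs_le_iff order_trans[OF _ f01(1)]\<close>)
        then show ?thesis using XL by simp
      qed
      have "measure M X = measure M' X"
        using LIMSEQ_unique[OF lim[OF M]] lim[OF M'] charfun_determines_expectation[OF F M M' eq fc fb] by simp
      then show ?thesis using M(1) M'(1)
        by (simp add: finite_measure.emeasure_eq_measure prob_space_def)
    qed
  qed (use M M' in \<open>auto simp: E prob_space_def finite_measure.emeasure_finite\<close>)
qed

text \<open>Kolmogorov extension. The finite marginals are picked by choice, but each is determined
  by its characteristic function, so the law on \<open>H\<close> restricts to the law on
  \<open>J\<close>; \<open>polish_projective\<close> then supplies the projective limit.\<close>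

theorem gaussian_process_exists:
  fixes \<Gamma> \<Delta> :: "'i \<Rightarrow> 'i \<Rightarrow> complex"
  assumes sym: "\<And>i j. \<Gamma> i j = \<Gamma> j i" "\<And>i j. \<Delta> i j = cnj (\<Delta> j i)"
    and psd: "\<And>F c. finite F \<Longrightarrow> 0 \<le> gauss_form \<Gamma> \<Delta> F c"
  shows "\<exists>R. sets R = sets (PiM UNIV (\<lambda>_. borel :: complex measure)) \<and> prob_space R \<and>
    (\<forall>F c. finite F \<longrightarrow> (\<integral>g. iexp (trig_phase F c g) \<partial>R) = of_real (exp (- gauss_form \<Gamma> \<Delta> F c / 2)))"
proof -
  define Q where "Q F M \<longleftrightarrow> sets M = sets (PiM F (\<lambda>_. borel :: complex measure)) \<and> prob_space M \<and>
    (\<forall>c. (\<integral>g. iexp (trig_phase F c g) \<partial>M) = of_real (exp (- gauss_form \<Gamma> \<Delta> F c / 2)))" for F :: "'i set" and M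
  define P where "P F = (SOME M. Q F M)" for F
  have PQ: "Q F (P F)" if "finite F" for F
    unfolding P_def by (rule someI_ex) (use finite_gaussian[OF that sym psd[OF that]] in \<open>simp add: Q_def\<close>)
  have iexp_m: "(\<lambda>g. iexp (trig_phase J c g)) \<in> borel_measurable (PiM J (\<lambda>_. borel))" for J c
  proof -
    have "(\<lambda>g. trig_phase J c (\<lambda>i. g i)) \<in> borel_measurable (PiM J (\<lambda>_. borel))"
      by (rule trig_phase_measurable) (rule measurable_component_singleton)
    then show ?thesis by simp
  qed
  have restr_int: "(\<integral>g. iexp (trig_phase J c g) \<partial>distr M (PiM J (\<lambda>_. borel)) (\<lambda>f. restrict f J)) = (\<integral>g. iexp (trig_phase J c g) \<partial>M)"
    if M: "sets M = sets (PiM H (\<lambda>_. borel))" and J: "J \<subseteq> H" for M J H and c :: "'i \<Rightarrow> complex"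
  proof -
    have r: "(\<lambda>f. restrict f J) \<in> measurable M (PiM J (\<lambda>_. borel))"
      unfolding measurable_cong_sets[OF M refl] by (rule measurable_restrict_subset[OF J])
    have "trig_phase J c (restrict g J) = trig_phase J c g" for g
      unfolding trig_phase_def by (intro sum.cong) auto
    then show ?thesis by (simp add: integral_distr[OF r iexp_m])
  qed
  have proj: "P J = distr (P H) (PiM J (\<lambda>_. borel)) (\<lambda>f. restrict f J)" if JH: "J \<subseteq> H" "finite H" for J H
  proof (rule charfun_unique)
    have fJ: "finite J" using JH finite_subset by blast
    show "finite J" by (rule fJ)
    show "prob_space (P J)" "sets (P J) = sets (PiM J (\<lambda>_. borel))" using PQ[OF fJ] by (auto simp: Q_def)
    have H: "sets (P H) = sets (PiM H (\<lambda>_. borel))" "prob_space (P H)" using PQ[OF JH(2)] by (auto simp: Q_def)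
    show "prob_space (distr (P H) (PiM J (\<lambda>_. borel)) (\<lambda>f. restrict f J))"
      by (rule prob_space.prob_space_distr[OF H(2)])
         (unfold measurable_cong_sets[OF H(1) refl], rule measurable_restrict_subset[OF JH(1)])
    fix c :: "'i \<Rightarrow> complex"
    define c' where "c' i = (if i \<in> J then c i else 0)" for i
    have "trig_phase J c g = trig_phase H c' g" for g
      unfolding trig_phase_def
      by (rule sum.mono_neutral_cong_left) (use JH in \<open>auto simp: c'_def\<close>)
    moreover have "gauss_form \<Gamma> \<Delta> J c = gauss_form \<Gamma> \<Delta> H c'"
    proof -
      have "(\<Sum>i\<in>J. \<Sum>j\<in>J. Re (c i * c j * \<Gamma> i j + c i * cnj (c j) * \<Delta> i j))
        = (\<Sum>i\<in>H. \<Sum>j\<in>H. Re (c' i * c' j * \<Gamma> i j + c' i * cnj (c' j) * \<Delta> i j))"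
        by (intro sum.mono_neutral_cong_left JH) (use JH in \<open>auto simp: c'_def intro!: sum.mono_neutral_cong_left\<close>)
      then show ?thesis by (simp add: gauss_form_def)
    qed
    moreover have "(\<integral>g. iexp (trig_phase J c g) \<partial>P J) = of_real (exp (- gauss_form \<Gamma> \<Delta> J c / 2))"
      using PQ[OF fJ] by (simp add: Q_def)
    moreover have "(\<integral>g. iexp (trig_phase H c' g) \<partial>P H) = of_real (exp (- gauss_form \<Gamma> \<Delta> H c' / 2))"
      using PQ[OF JH(2)] by (simp add: Q_def)
    ultimately show "(\<integral>g. iexp (trig_phase J c g) \<partial>P J) = (\<integral>g. iexp (trig_phase J c g) \<partial>distr (P H) (PiM J (\<lambda>_. borel)) (\<lambda>f. restrict f J))"
      unfolding restr_int[OF H(1) JH(1)] by simp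
  qed simp
  have "projective_family UNIV P (\<lambda>_. borel)"
  proof (rule projective_family.intro)
    show "prob_space (P J)" if "finite J" for J using PQ[OF that] by (simp add: Q_def)
  qed (rule proj)
  then interpret polish_projective UNIV P by (rule polish_projective.intro)
  have law: "distr lim (PiM F (\<lambda>_. borel)) (\<lambda>f. restrict f F) = P F" if F: "finite F" for F
  proof (rule measure_eqI)
    have sP: "sets (P F) = sets (PiM F (\<lambda>_. borel))" using PQ[OF F] by (simp add: Q_def)
    then show "sets (distr lim (PiM F (\<lambda>_. borel)) (\<lambda>f. restrict f F)) = sets (P F)" by simp
    fix X assume "X \<in> sets (distr lim (PiM F (\<lambda>_. borel)) (\<lambda>f. restrict f F))"
    then have X: "X \<in> sets (PiM F (\<lambda>_. borel))" by simp
    have "(\<lambda>f. restrict f F) \<in> measurable lim (PiM F (\<lambda>_. borel))"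
      unfolding measurable_cong_sets[OF sets_lim refl] by (rule measurable_restrict_subset) simp
    then have "emeasure (distr lim (PiM F (\<lambda>_. borel)) (\<lambda>f. restrict f F)) X = emeasure lim (emb UNIV F X)"
      using X by (simp add: emeasure_distr prod_emb_def space_PiM)
    then show "emeasure (distr lim (PiM F (\<lambda>_. borel)) (\<lambda>f. restrict f F)) X = emeasure (P F) X"
      using emeasure_lim_emb[OF _ F X] by simp
  qed
  have "(\<integral>g. iexp (trig_phase F c g) \<partial>lim) = of_real (exp (- gauss_form \<Gamma> \<Delta> F c / 2))" if F: "finite F" for F c
    using restr_int[OF sets_lim, of F c] law[OF F] PQ[OF F] by (simp add: Q_def)
  then show ?thesis
    by (intro exI[of _ lim]) (auto simp: P.prob_space_axioms)
qed

text \<open>By Levy uniqueness the law is that of \<open>\<sigma>\<close> times a standard normal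
  variable, and the second moment is read off from this law.\<close>

lemma gaussian_rv_from_charfun:
  fixes X :: "'a \<Rightarrow> real"
  assumes M: "prob_space M" and X: "X \<in> borel_measurable M" and s: "0 \<le> s"
    and ch: "\<And>t. (\<integral>\<omega>. iexp (t * X \<omega>) \<partial>M) = of_real (exp (- (t\<^sup>2 * s) / 2))"
  shows "centered_gaussian_rv M X \<and> integrable M (\<lambda>\<omega>. (X \<omega>)\<^sup>2) \<and> (\<integral>\<omega>. (X \<omega>)\<^sup>2 \<partial>M) = s"
proof -
  interpret M: prob_space M by (rule M)
  interpret std: prob_space std_normal_distribution by (rule prob_space_normal_density) simp
  define \<sigma> where "\<sigma> = sqrt s"
  have \<sigma>: "0 \<le> \<sigma>" "\<sigma>\<^sup>2 = s" using s by (auto simp: \<sigma>_def)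
  let ?N = "distr std_normal_distribution borel (\<lambda>x. \<sigma> * x)"
  have eq: "distr M borel X = ?N"
  proof (rule Levy_uniqueness)
    show "real_distribution (distr M borel X)" by (rule M.real_distribution_distr[OF X])
    show "real_distribution ?N" by (rule std.real_distribution_distr) simp
    show "char (distr M borel X) = char ?N"
    proof
      fix t
      have "char ?N t = char std_normal_distribution (t * \<sigma>)"
        by (simp add: char_def integral_distr mult.assoc)
      also have "\<dots> = of_real (exp (- (t\<^sup>2 * s) / 2))"
        by (simp add: char_std_normal_distribution power_mult_distrib \<sigma>)
      finally show "char (distr M borel X) t = char ?N t"
        using ch[of t] X by (simp add: char_def integral_distr)
    qed
  qed
  have N: "?N = (if \<sigma> = 0 then return borel 0 else density lborel (normal_density 0 \<sigma>))"
  proof (cases "\<sigma> = 0")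
    case True
    then show ?thesis by (simp add: std.distr_const)
  next
    case False
    have "distributed std_normal_distribution lborel (\<lambda>x. x) std_normal_density"
      by (simp add: distributed_def distr_id2 normal_density_nonneg)
    then have "distributed std_normal_distribution lborel (\<lambda>x. 0 + \<sigma> * x) (normal_density (0 + \<sigma> * 0) (\<bar>\<sigma>\<bar> * 1))"
      by (rule std.normal_density_affine) (use False in auto)
    then have "distr std_normal_distribution lborel (\<lambda>x. \<sigma> * x) = density lborel (normal_density 0 \<sigma>)"
      using \<sigma> by (simp add: distributed_def)
    moreover have "?N = distr std_normal_distribution lborel (\<lambda>x. \<sigma> * x)" by (rule distr_cong) auto
    ultimately show ?thesis using False by simp
  qed
  have g: "centered_gaussian_rv M X"
    unfolding centered_gaussian_rv_def using X \<sigma> eq N by auto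
  have "integrable ?N (\<lambda>x. x\<^sup>2)"
    by (subst integrable_distr_eq) (auto simp: power_mult_distrib integrable_std_normal_distribution_moment)
  then have i: "integrable M (\<lambda>\<omega>. (X \<omega>)\<^sup>2)"
    unfolding eq[symmetric] by (subst (asm) integrable_distr_eq) (use X in auto)
  have "(\<integral>\<omega>. (X \<omega>)\<^sup>2 \<partial>M) = (\<integral>x. x\<^sup>2 \<partial>distr M borel X)"
    by (subst integral_distr) (use X in auto)
  also have "\<dots> = (\<integral>x. (\<sigma> * x)\<^sup>2 \<partial>std_normal_distribution)" unfolding eq by (subst integral_distr) auto
  also have "\<dots> = s"
    using std_normal_distribution_even_moments(1)[of 1] by (simp add: power_mult_distrib \<sigma>)
  finally show ?thesis using g i by simp
qed

text \<open>Every real linear combination of real and imaginary parts is a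
  \<open>trig_phase\<close>, hence Gaussian with variance \<open>gauss_form\<close>. The mixed
  second moments follow by polarisation.\<close>

lemma gaussian_process_moments:
  fixes \<Gamma> \<Delta> :: "'i \<Rightarrow> 'i \<Rightarrow> complex"
  assumes sym: "\<And>i j. \<Gamma> i j = \<Gamma> j i" "\<And>i j. \<Delta> i j = cnj (\<Delta> j i)"
    and psd: "\<And>F c. finite F \<Longrightarrow> 0 \<le> gauss_form \<Gamma> \<Delta> F c"
    and R: "sets R = sets (PiM UNIV (\<lambda>_. borel :: complex measure))" "prob_space R"
    and ch: "\<And>F c. finite F \<Longrightarrow> (\<integral>g. iexp (trig_phase F c g) \<partial>R) = of_real (exp (- gauss_form \<Gamma> \<Delta> F c / 2))"
  shows "complex_centered_gaussian R (\<lambda>i g. g i)"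
    "integrable R (\<lambda>g. g i * g j) \<and> (\<integral>g. g i * g j \<partial>R) = \<Gamma> i j"
    "integrable R (\<lambda>g. g i * cnj (g j)) \<and> (\<integral>g. g i * cnj (g j) \<partial>R) = \<Delta> i j"
proof -
  interpret R: prob_space R by (rule R)
  have m[measurable]: "(\<lambda>g. g i) \<in> borel_measurable R" for i
    unfolding measurable_cong_sets[OF R(1) refl] by (rule measurable_component_singleton) simp
  have lin: "centered_gaussian_rv R (trig_phase F c) \<and> integrable R (\<lambda>g. (trig_phase F c g)\<^sup>2) \<and>
      (\<integral>g. (trig_phase F c g)\<^sup>2 \<partial>R) = gauss_form \<Gamma> \<Delta> F c" if F: "finite F" for F c
  proof (rule gaussian_rv_from_charfun[OF R(2) _ psd[OF F]])
    show "trig_phase F c \<in> borel_measurable R"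
      using trig_phase_measurable[of F "\<lambda>i g. g i" R c] m by simp
    fix t :: real
    have "t * trig_phase F c g = trig_phase F (\<lambda>i. of_real t * c i) g" for g
      by (simp add: trig_phase_def sum_distrib_left algebra_simps)
    moreover have "gauss_form \<Gamma> \<Delta> F (\<lambda>i. of_real t * c i) = t\<^sup>2 * gauss_form \<Gamma> \<Delta> F c"
      by (simp add: gauss_form_def sum_distrib_left power2_eq_square algebra_simps sum_divide_distrib)
    ultimately show "(\<integral>g. iexp (t * trig_phase F c g) \<partial>R) = of_real (exp (- (t\<^sup>2 * gauss_form \<Gamma> \<Delta> F c) / 2))"
      using ch[OF F, of "\<lambda>i. of_real t * c i"] by simp
  qed
  show "complex_centered_gaussian R (\<lambda>i g. g i)"
    unfolding complex_centered_gaussian_def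
  proof (intro conjI allI impI m)
    fix F and a b :: "'i \<Rightarrow> real" assume F: "finite (F :: 'i set)"
    have "(\<lambda>g. \<Sum>i\<in>F. a i * Re (g i) + b i * Im (g i)) = trig_phase F (\<lambda>i. Complex (a i) (- b i))"
      by (simp add: trig_phase_def fun_eq_iff)
    then show "centered_gaussian_rv R (\<lambda>g. \<Sum>i\<in>F. a i * Re (g i) + b i * Im (g i))"
      using lin[OF F, of "\<lambda>i. Complex (a i) (- b i)"] by simp
  qed
  \<comment> \<open>The value that the covariance of \<open>Re (c * g i)\<close> and
    \<open>Re (d * g j)\<close> must take.\<close>
  define bil where "bil c d i j = Re (c * d * \<Gamma> i j + c * cnj d * \<Delta> i j) / 2" for c d i j
  have bil_sym: "bil c d i j = bil d c j i" for c d i j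
    unfolding bil_def sym(1)[of i j] sym(2)[of i j] by (simp add: algebra_simps)
  have one: "integrable R (\<lambda>g. (Re (c * g i) + Re (d * g j))\<^sup>2) \<and>
      (\<integral>g. (Re (c * g i) + Re (d * g j))\<^sup>2 \<partial>R) = bil c c i i + 2 * bil c d i j + bil d d j j" for c d i j
  proof -
    \<comment> \<open>Adding two indicators lets the coefficients accumulate when
      \<open>i = j\<close>, so the same formula covers the diagonal.\<close>
    define e where "e m = (if m = i then c else 0) + (if m = j then d else 0)" for m
    have s: "(\<Sum>m\<in>{i, j}. Re (e m * f m)) = Re (c * f i) + Re (d * f j)" for f
      by (cases "i = j") (auto simp: e_def distrib_right)
    have "trig_phase {i, j} e g = Re (c * g i) + Re (d * g j)" for g
      unfolding trig_phase_def by (rule s)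
    moreover have "gauss_form \<Gamma> \<Delta> {i, j} e = bil c c i i + 2 * bil c d i j + bil d d j j"
    proof -
      have "gauss_form \<Gamma> \<Delta> {i, j} e = (\<Sum>m\<in>{i, j}. Re (e m * (\<Sum>n\<in>{i, j}. e n * \<Gamma> m n + cnj (e n) * \<Delta> m n))) / 2"
        unfolding gauss_form_def by (simp add: sum_distrib_left algebra_simps)
      also have "\<dots> = bil c c i i + bil c d i j + bil d c j i + bil d d j j"
        unfolding s by (cases "i = j") (auto simp: e_def bil_def algebra_simps add_divide_distrib diff_divide_distrib)
      finally show ?thesis using bil_sym[of d c j i] by simp
    qed
    ultimately show ?thesis using lin[of "{i, j}" e] by simp
  qed
  have prod: "integrable R (\<lambda>g. Re (c * g i) * Re (d * g j)) \<and> (\<integral>g. Re (c * g i) * Re (d * g j) \<partial>R) = bil c d i j" for c d i j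
  proof -
    have e: "Re (c * g i) * Re (d * g j) = ((Re (c * g i) + Re (d * g j))\<^sup>2 - (Re (c * g i) + Re ((- d) * g j))\<^sup>2) / 4" for g :: "'i \<Rightarrow> complex"
      by (simp add: power2_eq_square algebra_simps)
    have n: "bil c (- d) i j = - bil c d i j" "bil (- d) (- d) j j = bil d d j j"
      by (simp_all add: bil_def algebra_simps add_divide_distrib diff_divide_distrib)
    show ?thesis unfolding e using one[of c i d j] one[of c i "- d" j] n by (simp add: field_simps)
  qed
  \<comment> \<open>\<open>Re (- \<i> * z)\<close> is \<open>Im z\<close>; in this form every
    product is one to which \<open>prod\<close> applies.\<close>
  have ex: "g i * g j = of_real (Re (1 * g i) * Re (1 * g j) - Re (- \<i> * g i) * Re (- \<i> * g j))
       + \<i> * of_real (Re (1 * g i) * Re (- \<i> * g j) + Re (- \<i> * g i) * Re (1 * g j))"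
     "g i * cnj (g j) = of_real (Re (1 * g i) * Re (1 * g j) + Re (- \<i> * g i) * Re (- \<i> * g j))
       + \<i> * of_real (Re (- \<i> * g i) * Re (1 * g j) - Re (1 * g i) * Re (- \<i> * g j))" for g :: "'i \<Rightarrow> complex"
    by (simp_all add: complex_eq_iff)
  have pi: "integrable R (\<lambda>g. Re (c * g i) * Re (d * g j))" and pe: "(\<integral>g. Re (c * g i) * Re (d * g j) \<partial>R) = bil c d i j" for c d
    using prod by auto
  let ?X = "\<lambda>c d g. Re (c * g i) * Re (d * g j)"
  have cplx: "integrable R (\<lambda>g. complex_of_real (f g) + \<i> * of_real (h g)) \<and>
     (\<integral>g. complex_of_real (f g) + \<i> * of_real (h g) \<partial>R) = of_real (\<integral>g. f g \<partial>R) + \<i> * of_real (\<integral>g. h g \<partial>R)"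
    if "integrable R f" "integrable R h" for f h
    using that by simp
  show "integrable R (\<lambda>g. g i * g j) \<and> (\<integral>g. g i * g j \<partial>R) = \<Gamma> i j"
  proof -
    have "integrable R (\<lambda>g. ?X 1 1 g - ?X (- \<i>) (- \<i>) g)" "integrable R (\<lambda>g. ?X 1 (- \<i>) g + ?X (- \<i>) 1 g)"
      by (intro Bochner_Integration.integrable_diff Bochner_Integration.integrable_add pi)+
    from cplx[OF this] show ?thesis
      unfolding ex(1) Bochner_Integration.integral_diff[OF pi pi] Bochner_Integration.integral_add[OF pi pi] pe
      by (simp add: bil_def complex_eq_iff add_divide_distrib diff_divide_distrib)
  qed
  show "integrable R (\<lambda>g. g i * cnj (g j)) \<and> (\<integral>g. g i * cnj (g j) \<partial>R) = \<Delta> i j"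
  proof -
    have "integrable R (\<lambda>g. ?X 1 1 g + ?X (- \<i>) (- \<i>) g)" "integrable R (\<lambda>g. ?X (- \<i>) 1 g - ?X 1 (- \<i>) g)"
      by (intro Bochner_Integration.integrable_diff Bochner_Integration.integrable_add pi)+
    from cplx[OF this] show ?thesis
      unfolding ex(2) Bochner_Integration.integral_diff[OF pi pi] Bochner_Integration.integral_add[OF pi pi] pe
      by (simp add: bil_def complex_eq_iff add_divide_distrib diff_divide_distrib)
  qed
qed

section \<open>Matrices and the Hilbert--Schmidt norm\<close>

definition smm :: "complex \<Rightarrow> cmat \<Rightarrow> cmat" where
  "smm c X = (\<lambda>i j. c * X i j)"

definition unitm :: "nat \<Rightarrow> nat \<Rightarrow> cmat" where
  "unitm a b = (\<lambda>i j. if i = a \<and> j = b then 1 else 0)"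

lemma mat_entry [simp]:
  "((X::cmat) + Y) i j = X i j + Y i j" "(X - Y) i j = X i j - Y i j"
  "(- X) i j = - X i j" "(0::cmat) i j = 0" "smm c X i j = c * X i j"
  "madj X i j = cnj (X j i)"
  by (simp_all add: smm_def madj_def)

lemma mmult_apply: "i < N \<Longrightarrow> j < N \<Longrightarrow> mmult N X Y i j = (\<Sum>l<N. X i l * Y l j)"
  by (simp add: mmult_def)

lemma msk_apply: "i < N \<Longrightarrow> j < N \<Longrightarrow> msk N X i j = X i j"
  by (simp add: msk_def)

lemma cmat_eqI:
  assumes "\<And>i j. i < N \<Longrightarrow> j < N \<Longrightarrow> X i j = Y i j" "msk N X = X" "msk N Y = Y"
  shows "X = Y"
proof -
  have "msk N X = msk N Y" using assms(1) by (auto simp: msk_def fun_eq_iff)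
  then show ?thesis using assms by simp
qed

lemma mmult_cong:
  assumes "\<And>i j. i < N \<Longrightarrow> j < N \<Longrightarrow> X i j = X' i j" "\<And>i j. i < N \<Longrightarrow> j < N \<Longrightarrow> Y i j = Y' i j"
  shows "mmult N X Y = mmult N X' Y'"
  by (auto simp: mmult_def fun_eq_iff assms intro!: sum.cong)

lemma mtr_cong: "(\<And>i. i < N \<Longrightarrow> X i i = Y i i) \<Longrightarrow> mtr N X = mtr N Y"
  by (simp add: mtr_def)

lemma msk_mmult [simp]: "msk N (mmult N X Y) = mmult N X Y"
  by (auto simp: mmult_def msk_def fun_eq_iff)

lemma msk_idm [simp]: "msk N (idm N) = idm N"
  by (auto simp: idm_def msk_def fun_eq_iff)

lemma msk_msk [simp]: "msk N (msk N X) = msk N X"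
  by (auto simp: msk_def fun_eq_iff)

lemma msk_lin [simp]: "msk N (X + Y) = msk N X + msk N Y" "msk N (X - Y) = msk N X - msk N Y"
  "msk N (smm c X) = smm c (msk N X)" "msk N (- X) = - msk N X" "msk N 0 = 0"
  by (auto simp: msk_def fun_eq_iff)

lemma msk_madj [simp]: "msk N (madj X) = madj (msk N X)"
  by (auto simp: msk_def fun_eq_iff)

lemma mmult_msk [simp]: "mmult N (msk N X) Y = mmult N X Y" "mmult N X (msk N Y) = mmult N X Y"
  by (rule mmult_cong; simp add: msk_apply)+

lemma mtr_msk [simp]: "mtr N (msk N X) = mtr N X"
  by (rule mtr_cong) (simp add: msk_apply)

lemma mmult_assoc: "mmult N (mmult N X Y) Z = mmult N X (mmult N Y Z)"
proof (rule cmat_eqI[where N = N])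
  fix i j assume ij: "i < N" "j < N"
  have "mmult N (mmult N X Y) Z i j = (\<Sum>l<N. \<Sum>k<N. X i k * Y k l * Z l j)"
    by (simp add: mmult_apply ij sum_distrib_right)
  also have "\<dots> = (\<Sum>k<N. \<Sum>l<N. X i k * Y k l * Z l j)" by (rule sum.swap)
  also have "\<dots> = mmult N X (mmult N Y Z) i j"
    by (simp add: mmult_apply ij sum_distrib_left mult.assoc)
  finally show "mmult N (mmult N X Y) Z i j = mmult N X (mmult N Y Z) i j" .
qed simp_all

lemma mmult_lin [simp]:
  "mmult N (X + X') Y = mmult N X Y + mmult N X' Y"
  "mmult N X (Y + Y') = mmult N X Y + mmult N X Y'"
  "mmult N (X - X') Y = mmult N X Y - mmult N X' Y"
  "mmult N X (Y - Y') = mmult N X Y - mmult N X Y'"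
  "mmult N (- X) Y = - mmult N X Y" "mmult N X (- Y) = - mmult N X Y"
  "mmult N (smm c X) Y = smm c (mmult N X Y)" "mmult N X (smm c Y) = smm c (mmult N X Y)"
  "mmult N 0 Y = 0" "mmult N X 0 = 0"
  by (auto simp: mmult_def fun_eq_iff algebra_simps sum.distrib sum_subtractf sum_negf sum_distrib_left)

lemma mtr_lin [simp]:
  "mtr N (X + Y) = mtr N X + mtr N Y" "mtr N (X - Y) = mtr N X - mtr N Y"
  "mtr N (- X) = - mtr N X" "mtr N (smm c X) = c * mtr N X" "mtr N 0 = 0"
  by (auto simp: mtr_def sum.distrib sum_subtractf sum_negf sum_distrib_left)

lemma madj_lin [simp]: "madj (X + Y) = madj X + madj Y" "madj (X - Y) = madj X - madj Y"
  "madj (- X) = - madj X" "madj (smm c X) = smm (cnj c) (madj X)" "madj (madj X) = X"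
  by (auto simp: fun_eq_iff)

lemma madj_idm [simp]: "madj (idm N) = idm N"
  by (auto simp: fun_eq_iff idm_def)

lemma madj_mmult [simp]: "madj (mmult N X Y) = mmult N (madj Y) (madj X)"
  by (auto simp: mmult_def fun_eq_iff mult.commute)

lemma mmult_idm [simp]: "mmult N (idm N) X = msk N X" "mmult N X (idm N) = msk N X"
  by (auto simp: mmult_def fun_eq_iff msk_def idm_def if_distrib if_distribR sum.delta cong: if_cong)

lemma mtr_idm [simp]: "mtr N (idm N) = of_nat N"
  by (simp add: mtr_def idm_def)

lemma mtr_madj [simp]: "mtr N (madj X) = cnj (mtr N X)"
  by (simp add: mtr_def)

lemma mtr_mmult: "mtr N (mmult N X Y) = (\<Sum>i<N. \<Sum>j<N. X i j * Y j i)"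
  by (simp add: mtr_def mmult_apply)

lemma mtr_cyclic: "mtr N (mmult N X Y) = mtr N (mmult N Y X)"
  unfolding mtr_mmult by (subst sum.swap) (simp add: mult.commute)

lemma mmult_unitm:
  assumes "i < N" "j < N" "b < N"
  shows "mmult N (unitm a b) Z i j = (if i = a then Z b j else 0)"
proof -
  have "mmult N (unitm a b) Z i j = (\<Sum>l<N. if l = b then (if i = a then Z l j else 0) else 0)"
    unfolding mmult_apply[OF assms(1,2)] by (intro sum.cong refl) (simp add: unitm_def)
  then show ?thesis using assms(3) by (simp add: sum.delta)
qed

text \<open>Each summand is \<open>Y a a * Z b b\<close>. This splitting rule is the source of the
  products of traces in the loop equations.\<close>

lemma sum_unitm_mid: "(\<Sum>a<N. \<Sum>b<N. mmult N Y (mmult N (unitm a b) Z) a b) = mtr N Y * mtr N Z"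
proof -
  have "mmult N Y (mmult N (unitm a b) Z) a b = Y a a * Z b b" if "a < N" "b < N" for a b
  proof -
    have "mmult N Y (mmult N (unitm a b) Z) a b = (\<Sum>l<N. if l = a then Y a a * Z b b else 0)"
      unfolding mmult_apply[OF that] by (intro sum.cong refl) (simp add: mmult_unitm that)
    then show ?thesis using that by (simp add: sum.delta)
  qed
  then show ?thesis by (simp add: mtr_def sum_product)
qed

lemma mtr_unitm: "a < N \<Longrightarrow> b < N \<Longrightarrow> mtr N (mmult N (unitm a b) Y) = Y b a"
  by (simp add: mtr_def mmult_unitm sum.delta)

text \<open>The merging rule: the derivative of a trace along matrix units, contracted with
  \<open>G\<close>, becomes one single trace.\<close>

lemma sum_unitm_mtr: "(\<Sum>a<N. \<Sum>b<N. G a b * mtr N (mmult N (unitm a b) Y)) = mtr N (mmult N G Y)"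
  unfolding mtr_mmult[of N G Y] by (intro sum.cong refl) (simp add: mtr_unitm)

section \<open>The Hilbert--Schmidt norm and operator bounds\<close>

definition hs :: "nat \<Rightarrow> cmat \<Rightarrow> real" where
  "hs N X = L2_set (\<lambda>p. cmod (X (fst p) (snd p))) ({..<N} \<times> {..<N})"

lemma hs_nonneg [simp]: "hs N X \<ge> 0" by (simp add: hs_def)

lemma hs_cong: "(\<And>i j. i < N \<Longrightarrow> j < N \<Longrightarrow> cmod (X i j) = cmod (Y i j)) \<Longrightarrow> hs N X = hs N Y"
  by (auto simp: hs_def intro!: L2_set_cong)

lemma hs_msk [simp]: "hs N (msk N X) = hs N X"
  by (rule hs_cong) (simp add: msk_apply)

lemma hs_sq: "(hs N X)\<^sup>2 = (\<Sum>i<N. \<Sum>j<N. (cmod (X i j))\<^sup>2)"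
  by (simp add: hs_def L2_set_def sum_nonneg sum.cartesian_product case_prod_beta)

lemma hs_sq_mtr: "of_real ((hs N X)\<^sup>2) = mtr N (mmult N X (madj X))"
  by (simp add: hs_sq mtr_mmult complex_norm_square del: of_real_power)

lemma hs_madj [simp]: "hs N (madj X) = hs N X"
proof -
  have "(hs N (madj X))\<^sup>2 = (hs N X)\<^sup>2"
    unfolding hs_sq by (subst sum.swap) simp
  then show ?thesis by (metis hs_nonneg power2_eq_imp_eq)
qed

lemma hs_triangle: "hs N (X + Y) \<le> hs N X + hs N Y"
proof -
  have "hs N (X + Y) \<le> L2_set (\<lambda>p. cmod (X (fst p) (snd p)) + cmod (Y (fst p) (snd p))) ({..<N} \<times> {..<N})"
    unfolding hs_def by (rule L2_set_mono) (auto intro: norm_triangle_ineq)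
  also have "\<dots> \<le> hs N X + hs N Y" unfolding hs_def by (rule L2_set_triangle_ineq)
  finally show ?thesis .
qed

lemma hs_smm [simp]: "hs N (smm c X) = cmod c * hs N X"
  by (simp add: hs_def L2_set_right_distrib norm_mult)

lemma hs_minus [simp]: "hs N (- X) = hs N X"
  by (rule hs_cong) simp

lemma hs_triangle_diff: "hs N (X - Y) \<le> hs N X + hs N Y"
  using hs_triangle[of N X "- Y"] by simp

lemma norm_entry_le_hs: "i < N \<Longrightarrow> j < N \<Longrightarrow> cmod (X i j) \<le> hs N X"
  unfolding hs_def
  using member_le_L2_set[of "{..<N} \<times> {..<N}" "(i, j)" "\<lambda>p. cmod (X (fst p) (snd p))"] by simp

lemma norm_mtr_mmult_le: "cmod (mtr N (mmult N X Y)) \<le> hs N X * hs N Y"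
proof -
  have "cmod (mtr N (mmult N X Y)) = cmod (\<Sum>p\<in>{..<N}\<times>{..<N}. X (fst p) (snd p) * Y (snd p) (fst p))"
    by (simp add: mtr_mmult sum.cartesian_product case_prod_beta)
  also have "\<dots> \<le> (\<Sum>p\<in>{..<N}\<times>{..<N}. \<bar>cmod (X (fst p) (snd p))\<bar> * \<bar>cmod (madj Y (fst p) (snd p))\<bar>)"
    by (rule order_trans[OF norm_sum]) (simp add: norm_mult)
  also have "\<dots> \<le> hs N X * hs N (madj Y)"
    unfolding hs_def by (rule L2_set_mult_ineq)
  finally show ?thesis by simp
qed

lemma hs_mmult_le: "hs N (mmult N X Y) \<le> hs N X * hs N Y"
proof -
  have cs: "(cmod (mmult N X Y i j))\<^sup>2 \<le> (\<Sum>l<N. (cmod (X i l))\<^sup>2) * (\<Sum>l<N. (cmod (Y l j))\<^sup>2)"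
    if ij: "i < N" "j < N" for i j
  proof -
    have "cmod (mmult N X Y i j) \<le> (\<Sum>l<N. \<bar>cmod (X i l)\<bar> * \<bar>cmod (Y l j)\<bar>)"
      unfolding mmult_apply[OF ij] by (rule order_trans[OF norm_sum]) (simp add: norm_mult)
    also have "\<dots> \<le> L2_set (\<lambda>l. cmod (X i l)) {..<N} * L2_set (\<lambda>l. cmod (Y l j)) {..<N}"
      by (rule L2_set_mult_ineq)
    finally have "(cmod (mmult N X Y i j))\<^sup>2 \<le> (L2_set (\<lambda>l. cmod (X i l)) {..<N} * L2_set (\<lambda>l. cmod (Y l j)) {..<N})\<^sup>2"
      by (intro power_mono) auto
    then show ?thesis by (simp add: power_mult_distrib L2_set_def sum_nonneg)
  qed
  have "(hs N (mmult N X Y))\<^sup>2 \<le> (\<Sum>i<N. \<Sum>j<N. (\<Sum>l<N. (cmod (X i l))\<^sup>2) * (\<Sum>l<N. (cmod (Y l j))\<^sup>2))"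
    unfolding hs_sq[of N "mmult N X Y"] by (intro sum_mono cs) auto
  also have "\<dots> = (\<Sum>i<N. \<Sum>l<N. (cmod (X i l))\<^sup>2) * (\<Sum>j<N. \<Sum>l<N. (cmod (Y l j))\<^sup>2)"
    by (simp add: sum_product)
  also have "(\<Sum>j<N. \<Sum>l<N. (cmod (Y l j))\<^sup>2) = (hs N Y)\<^sup>2"
    unfolding hs_sq by (rule sum.swap)
  also have "(\<Sum>i<N. \<Sum>l<N. (cmod (X i l))\<^sup>2) = (hs N X)\<^sup>2"
    unfolding hs_sq ..
  finally have "(hs N (mmult N X Y))\<^sup>2 \<le> (hs N X * hs N Y)\<^sup>2" by (simp add: power_mult_distrib)
  then show ?thesis by (rule power2_le_imp_le) simp
qed

lemma hs_idm: "hs N (idm N) = sqrt (real N)"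
proof -
  have "complex_of_real ((hs N (idm N))\<^sup>2) = of_real (real N)"
    unfolding hs_sq_mtr by simp
  then have "(hs N (idm N))\<^sup>2 = real N" by (simp only: of_real_eq_iff)
  then show ?thesis by (metis hs_nonneg real_sqrt_unique)
qed

text \<open>Equivalent to an operator norm of at most \<open>K\<close> (test on matrices with one
  nonzero column), but phrased by left multiplication so that only Hilbert--Schmidt norms
  occur.\<close>

definition op_bound :: "nat \<Rightarrow> cmat \<Rightarrow> real \<Rightarrow> bool" where
  "op_bound N X K \<longleftrightarrow> 0 \<le> K \<and> (\<forall>Y. hs N (mmult N X Y) \<le> K * hs N Y)"

lemma op_boundD: "op_bound N X K \<Longrightarrow> hs N (mmult N X Y) \<le> K * hs N Y" "op_bound N X K \<Longrightarrow> 0 \<le> K"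
  by (auto simp: op_bound_def)

lemma op_bound_mono: "op_bound N X K \<Longrightarrow> K \<le> K' \<Longrightarrow> op_bound N X K'"
  by (meson hs_nonneg mult_right_mono op_bound_def order_trans)

text \<open>By cyclicity the squared norm is the trace of \<open>madj X\<close>, \<open>X\<close>,
  \<open>Y\<close>, \<open>madj Y\<close> multiplied in this order; Cauchy--Schwarz separates the
  last factor.\<close>

lemma hs_mmult_sq_le: "(hs N (mmult N X Y))\<^sup>2 \<le> hs N Y * hs N (mmult N (mmult N (madj X) X) Y)"
proof -
  have "complex_of_real ((hs N (mmult N X Y))\<^sup>2) = mtr N (mmult N (mmult N (mmult N (madj X) X) Y) (madj Y))"
    using mtr_cyclic[of N "mmult N X (mmult N Y (madj Y))" "madj X"]
    unfolding hs_sq_mtr by (simp add: mmult_assoc)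
  then have "(hs N (mmult N X Y))\<^sup>2 = cmod (mtr N (mmult N (mmult N (mmult N (madj X) X) Y) (madj Y)))"
    using norm_of_real[of "(hs N (mmult N X Y))\<^sup>2", where 'a = complex] by simp
  also have "\<dots> \<le> hs N (mmult N (mmult N (madj X) X) Y) * hs N (madj Y)" by (rule norm_mtr_mmult_le)
  finally show ?thesis by (simp add: mult.commute)
qed

text \<open>By \<open>hs_mmult_sq_le\<close> the square of the norm in question is at most
  \<open>K * hs N Y\<close> times that norm itself, and one power cancels.\<close>

lemma op_bound_madj:
  assumes "op_bound N X K" shows "op_bound N (madj X) K"
  unfolding op_bound_def
proof (intro conjI allI)
  show "0 \<le> K" using assms by (simp add: op_bound_def)
  fix Y
  let ?h = "hs N (mmult N (madj X) Y)"
  have "?h\<^sup>2 \<le> hs N Y * hs N (mmult N X (mmult N (madj X) Y))"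
    using hs_mmult_sq_le[of N "madj X" Y] by (simp add: mmult_assoc)
  also have "\<dots> \<le> hs N Y * (K * ?h)"
    by (intro mult_left_mono op_boundD(1) assms) simp
  finally have "?h * ?h \<le> (K * hs N Y) * ?h" by (simp add: power2_eq_square mult_ac)
  then show "?h \<le> K * hs N Y"
    using \<open>0 \<le> K\<close> by (cases "?h = 0") (auto simp: mult_le_cancel_right order_less_le)
qed

lemma op_bound_right: "op_bound N X K \<Longrightarrow> hs N (mmult N Y X) \<le> K * hs N Y"
  using op_boundD(1)[OF op_bound_madj, of N X K "madj Y"]
  by (metis hs_madj madj_mmult)

lemma op_bound_mmult: "op_bound N X K \<Longrightarrow> op_bound N Y L \<Longrightarrow> op_bound N (mmult N X Y) (K * L)"
proof -
  assume X: "op_bound N X K" and Y: "op_bound N Y L"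
  have "hs N (mmult N (mmult N X Y) Z) \<le> K * L * hs N Z" for Z
    using op_boundD(1)[OF X, of "mmult N Y Z"] mult_left_mono[OF op_boundD(1)[OF Y, of Z] op_boundD(2)[OF X]]
    by (simp add: mmult_assoc)
  then show ?thesis using op_boundD(2)[OF X] op_boundD(2)[OF Y] by (simp add: op_bound_def)
qed

lemma op_bound_diff: "op_bound N X K \<Longrightarrow> op_bound N Y L \<Longrightarrow> op_bound N (X - Y) (K + L)"
  unfolding op_bound_def
  by (auto simp: distrib_right intro!: order_trans[OF hs_triangle_diff] add_mono)

text \<open>Orthogonal projection onto the trace-zero matrices for the Hilbert--Schmidt inner
  product. Masking makes the result vanish off the \<open>N\<close> by \<open>N\<close> block, so
  that later identities hold as equalities of functions.\<close>

definition ctr :: "nat \<Rightarrow> cmat \<Rightarrow> cmat" where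
  "ctr N X = msk N X - smm (mtr N X / of_nat N) (idm N)"

lemma mtr_ctr [simp]: "mtr N (ctr N X) = 0"
  by (cases "N = 0") (simp_all add: ctr_def, simp add: mtr_def)

lemma msk_ctr [simp]: "msk N (ctr N X) = ctr N X"
  by (simp add: ctr_def)

lemma madj_ctr: "madj (ctr N X) = ctr N (madj X)"
  by (simp add: ctr_def)

lemma mtr_ctr_mmult: "N \<ge> 1 \<Longrightarrow> mtr N (mmult N (ctr N X) (ctr N Y)) = mtr N (mmult N X Y) - mtr N X * mtr N Y / of_nat N"
  by (simp add: ctr_def)

lemma op_bound_norm_mtr:
  assumes "op_bound N X K" shows "cmod (mtr N X) \<le> K * real N"
proof -
  have "cmod (mtr N X) = cmod (mtr N (mmult N (mmult N X (idm N)) (idm N)))" by simp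
  also have "\<dots> \<le> hs N (mmult N X (idm N)) * hs N (idm N)" by (rule norm_mtr_mmult_le)
  also have "\<dots> \<le> (K * hs N (idm N)) * hs N (idm N)" by (intro mult_right_mono op_boundD(1) assms) simp
  finally show ?thesis by (simp add: hs_idm mult.assoc)
qed

lemma op_bound_ctr:
  assumes "op_bound N X K" shows "op_bound N (ctr N X) (2 * K)"
proof -
  have K: "0 \<le> K" using assms by (simp add: op_bound_def)
  have "op_bound N (msk N X) K" using assms by (simp add: op_bound_def)
  moreover have "op_bound N (smm (mtr N X / of_nat N) (idm N)) K"
  proof -
    have "cmod (mtr N X / of_nat N) \<le> K"
      using op_bound_norm_mtr[OF assms] K by (cases "N = 0") (auto simp: norm_divide divide_le_eq)
    then show ?thesis using K by (auto simp: op_bound_def intro!: mult_right_mono)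
  qed
  ultimately show ?thesis unfolding ctr_def using op_bound_diff by fastforce
qed

text \<open>The Schatten 8-norm. Among the indices 2, 4, 8 it is the first for which bounded
  normalised moments keep the fourth moment of the norm below order \<open>N\<close>.\<close>

definition kap :: "nat \<Rightarrow> cmat \<Rightarrow> real" where
  "kap N X = root 4 (hs N (mmult N (mmult N X (madj X)) (mmult N X (madj X))))"

text \<open>Two applications of Cauchy--Schwarz, \<open>|X* Y|^4 \<le> |Y|^2 |H Y|^2 \<le> |Y|^4 |H^2|\<close> with
  \<open>H = X X*\<close>, bound the operator norm by a moment without any spectral theory.\<close>
lemma op_bound_kap: "op_bound N X (kap N X)"
proof -
  define H where "H = mmult N X (madj X)"
  have Hadj: "madj H = H" by (simp add: H_def)
  have k: "kap N X ^ 4 = hs N (mmult N H H)" "kap N X \<ge> 0"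
    by (simp_all add: kap_def H_def)
  have "hs N (mmult N (madj X) Y) \<le> kap N X * hs N Y" for Y
  proof -
    have 1: "(hs N (mmult N (madj X) Y))\<^sup>2 \<le> hs N Y * hs N (mmult N H Y)"
      using hs_mmult_sq_le[of N "madj X" Y] by (simp add: H_def)
    have "(hs N (mmult N H Y))\<^sup>2 \<le> hs N Y * hs N (mmult N (mmult N H H) Y)"
      using hs_mmult_sq_le[of N H Y] by (simp add: Hadj)
    also have "\<dots> \<le> hs N Y * (hs N (mmult N H H) * hs N Y)"
      by (intro mult_left_mono hs_mmult_le) simp
    finally have 2: "(hs N (mmult N H Y))\<^sup>2 \<le> kap N X ^ 4 * (hs N Y)\<^sup>2"
      by (simp add: k power2_eq_square mult_ac)
    have "(hs N (mmult N (madj X) Y)) ^ 4 = ((hs N (mmult N (madj X) Y))\<^sup>2)\<^sup>2" by simp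
    also have "\<dots> \<le> (hs N Y * hs N (mmult N H Y))\<^sup>2" using 1 by (intro power_mono) auto
    also have "\<dots> \<le> (hs N Y)\<^sup>2 * (kap N X ^ 4 * (hs N Y)\<^sup>2)"
      unfolding power_mult_distrib by (intro mult_left_mono 2) simp
    also have "\<dots> = (kap N X * hs N Y) ^ 4" by (simp add: power_mult_distrib power4_eq_xxxx power2_eq_square mult_ac)
    finally show ?thesis using k(2) by (auto intro: power_mono_iff[THEN iffD1])
  qed
  then have "op_bound N (madj X) (kap N X)" using k by (simp add: op_bound_def)
  then show ?thesis using op_bound_madj by fastforce
qed

lemma kap_nonneg [simp]: "kap N X \<ge> 0" by (simp add: kap_def)

text \<open>Connects \<open>kap\<close> with the normalised moments of hypothesis (b), at exponent
  4.\<close>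

lemma kap_pow8: "of_real (kap N X ^ 8) = mtr N (mpow N (mmult N X (madj X)) 4)"
proof -
  define H where "H = mmult N X (madj X)"
  have Hadj: "madj H = H" by (simp add: H_def)
  have "kap N X ^ 8 = (kap N X ^ 4)\<^sup>2" by simp
  also have "kap N X ^ 4 = hs N (mmult N H H)" by (simp add: kap_def H_def)
  finally have "of_real (kap N X ^ 8) = mtr N (mmult N (mmult N H H) (madj (mmult N H H)))"
    unfolding hs_sq_mtr[symmetric] by simp
  also have "\<dots> = mtr N (mpow N H 4)" by (simp add: Hadj mmult_assoc numeral_eq_Suc)
  finally show ?thesis unfolding H_def .
qed

section \<open>Unitarily invariant ensembles and derivations along one-parameter groups\<close>

text \<open>The cubic relation confines the spectrum to 0, \<i> and -\<i>, so the exponential is a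
  trigonometric polynomial in closed form. These directions suffice because they span all matrices
  over the complex numbers, see \<open>skewm_decomp\<close>.\<close>

definition skewm :: "nat \<Rightarrow> cmat \<Rightarrow> bool" where
  "skewm N X \<longleftrightarrow> msk N X = X \<and> madj X = - X \<and> mmult N X (mmult N X X) = - X"

text \<open>For \<open>X* = - X\<close> and \<open>X^3 = - X\<close> this is the one-parameter group \<open>exp (t X)\<close>.\<close>
definition rot :: "nat \<Rightarrow> cmat \<Rightarrow> real \<Rightarrow> cmat" where
  "rot N X t = idm N + smm (of_real (sin t)) X + smm (of_real (1 - cos t)) (mmult N X X)"

lemma madj_rot:
  assumes "skewm N X" shows "madj (rot N X t) = rot N X (- t)"
proof -
  have X: "madj X = - X" using assms by (simp add: skewm_def)
  have "madj (rot N X t) = idm N + smm (of_real (sin t)) (- X) + smm (of_real (1 - cos t)) (mmult N X X)"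
    by (simp add: rot_def X)
  then show ?thesis by (auto simp: rot_def fun_eq_iff)
qed

text \<open>Since X^4 = - X^2, the coefficient of X^2 is 2 (1 - cos t) - (1 - cos t)^2 - (sin t)^2 =
  0.\<close>

lemma rot_mult_inverse:
  assumes "skewm N X" shows "mmult N (rot N X t) (rot N X (- t)) = idm N"
proof -
  have X: "msk N X = X" "mmult N X (mmult N X X) = - X" using assms by (auto simp: skewm_def)
  have sc: "complex_of_real (sin t) * of_real (sin t) = 1 - of_real (cos t) * of_real (cos t)"
    by (metis cos_squared_eq of_real_1 of_real_diff of_real_mult power2_eq_square sin_squared_eq)
  have "mmult N (rot N X t) (rot N X (- t)) = idm N
      + smm (2 * (1 - of_real (cos t)) - (1 - of_real (cos t))\<^sup>2 - of_real (sin t) * of_real (sin t)) (mmult N X X)"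
    by (simp add: rot_def X mmult_assoc) (auto simp: fun_eq_iff algebra_simps power2_eq_square)
  also have "\<dots> = idm N"
    unfolding sc by (auto simp: fun_eq_iff algebra_simps power2_eq_square)
  finally show ?thesis .
qed

lemma unitary_rot: "skewm N X \<Longrightarrow> unitary N (rot N X t)"
  using rot_mult_inverse[of N X t] rot_mult_inverse[of N X "- t"]
  by (simp add: unitary_def madj_rot)

lemma mmult_rot:
  assumes "skewm N X"
  shows "mmult N X (rot N X t) = smm (of_real (cos t)) X + smm (of_real (sin t)) (mmult N X X)"
proof -
  have X: "msk N X = X" "mmult N X (mmult N X X) = - X" using assms by (auto simp: skewm_def)
  have "mmult N X (rot N X t) = X + smm (of_real (sin t)) (mmult N X X) + smm (of_real (1 - cos t)) (- X)"
    by (simp add: rot_def X)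
  then show ?thesis by (auto simp: fun_eq_iff algebra_simps)
qed

lemma rot_deriv:
  assumes "skewm N X"
  shows "((\<lambda>t. rot N X t i j) has_vector_derivative mmult N X (rot N X t) i j) (at t)"
  unfolding mmult_rot[OF assms] unfolding rot_def mat_entry
  by (auto intro!: derivative_eq_intros simp: has_vector_derivative_def scaleR_conv_of_real algebra_simps)

lemma msk_unitm: "a < N \<Longrightarrow> b < N \<Longrightarrow> msk N (unitm a b) = unitm a b"
  by (auto simp: msk_def unitm_def fun_eq_iff)

lemma madj_unitm: "madj (unitm a b) = unitm b a"
  by (auto simp: unitm_def fun_eq_iff)

lemma unitm_mult:
  assumes "i < N" "j < N" "k < N" "l < N"
  shows "mmult N (unitm i j) (unitm k l) = (if j = k then unitm i l else 0)"
  by (rule cmat_eqI[where N = N]) (use assms in \<open>auto simp: mmult_unitm msk_unitm, auto simp: unitm_def\<close>)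

text \<open>The complexification of the skew-Hermitian matrices is the full matrix algebra. The
  generators are the usual ones, \<i> times a diagonal unit and two off-diagonal combinations, and
  they satisfy the cubic relation.\<close>

lemma skewm_decomp:
  assumes "a < N" "b < N"
  obtains X Y c d where "skewm N X" "skewm N Y" "unitm a b = smm c X + smm d Y"
proof (cases "a = b")
  case True
  let ?X = "smm \<i> (unitm a a)"
  have "mmult N (unitm a a) (unitm a a) = unitm a a" "msk N (unitm a a) = unitm a a" "madj (unitm a a) = unitm a a"
    using assms by (simp_all add: unitm_mult msk_unitm madj_unitm)
  then have "skewm N ?X"
    by (simp add: skewm_def) (auto simp: fun_eq_iff)
  moreover have "unitm a b = smm (- \<i>) ?X + smm 0 ?X"
    using True by (auto simp: fun_eq_iff)
  ultimately show ?thesis using that by blast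
next
  case False
  let ?E = "\<lambda>i j. unitm i j :: cmat"
  let ?X = "?E a b - ?E b a" and ?Y = "smm \<i> (?E a b + ?E b a)"
  have "skewm N ?X" "skewm N ?Y"
    using assms False by (simp_all add: skewm_def unitm_mult msk_unitm madj_unitm) (auto simp: fun_eq_iff algebra_simps)
  moreover have "unitm a b = smm (1/2) ?X + smm (-\<i>/2) ?Y"
    by (auto simp: fun_eq_iff algebra_simps)
  ultimately show ?thesis using that by blast
qed

section \<open>Conjugation of a family by a unitary\<close>

definition cj :: "nat \<Rightarrow> cmat \<Rightarrow> ('k \<Rightarrow> cmat) \<Rightarrow> 'k \<Rightarrow> cmat" where
  "cj N U a = (\<lambda>k. mmult N (mmult N U (a k)) (madj U))"

lemma unitaryD:
  assumes "unitary N U"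
  shows "mmult N (madj U) (mmult N U X) = msk N X" "mmult N U (mmult N (madj U) X) = msk N X"
    "mmult N (madj U) U = idm N" "mmult N U (madj U) = idm N"
  using assms by (simp_all add: unitary_def flip: mmult_assoc)

lemma mtr_conj: "unitary N U \<Longrightarrow> mtr N (mmult N U (mmult N X (madj U))) = mtr N X"
  by (subst mtr_cyclic) (simp add: mmult_assoc unitaryD)

lemma hs_conj: "unitary N U \<Longrightarrow> hs N (mmult N U (mmult N X (madj U))) = hs N X"
proof -
  assume U: "unitary N U"
  have "complex_of_real ((hs N (mmult N U (mmult N X (madj U))))\<^sup>2) = of_real ((hs N X)\<^sup>2)"
    unfolding hs_sq_mtr using mtr_conj[OF U, of "mmult N X (madj X)"]
    by (simp add: mmult_assoc unitaryD[OF U])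
  then show ?thesis by (metis hs_nonneg of_real_eq_iff power2_eq_imp_eq)
qed

lemma fam_entry_measurable [measurable]: "(\<lambda>a. a k i j) \<in> borel_measurable (fam_space :: ('k \<Rightarrow> cmat) measure)"
proof -
  have "(\<lambda>a. a k) \<in> measurable (fam_space :: ('k \<Rightarrow> cmat) measure) (PiM UNIV (\<lambda>_. PiM UNIV (\<lambda>_. borel)))"
    unfolding fam_space_def by (rule measurable_component_singleton) simp
  then have "(\<lambda>a. a k i) \<in> measurable (fam_space :: ('k \<Rightarrow> cmat) measure) (PiM UNIV (\<lambda>_. borel))"
    by (rule measurable_compose[OF _ measurable_component_singleton]) simp
  then show ?thesis
    by (rule measurable_compose[OF _ measurable_component_singleton]) simp
qed

lemma fam_measurableI:
  assumes "\<And>k i j. (\<lambda>x. f x k i j) \<in> borel_measurable M"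
  shows "f \<in> measurable M (fam_space :: ('k \<Rightarrow> cmat) measure)"
  unfolding fam_space_def
  by (rule measurable_PiM_single'; (rule measurable_PiM_single')?; (rule measurable_PiM_single')?)
     (use assms in \<open>auto simp: space_PiM\<close>)

lemma cj_measurable [measurable]: "cj N U \<in> measurable fam_space fam_space"
  by (rule fam_measurableI) (simp add: cj_def mmult_def)

lemma has_vector_derivative_quotient:
  assumes "(f has_vector_derivative f') (at (0::real))"
  shows "((\<lambda>t. (f t - f 0) /\<^sub>R t) \<longlongrightarrow> f') (at 0)"
proof -
  have "((\<lambda>t. norm (f t - f 0 - t *\<^sub>R f') / norm t) \<longlongrightarrow> 0) (at 0)"
    using assms by (simp add: has_vector_derivative_def has_derivative_iff_norm)
  moreover have "\<forall>\<^sub>F t in at 0. norm (f t - f 0 - t *\<^sub>R f') / norm t = norm ((f t - f 0) /\<^sub>R t - f')"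
    unfolding eventually_at_filter
  proof (intro always_eventually allI impI)
    fix t :: real assume t: "t \<noteq> 0"
    have "(f t - f 0) /\<^sub>R t - f' = (f t - f 0 - t *\<^sub>R f') /\<^sub>R t" using t by (simp add: algebra_simps)
    then show "norm (f t - f 0 - t *\<^sub>R f') / norm t = norm ((f t - f 0) /\<^sub>R t - f')"
      by (simp add: divide_inverse mult.commute)
  qed
  ultimately have "((\<lambda>t. norm ((f t - f 0) /\<^sub>R t - f')) \<longlongrightarrow> 0) (at 0)"
    by (rule Lim_transform_eventually)
  then show ?thesis by (metis LIM_zero_iff tendsto_norm_zero_iff)
qed

lemma sum_power_le_two: "0 \<le> u \<Longrightarrow> 0 \<le> v \<Longrightarrow> (u + v) ^ m \<le> 2 ^ m * (u ^ m + v ^ m)" for u v :: real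
proof (induction u v rule: linorder_wlog)
  case (le u v)
  have "(u + v) ^ m \<le> (2 * v) ^ m" using le by (intro power_mono) auto
  also have "\<dots> \<le> 2 ^ m * (u ^ m + v ^ m)" using le by (simp add: power_mult_distrib)
  finally show ?case .
qed (simp add: add.commute)

text \<open>The random family is replaced by its law on \<open>fam_space\<close>, so that
  conjugation acts on the sample points themselves. \<open>S\<close> holds the finitely many indices
  whose matrices occur; finiteness lets one sum \<open>R\<close> dominate them all.\<close>

locale ens = prob_space \<mu> for \<mu> :: "('k \<Rightarrow> cmat) measure" +
  fixes N :: nat and S :: "'k set"
  assumes N: "N \<ge> 1" and sets_mu: "sets \<mu> = sets fam_space"
    and inv: "\<And>U. unitary N U \<Longrightarrow> distr \<mu> fam_space (cj N U) = \<mu>"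
    and fin_S: "finite S"
    and mom: "\<And>k m. k \<in> S \<Longrightarrow> integrable \<mu> (\<lambda>a. hs N (a k) ^ m)"
begin

lemma meas_mu [simp]: "measurable \<mu> M = measurable fam_space M"
  by (rule measurable_cong_sets[OF sets_mu refl])

definition R :: "('k \<Rightarrow> cmat) \<Rightarrow> real" where "R a = (\<Sum>k\<in>S. hs N (a k))"

lemma R_nonneg [simp]: "R a \<ge> 0" by (simp add: R_def sum_nonneg)

lemma R_conj: "unitary N U \<Longrightarrow> R (cj N U a) = R a"
  by (simp add: R_def cj_def mmult_assoc hs_conj)

lemma integral_conj:
  fixes F :: "('k \<Rightarrow> cmat) \<Rightarrow> complex"
  assumes U: "unitary N U" and F: "F \<in> borel_measurable fam_space"
  shows "(\<integral>a. F (cj N U a) \<partial>\<mu>) = (\<integral>a. F a \<partial>\<mu>)"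
proof -
  have "(\<integral>a. F a \<partial>\<mu>) = (\<integral>a. F a \<partial>distr \<mu> fam_space (cj N U))" by (simp add: inv U)
  also have "\<dots> = (\<integral>a. F (cj N U a) \<partial>\<mu>)" by (rule integral_distr) (use F in simp_all)
  finally show ?thesis by simp
qed

lemma integrable_R: "integrable \<mu> (\<lambda>a. (1 + R a) ^ m)"
proof -
  have "integrable \<mu> (\<lambda>a. (1 + (\<Sum>k\<in>S'. hs N (a k))) ^ m)" if "finite S'" "S' \<subseteq> S" for S'
    using that
  proof (induction S')
    case (insert k S')
    then have i: "integrable \<mu> (\<lambda>a. 2 ^ m * (hs N (a k) ^ m + (1 + (\<Sum>k\<in>S'. hs N (a k))) ^ m))"
      by (intro integrable_mult_right Bochner_Integration.integrable_add mom) auto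
    have m: "(\<lambda>a. (1 + (\<Sum>k\<in>insert k S'. hs N (a k))) ^ m) \<in> borel_measurable \<mu>"
      unfolding hs_def L2_set_def meas_mu by measurable
    show ?case
    proof (rule Bochner_Integration.integrable_bound[OF i m], rule AE_I2)
      fix a :: "'k \<Rightarrow> cmat"
      have "(hs N (a k) + (1 + (\<Sum>k\<in>S'. hs N (a k)))) ^ m
          \<le> 2 ^ m * (hs N (a k) ^ m + (1 + (\<Sum>k\<in>S'. hs N (a k))) ^ m)"
        by (rule sum_power_le_two) (simp_all add: sum_nonneg)
      then show "norm ((1 + (\<Sum>k\<in>insert k S'. hs N (a k))) ^ m)
          \<le> norm (2 ^ m * (hs N (a k) ^ m + (1 + (\<Sum>k\<in>S'. hs N (a k))) ^ m))"
        using insert by (simp add: sum_nonneg algebra_simps abs_mult)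
    qed
  qed simp
  from this[OF fin_S] show ?thesis by (simp add: R_def)
qed

text \<open>Bounds in terms of \<open>R\<close> are invariant under conjugation; this is what dominates the difference
  quotients along a one-parameter group.\<close>
definition pbd :: "(('k \<Rightarrow> cmat) \<Rightarrow> complex) \<Rightarrow> bool" where
  "pbd F \<longleftrightarrow> F \<in> borel_measurable fam_space \<and> (\<exists>c m. \<forall>a. cmod (F a) \<le> c * (1 + R a) ^ m)"

lemma pbdI: "F \<in> borel_measurable fam_space \<Longrightarrow> (\<And>a. cmod (F a) \<le> c * (1 + R a) ^ m) \<Longrightarrow> pbd F"
  by (auto simp: pbd_def)

lemma pbd_meas: "pbd F \<Longrightarrow> F \<in> borel_measurable fam_space"
  by (simp add: pbd_def)

lemma pbdE:
  assumes "pbd F"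
  obtains c m where "c \<ge> 0" "\<And>a. cmod (F a) \<le> c * (1 + R a) ^ m"
proof -
  obtain c m where c: "\<And>a. cmod (F a) \<le> c * (1 + R a) ^ m" using assms by (auto simp: pbd_def)
  have "cmod (F a) \<le> \<bar>c\<bar> * (1 + R a) ^ m" for a
    using c[of a] mult_right_mono[OF abs_ge_self[of c], of "(1 + R a) ^ m"] R_nonneg[of a]
    by (meson add_nonneg_nonneg order_trans zero_le_one zero_le_power)
  then show ?thesis using that[of "\<bar>c\<bar>" m] by simp
qed

lemma pbd_integrable: "pbd F \<Longrightarrow> integrable \<mu> F"
proof -
  assume F: "pbd F"
  obtain c m where b: "\<And>a. cmod (F a) \<le> c * (1 + R a) ^ m" using F by (rule pbdE) blast
  show "integrable \<mu> F"
    by (rule Bochner_Integration.integrable_bound[OF integrable_mult_right[OF integrable_R[of m], of c]])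
       (use F b in \<open>auto simp: pbd_meas intro: order_trans[OF b abs_ge_self]\<close>)
qed

lemma pbd_bounded: "F \<in> borel_measurable fam_space \<Longrightarrow> (\<And>a. cmod (F a) \<le> c) \<Longrightarrow> pbd F"
  by (rule pbdI[where m = 0]) auto

lemma pbd_const [simp]: "pbd (\<lambda>a. c)"
  by (rule pbd_bounded[where c = "cmod c"]) auto

lemma pbd_add: assumes "pbd F" "pbd G" shows "pbd (\<lambda>a. F a + G a)"
proof -
  obtain c m where 1: "c \<ge> 0" "\<And>a. cmod (F a) \<le> c * (1 + R a) ^ m" using assms(1) by (rule pbdE) blast
  obtain c' m' where 2: "c' \<ge> 0" "\<And>a. cmod (G a) \<le> c' * (1 + R a) ^ m'" using assms(2) by (rule pbdE) blast
  have "cmod (F a + G a) \<le> (c + c') * (1 + R a) ^ (m + m')" for a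
  proof -
    have "c * (1 + R a) ^ m \<le> c * (1 + R a) ^ (m + m')" "c' * (1 + R a) ^ m' \<le> c' * (1 + R a) ^ (m + m')"
      using 1(1) 2(1) by (auto intro!: mult_left_mono power_increasing)
    then show ?thesis using 1(2)[of a] 2(2)[of a] norm_triangle_ineq[of "F a" "G a"]
      by (simp add: distrib_right)
  qed
  then show ?thesis
    by (rule pbdI[OF borel_measurable_add[OF assms[THEN pbd_meas]]])
qed

lemma pbd_mult: assumes "pbd F" "pbd G" shows "pbd (\<lambda>a. F a * G a)"
proof -
  obtain c m where 1: "c \<ge> 0" "\<And>a. cmod (F a) \<le> c * (1 + R a) ^ m" using assms(1) by (rule pbdE) blast
  obtain c' m' where 2: "c' \<ge> 0" "\<And>a. cmod (G a) \<le> c' * (1 + R a) ^ m'" using assms(2) by (rule pbdE) blast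
  have "cmod (F a * G a) \<le> (c * c') * (1 + R a) ^ (m + m')" for a
    using mult_mono[OF 1(2)[of a] 2(2)[of a]] 1(1) by (simp add: norm_mult power_add mult_ac)
  then show ?thesis
    by (rule pbdI[OF borel_measurable_times[OF assms[THEN pbd_meas]]])
qed

lemma pbd_sum: "(\<And>i. i \<in> I \<Longrightarrow> pbd (F i)) \<Longrightarrow> pbd (\<lambda>a. \<Sum>i\<in>I. F i a)"
  by (induction I rule: infinite_finite_induct) (auto intro: pbd_add)

lemma pbd_uminus: "pbd F \<Longrightarrow> pbd (\<lambda>a. - F a)"
  using pbd_mult[OF pbd_const[of "-1"], of F] by simp

lemma pbd_diff: "pbd F \<Longrightarrow> pbd G \<Longrightarrow> pbd (\<lambda>a. F a - G a)"
  using pbd_add[OF _ pbd_uminus, of F G] by simp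

lemma pbd_cnj: "pbd F \<Longrightarrow> pbd (\<lambda>a. cnj (F a))"
  unfolding pbd_def
  by (auto intro!: measurable_compose[OF _ borel_measurable_continuous_onI[OF continuous_on_cnj[OF continuous_on_id]]])

lemma pbd_norm: "pbd F \<Longrightarrow> pbd (\<lambda>a. of_real (cmod (F a)))"
  unfolding pbd_def by auto

lemma pbd_dominated:
  assumes "pbd F" "G \<in> borel_measurable fam_space" "\<And>a. cmod (G a) \<le> cmod (F a)"
  shows "pbd G"
  using assms unfolding pbd_def by (meson order_trans)

lemma pbd_power: "pbd F \<Longrightarrow> pbd (\<lambda>a. F a ^ m)"
  by (induction m) (auto intro: pbd_mult)

lemmas pbd_intros = pbd_const pbd_add pbd_mult pbd_sum pbd_uminus pbd_diff pbd_cnj pbd_norm pbd_power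

text \<open>Only directions \<open>X\<close> with \<open>skewm N X\<close> come from curves of unitaries. The direction is nevertheless an
  arbitrary matrix and \<open>D\<close> is required to be complex linear in it, so that matrix units can be inserted.\<close>
definition der :: "(('k \<Rightarrow> cmat) \<Rightarrow> complex) \<Rightarrow> (cmat \<Rightarrow> ('k \<Rightarrow> cmat) \<Rightarrow> complex) \<Rightarrow> bool" where
  "der F D \<longleftrightarrow> pbd F \<and> (\<forall>X. pbd (D X)) \<and>
     (\<forall>X Y a. D (X + Y) a = D X a + D Y a) \<and> (\<forall>c X a. D (smm c X) a = c * D X a) \<and>
     (\<forall>X a t. skewm N X \<longrightarrow>
       ((\<lambda>t. F (cj N (rot N X t) a)) has_vector_derivative D X (cj N (rot N X t) a)) (at t))"

text \<open>The expectation of \<open>F\<close> along the orbit does not depend on time. The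
  difference quotients are dominated by a power of \<open>1 + R\<close>, because the bound on
  \<open>D X\<close> is constant along the orbit, so the limit may be taken under the
  integral.\<close>

lemma integral_der_skew:
  assumes D: "der F D" and X: "skewm N X"
  shows "(\<integral>a. D X a \<partial>\<mu>) = 0"
proof -
  let ?c = "\<lambda>t. cj N (rot N X t)"
  have F: "pbd F" "pbd (D X)" using D by (auto simp: der_def)
  obtain c m where c: "c \<ge> 0" "\<And>a. cmod (D X a) \<le> c * (1 + R a) ^ m" using F(2) by (rule pbdE) blast
  define g where "g n a = of_nat (Suc n) * (F (?c (1 / Suc n) a) - F (?c 0 a))" for n a
  have int_conj: "integrable \<mu> (\<lambda>a. F (?c t a))" for t
  proof -
    have "integrable (distr \<mu> fam_space (?c t)) F"
      using pbd_integrable[OF F(1)] by (simp add: inv unitary_rot[OF X])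
    then show ?thesis by (subst (asm) integrable_distr_eq) (use F in \<open>auto simp: pbd_meas\<close>)
  qed
  have g0: "(\<integral>a. g n a \<partial>\<mu>) = 0" for n
    unfolding g_def using int_conj F
    by (simp add: Bochner_Integration.integral_diff integral_conj unitary_rot[OF X] pbd_meas del: of_nat_Suc)
  have bound: "cmod (g n a) \<le> c * (1 + R a) ^ m" for n a
  proof -
    have "cmod (F (?c (1 / Suc n) a) - F (?c 0 a)) \<le> c * (1 + R a) ^ m * norm (1 / Suc n - 0 :: real)"
    proof (rule differentiable_bound[where S = UNIV and f = "\<lambda>t. F (?c t a)" and f' = "\<lambda>t h. h *\<^sub>R D X (?c t a)"])
      fix t show "((\<lambda>t. F (?c t a)) has_derivative (\<lambda>h. h *\<^sub>R D X (?c t a))) (at t)"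
        using D X by (auto simp: der_def has_vector_derivative_def)
      have "cmod (D X (?c t a)) \<le> c * (1 + R a) ^ m"
        using c(2)[of "?c t a"] by (simp add: R_conj unitary_rot[OF X])
      then show "onorm (\<lambda>h. h *\<^sub>R D X (?c t a)) \<le> c * (1 + R a) ^ m"
        by (intro onorm_le) (simp add: mult_left_mono mult.commute)
    qed auto
    then show ?thesis unfolding g_def norm_mult by (simp add: field_simps del: of_nat_Suc)
  qed
  have lim: "(\<lambda>n. g n a) \<longlonglongrightarrow> D X (?c 0 a)" for a
  proof -
    have "((\<lambda>t. F (?c t a)) has_vector_derivative D X (?c 0 a)) (at 0)"
      using D X by (simp add: der_def)
    then have "((\<lambda>t. (F (?c t a) - F (?c 0 a)) /\<^sub>R t) \<longlongrightarrow> D X (?c 0 a)) (at 0)"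
      by (rule has_vector_derivative_quotient)
    moreover have "filterlim (\<lambda>n. 1 / real (Suc n)) (at 0) sequentially"
      unfolding filterlim_at using LIMSEQ_inverse_real_of_nat by (auto simp: inverse_eq_divide)
    ultimately have "(\<lambda>n. (F (?c (1 / Suc n) a) - F (?c 0 a)) /\<^sub>R (1 / Suc n)) \<longlonglongrightarrow> D X (?c 0 a)"
      by (rule filterlim_compose)
    then show ?thesis by (simp add: g_def scaleR_conv_of_real del: of_nat_Suc)
  qed
  have "(\<lambda>n. \<integral>a. g n a \<partial>\<mu>) \<longlonglongrightarrow> (\<integral>a. D X (?c 0 a) \<partial>\<mu>)"
  proof (rule integral_dominated_convergence)
    show "integrable \<mu> (\<lambda>a. c * (1 + R a) ^ m)" by (intro integrable_mult_right integrable_R)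
    show "(\<lambda>a. D X (?c 0 a)) \<in> borel_measurable \<mu>" "\<And>n. g n \<in> borel_measurable \<mu>"
      unfolding g_def meas_mu
      by (intro borel_measurable_times borel_measurable_diff borel_measurable_const
        measurable_compose[OF cj_measurable pbd_meas] F)+
  qed (use lim bound in auto)
  then have "(\<integral>a. D X (?c 0 a) \<partial>\<mu>) = 0" by (simp add: g0 LIMSEQ_const_iff)
  moreover have "(\<integral>a. D X (?c 0 a) \<partial>\<mu>) = (\<integral>a. D X a \<partial>\<mu>)"
    by (rule integral_conj) (use X F in \<open>simp_all add: unitary_rot pbd_meas\<close>)
  ultimately show ?thesis by simp
qed

lemma integral_der:
  assumes D: "der F D" and "a < N" "b < N"
  shows "(\<integral>x. D (unitm a b) x \<partial>\<mu>) = 0"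
proof -
  obtain X Y c d where XY: "skewm N X" "skewm N Y" "unitm a b = smm c X + smm d Y"
    using skewm_decomp[OF assms(2,3)] by blast
  have "D (unitm a b) x = c * D X x + d * D Y x" for x using D by (simp add: XY(3) der_def)
  moreover have "integrable \<mu> (D X)" "integrable \<mu> (D Y)"
    using D by (auto simp: der_def intro: pbd_integrable)
  ultimately show ?thesis using integral_der_skew[OF D] XY by simp
qed

section \<open>Calculus rules for the derivations\<close>

lemma der_add: "der F D \<Longrightarrow> der G E \<Longrightarrow> der (\<lambda>a. F a + G a) (\<lambda>X a. D X a + E X a)"
  unfolding der_def by (auto simp: algebra_simps intro!: pbd_add has_vector_derivative_add)

lemma der_mult: "der F D \<Longrightarrow> der G E \<Longrightarrow> der (\<lambda>a. F a * G a) (\<lambda>X a. D X a * G a + F a * E X a)"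
  unfolding der_def
  apply (intro conjI allI impI)
      apply (auto simp: algebra_simps intro!: pbd_add pbd_mult)[4]
  subgoal for X a t
    using has_vector_derivative_mult[of "\<lambda>t. F (cj N (rot N X t) a)" "D X (cj N (rot N X t) a)" t UNIV
        "\<lambda>t. G (cj N (rot N X t) a)" "E X (cj N (rot N X t) a)"]
    by (simp add: add.commute)
  done

lemma der_const: "der (\<lambda>a. c) (\<lambda>X a. 0)"
  unfolding der_def by auto

lemma der_sum: "(\<And>i. i \<in> I \<Longrightarrow> der (F i) (D i)) \<Longrightarrow> der (\<lambda>a. \<Sum>i\<in>I. F i a) (\<lambda>X a. \<Sum>i\<in>I. D i X a)"
  by (induction I rule: infinite_finite_induct) (auto intro: der_add der_const)

text \<open>Invariant weights can thus multiply any observable in a loop equation without adding a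
  term.\<close>

lemma der_invariant:
  assumes "pbd w" "\<And>U a. unitary N U \<Longrightarrow> w (cj N U a) = w a"
  shows "der w (\<lambda>X a. 0)"
  using assms by (auto simp: der_def unitary_rot)

text \<open>Reality of \<open>Y\<close> keeps the exponential at modulus 1 and hence inside
  \<open>pbd\<close>; powers of \<open>1 + R\<close> do not dominate exponentials in
  general.\<close>

lemma der_iexp:
  assumes Y: "der Y D" and re: "\<And>a. Im (Y a) = 0"
  shows "der (\<lambda>a. exp (\<i> * of_real s * Y a)) (\<lambda>X a. \<i> * of_real s * D X a * exp (\<i> * of_real s * Y a))"
proof -
  have n: "cmod (exp (\<i> * of_real s * Y a)) = 1" for a by (simp add: re)
  have e: "pbd (\<lambda>a. exp (\<i> * of_real s * Y a))"
  proof (rule pbd_bounded[where c = 1])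
    have [measurable]: "Y \<in> borel_measurable fam_space" using Y by (auto simp: der_def pbd_meas)
    show "(\<lambda>a. exp (\<i> * of_real s * Y a)) \<in> borel_measurable fam_space" by measurable
  qed (simp only: n order_refl)
  have d: "((\<lambda>t. exp (\<i> * of_real s * Y (cj N (rot N X t) a))) has_vector_derivative
      \<i> * of_real s * D X (cj N (rot N X t) a) * exp (\<i> * of_real s * Y (cj N (rot N X t) a))) (at t)"
    if X: "skewm N X" for X a t
  proof -
    have "((\<lambda>t. \<i> * of_real s * Y (cj N (rot N X t) a)) has_vector_derivative
        \<i> * of_real s * D X (cj N (rot N X t) a)) (at t)"
      using Y X by (intro has_vector_derivative_mult_right) (auto simp: der_def)
    from field_vector_diff_chain_at[OF this DERIV_exp] show ?thesis by (simp add: o_def)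
  qed
  show ?thesis unfolding der_def using Y e d
    by (auto simp: der_def algebra_simps intro!: pbd_mult)
qed

section \<open>Matrix-valued observables\<close>

definition derm :: "(('k \<Rightarrow> cmat) \<Rightarrow> cmat) \<Rightarrow> (cmat \<Rightarrow> ('k \<Rightarrow> cmat) \<Rightarrow> cmat) \<Rightarrow> bool" where
  "derm C D \<longleftrightarrow> (\<forall>i<N. \<forall>j<N. der (\<lambda>a. C a i j) (\<lambda>X a. D X a i j))"

lemma derm_const: "derm (\<lambda>a. Q) (\<lambda>X a. 0)"
  by (simp add: derm_def der_const)

lemma derm_mmult:
  assumes "derm C D" "derm C' D'"
  shows "derm (\<lambda>a. mmult N (C a) (C' a)) (\<lambda>X a. mmult N (D X a) (C' a) + mmult N (C a) (D' X a))"
  unfolding derm_def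
proof (intro allI impI)
  fix i j assume ij: "i < N" "j < N"
  have "der (\<lambda>a. \<Sum>l<N. C a i l * C' a l j) (\<lambda>X a. \<Sum>l<N. D X a i l * C' a l j + C a i l * D' X a l j)"
    using assms ij by (intro der_sum der_mult) (auto simp: derm_def)
  then show "der (\<lambda>a. mmult N (C a) (C' a) i j) (\<lambda>X a. (mmult N (D X a) (C' a) + mmult N (C a) (D' X a)) i j)"
    using ij by (simp add: mmult_apply sum.distrib)
qed

lemma der_mtr: "derm C D \<Longrightarrow> der (\<lambda>a. mtr N (C a)) (\<lambda>X a. mtr N (D X a))"
  unfolding mtr_def by (rule der_sum) (auto simp: derm_def)

lemma derm_mtr_left:
  assumes "derm C D"
  shows "der (\<lambda>a. mtr N (mmult N Q (C a))) (\<lambda>X a. mtr N (mmult N Q (D X a)))"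
  using der_mtr[OF derm_mmult[OF derm_const[of Q] assms]] by simp

text \<open>Short for covariant: conjugating the sample conjugates the value. Whatever formula
  defines such a map, its derivative is a commutator, see \<open>derm_cov\<close>.\<close>

definition cov :: "(('k \<Rightarrow> cmat) \<Rightarrow> cmat) \<Rightarrow> bool" where
  "cov C \<longleftrightarrow> (\<forall>a. msk N (C a) = C a) \<and> (\<forall>i j. pbd (\<lambda>a. C a i j)) \<and>
     (\<forall>U a. unitary N U \<longrightarrow> C (cj N U a) = mmult N (mmult N U (C a)) (madj U))"

lemma covD:
  assumes "cov C"
  shows "msk N (C a) = C a" "pbd (\<lambda>a. C a i j)"
    "unitary N U \<Longrightarrow> C (cj N U a) = mmult N U (mmult N (C a) (madj U))"
  using assms by (auto simp: cov_def mmult_assoc)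

lemma pbd_mmult: "(\<And>i j. pbd (\<lambda>a. C a i j)) \<Longrightarrow> (\<And>i j. pbd (\<lambda>a. C' a i j)) \<Longrightarrow> pbd (\<lambda>a. mmult N (C a) (C' a) i j)"
  by (cases "i < N \<and> j < N") (auto simp: mmult_def intro!: pbd_sum pbd_mult)

lemma pbd_mtr: "(\<And>i j. pbd (\<lambda>a. C a i j)) \<Longrightarrow> pbd (\<lambda>a. mtr N (C a))"
  by (auto simp: mtr_def intro!: pbd_sum)

lemma cov_mmult:
  assumes "cov C" "cov C'" shows "cov (\<lambda>a. mmult N (C a) (C' a))"
  using assms unfolding cov_def
  by (auto simp: mmult_assoc unitaryD intro!: pbd_mmult)

lemma cov_madj: "cov C \<Longrightarrow> cov (\<lambda>a. madj (C a))"
  unfolding cov_def by (auto simp: mmult_assoc pbd_cnj)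

lemma cov_ctr:
  assumes "cov C" shows "cov (\<lambda>a. ctr N (C a))"
  unfolding cov_def
proof (intro conjI allI impI)
  fix i j
  have "pbd (\<lambda>a. ctr N (C a) i j)"
    using covD(2)[OF assms] by (auto simp: ctr_def covD(1)[OF assms] divide_inverse intro!: pbd_intros pbd_mtr)
  then show "pbd (\<lambda>a. ctr N (C a) i j)" .
next
  fix U a assume U: "unitary N U"
  show "ctr N (C (cj N U a)) = mmult N (mmult N U (ctr N (C a))) (madj U)"
    by (simp add: ctr_def covD(1,3)[OF assms] U mtr_conj mmult_assoc unitaryD[OF U])
qed (simp add: msk_lin)

lemma cov_proj: assumes "k \<in> S" shows "cov (\<lambda>a. msk N (a k))"
  unfolding cov_def
proof (intro conjI allI impI)
  fix i j
  have "cmod (msk N (a k) i j) \<le> 1 * (1 + R a) ^ 1" for a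
  proof (cases "i < N \<and> j < N")
    case True
    have "hs N (a k) \<le> R a" unfolding R_def using assms fin_S by (intro member_le_sum) auto
    then show ?thesis using True norm_entry_le_hs[of i N j "a k"] by (simp add: msk_apply)
  qed (auto simp: msk_def)
  then show "pbd (\<lambda>a. msk N (a k) i j)"
    by (intro pbdI[where c = 1 and m = 1]) (simp_all add: msk_def)
qed (simp_all add: cj_def)

text \<open>Along the group the value is \<open>C a\<close> between \<open>rot N X t\<close> and
  \<open>rot N X (- t)\<close>. Both outer factors are differentiated, and since \<open>X\<close>
  commutes with the group, the result is the commutator.\<close>

lemma derm_cov:
  assumes "cov C"
  shows "derm C (\<lambda>X a. mmult N X (C a) - mmult N (C a) X)"
  unfolding derm_def
proof (intro allI impI)
  fix i j assume ij: "i < N" "j < N"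
  have p: "pbd (\<lambda>a. C a i j)" for i j by (rule covD(2)[OF assms])
  have dv: "((\<lambda>t. C (cj N (rot N X t) a) i j) has_vector_derivative
      (mmult N X (C (cj N (rot N X t) a)) - mmult N (C (cj N (rot N X t) a)) X) i j) (at t)"
    if X: "skewm N X" for X a t
  proof -
    let ?U = "\<lambda>t. rot N X t"
    have eq: "C (cj N (?U t) a) i j = (\<Sum>p<N. ?U t i p * (\<Sum>q<N. C a p q * ?U (- t) q j))" for t
      unfolding covD(3)[OF assms unitary_rot[OF X]] by (simp add: mmult_apply ij madj_rot[OF X])
    have X': "mmult N (?U (- t)) X = mmult N X (?U (- t))" for t
      using X by (simp add: rot_def skewm_def mmult_assoc)
    have neg: "((\<lambda>t. ?U (- t) q j) has_vector_derivative - mmult N (?U (- t)) X q j) (at t)" for q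
    proof -
      have "((\<lambda>t. rot N X t q j) \<circ> uminus has_vector_derivative - 1 *\<^sub>R mmult N X (rot N X (- t)) q j) (at t)"
        by (rule vector_diff_chain_at) (auto intro!: derivative_eq_intros rot_deriv X)
      then show ?thesis by (simp add: o_def X')
    qed
    have "((\<lambda>t. \<Sum>p<N. ?U t i p * (\<Sum>q<N. C a p q * ?U (- t) q j)) has_vector_derivative
       (\<Sum>p<N. ?U t i p * (\<Sum>q<N. C a p q * (- mmult N (?U (- t)) X q j)) + mmult N X (?U t) i p * (\<Sum>q<N. C a p q * ?U (- t) q j))) (at t)"
      by (intro has_vector_derivative_sum has_vector_derivative_mult has_vector_derivative_mult_right neg rot_deriv X)
    moreover have "(\<Sum>p<N. ?U t i p * (\<Sum>q<N. C a p q * (- mmult N (?U (- t)) X q j)) + mmult N X (?U t) i p * (\<Sum>q<N. C a p q * ?U (- t) q j))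
        = (mmult N X (C (cj N (?U t) a)) - mmult N (C (cj N (?U t) a)) X) i j"
    proof -
      have "(mmult N X (C (cj N (?U t) a)) - mmult N (C (cj N (?U t) a)) X) i j
          = mmult N (mmult N X (?U t)) (mmult N (C a) (?U (- t))) i j
            - mmult N (?U t) (mmult N (C a) (mmult N (?U (- t)) X)) i j"
        unfolding covD(3)[OF assms unitary_rot[OF X]] by (simp add: mmult_assoc madj_rot[OF X])
      also have "\<dots> = (\<Sum>p<N. mmult N X (?U t) i p * (\<Sum>q<N. C a p q * ?U (- t) q j))
          - (\<Sum>p<N. ?U t i p * (\<Sum>q<N. C a p q * (mmult N (?U (- t)) X q j)))"
        unfolding mmult_apply[OF ij, of "mmult N X (?U t)"] mmult_apply[OF ij, of "?U t"]
        by (intro arg_cong2[where f = "(-)"] sum.cong refl) (auto simp: mmult_apply ij)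
      finally show ?thesis by (simp add: sum.distrib sum_negf sum_subtractf)
    qed
    ultimately show ?thesis by (simp add: eq)
  qed
  show "der (\<lambda>a. C a i j) (\<lambda>X a. (mmult N X (C a) - mmult N (C a) X) i j)"
    unfolding der_def using p dv ij
    by (auto simp: mmult_apply algebra_simps sum.distrib sum_distrib_left intro!: pbd_diff pbd_mult pbd_sum)
qed

end

section \<open>Loop equations and variance bounds\<close>

lemma sum_unitm_end: "(\<Sum>a<N. \<Sum>b<N. mmult N Y (unitm a b) a b) = of_nat N * mtr N Y"
  using sum_unitm_mid[of N Y "idm N"]
  by (simp add: msk_unitm mult.commute cong: sum.cong_simp)

context ens
begin

text \<open>Integration by parts for the invariant law: the product of each entry of
  \<open>G\<close> with \<open>w\<close> is differentiated along the matching matrix unit, and every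
  such derivative has expectation zero.\<close>

lemma loop_equation:
  assumes G: "derm G DG" and w: "der w D"
  shows "(\<integral>x. (\<Sum>a<N. \<Sum>b<N. DG (unitm a b) x a b) * w x + (\<Sum>a<N. \<Sum>b<N. G x a b * D (unitm a b) x) \<partial>\<mu>) = 0"
proof -
  have d: "der (\<lambda>x. G x a b * w x) (\<lambda>X x. DG X x a b * w x + G x a b * D X x)" if "a < N" "b < N" for a b
    using G w that by (intro der_mult) (auto simp: derm_def)
  have "(\<integral>x. (\<Sum>a<N. \<Sum>b<N. DG (unitm a b) x a b * w x + G x a b * D (unitm a b) x) \<partial>\<mu>)
      = (\<Sum>a<N. \<Sum>b<N. \<integral>x. DG (unitm a b) x a b * w x + G x a b * D (unitm a b) x \<partial>\<mu>)"
  proof -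
    have i: "integrable \<mu> (\<lambda>x. DG (unitm a b) x a b * w x + G x a b * D (unitm a b) x)" if "a < N" "b < N" for a b
      using d[OF that] by (auto simp: der_def intro: pbd_integrable)
    show ?thesis
      by (subst Bochner_Integration.integral_sum)
         (auto intro!: sum.cong Bochner_Integration.integral_sum Bochner_Integration.integrable_sum i)
  qed
  also have "\<dots> = 0" by (intro sum.neutral ballI) (use integral_der[OF d] in auto)
  finally show ?thesis by (simp add: sum.distrib sum_distrib_right)
qed

text \<open>The loop equation for \<open>G = Q C\<close>: the splitting rule turns the two halves of
  the commutator into \<open>Tr Q Tr C\<close> and \<open>N Tr (Q C)\<close>. The identity is exact
  at every \<open>N\<close>.\<close>

lemma integral_mtr_cov:
  assumes C: "cov C" and w: "pbd w" "\<And>U a. unitary N U \<Longrightarrow> w (cj N U a) = w a"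
  shows "of_nat N * (\<integral>a. w a * mtr N (mmult N Q (C a)) \<partial>\<mu>) = mtr N Q * (\<integral>a. w a * mtr N (C a) \<partial>\<mu>)"
proof -
  have "(\<Sum>a<N. \<Sum>b<N. mmult N Q (mmult N (unitm a b) (C x) - mmult N (C x) (unitm a b)) a b)
      = mtr N Q * mtr N (C x) - of_nat N * mtr N (mmult N Q (C x))" for x
    using sum_unitm_mid[of N Q "C x"] sum_unitm_end[of N "mmult N Q (C x)"]
    by (simp add: sum_subtractf mmult_assoc)
  then have "(\<integral>x. (mtr N Q * mtr N (C x) - of_nat N * mtr N (mmult N Q (C x))) * w x \<partial>\<mu>) = 0"
    using loop_equation[OF derm_mmult[OF derm_const[of Q] derm_cov[OF C]] der_invariant[OF w]] by simp
  moreover have "integrable \<mu> (\<lambda>x. w x * mtr N (C x))" "integrable \<mu> (\<lambda>x. w x * mtr N (mmult N Q (C x)))"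
    using w covD(2)[OF C] by (auto intro!: pbd_integrable pbd_mult pbd_mtr pbd_mmult)
  moreover have "(mtr N Q * mtr N (C x) - of_nat N * mtr N (mmult N Q (C x))) * w x
     = mtr N Q * (w x * mtr N (C x)) - of_nat N * (w x * mtr N (mmult N Q (C x)))" for x
    by (simp add: algebra_simps)
  ultimately show ?thesis by simp
qed

text \<open>The same \<open>G\<close>, now weighted by \<open>w\<close> times the conjugate of
  \<open>Tr (Q C)\<close>; the derivative of this conjugate yields the right-hand side by the
  merging rule. Vanishing of \<open>Tr C\<close> removes the product of traces.\<close>

lemma integral_mtr_sq_eq:
  assumes C: "cov C" and t0: "\<And>a. mtr N (C a) = 0"
    and w: "pbd w" "\<And>U a. unitary N U \<Longrightarrow> w (cj N U a) = w a"
  shows "of_nat N * (\<integral>a. w a * of_real ((cmod (mtr N (mmult N Q (C a))))\<^sup>2) \<partial>\<mu>) =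
    (\<integral>a. w a * (of_real ((hs N (mmult N Q (C a)))\<^sup>2)
       - mtr N (mmult N (mmult N Q (C a)) (mmult N (madj Q) (madj (C a))))) \<partial>\<mu>)"
proof -
  let ?T = "\<lambda>a. mtr N (mmult N (madj (C a)) (madj Q))"
  have T: "?T a = cnj (mtr N (mmult N Q (C a)))" for a by (simp flip: mtr_madj)
  have dT: "der (\<lambda>a. w a * ?T a) (\<lambda>X a. w a * mtr N (mmult N (mmult N X (madj (C a)) - mmult N (madj (C a)) X) (madj Q)))"
    using der_mult[OF der_invariant[OF w] der_mtr[OF derm_mmult[OF derm_cov[OF cov_madj[OF C]] derm_const[of "madj Q"]]]]
    by simp
  have 1: "(\<Sum>a<N. \<Sum>b<N. mmult N Q (mmult N (unitm a b) (C x) - mmult N (C x) (unitm a b)) a b)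
      = - of_nat N * mtr N (mmult N Q (C x))" for x
    using sum_unitm_mid[of N Q "C x"] sum_unitm_end[of N "mmult N Q (C x)"]
    by (simp add: sum_subtractf mmult_assoc t0)
  have 2: "(\<Sum>a<N. \<Sum>b<N. mmult N Q (C x) a b * (w x * mtr N (mmult N (mmult N (unitm a b) (madj (C x)) - mmult N (madj (C x)) (unitm a b)) (madj Q))))
     = w x * (of_real ((hs N (mmult N Q (C x)))\<^sup>2) - mtr N (mmult N (mmult N Q (C x)) (mmult N (madj Q) (madj (C x)))))" for x
  proof -
    have e: "mtr N (mmult N (mmult N (unitm a b) (madj (C x)) - mmult N (madj (C x)) (unitm a b)) (madj Q))
      = mtr N (mmult N (unitm a b) (mmult N (madj (C x)) (madj Q) - mmult N (madj Q) (madj (C x))))" for a b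
      using mtr_cyclic[of N "madj (C x)" "mmult N (unitm a b) (madj Q)"] by (simp add: mmult_assoc)
    have "(\<Sum>a<N. \<Sum>b<N. mmult N Q (C x) a b * (w x * mtr N (mmult N (mmult N (unitm a b) (madj (C x)) - mmult N (madj (C x)) (unitm a b)) (madj Q))))
      = w x * (\<Sum>a<N. \<Sum>b<N. mmult N Q (C x) a b * mtr N (mmult N (unitm a b) (mmult N (madj (C x)) (madj Q) - mmult N (madj Q) (madj (C x)))))"
      unfolding e sum_distrib_left by (intro sum.cong refl) (simp add: mult_ac)
    then show ?thesis unfolding sum_unitm_mtr hs_sq_mtr by simp
  qed
  define f where "f x = w x * of_real ((cmod (mtr N (mmult N Q (C x))))\<^sup>2)" for x
  define g where "g x = w x * (of_real ((hs N (mmult N Q (C x)))\<^sup>2) - mtr N (mmult N (mmult N Q (C x)) (mmult N (madj Q) (madj (C x)))))" for x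
  have A: "(\<integral>x. - of_nat N * mtr N (mmult N Q (C x)) * (w x * ?T x) + g x \<partial>\<mu>) = 0"
    using loop_equation[OF derm_mmult[OF derm_const[of Q] derm_cov[OF C]] dT] 1 2 by (simp add: g_def)
  have e: "- of_nat N * mtr N (mmult N Q (C x)) * (w x * ?T x) + g x = g x - of_nat N * f x" for x
    unfolding T f_def complex_norm_square by (simp add: mult_ac)
  have "pbd f"
    unfolding f_def complex_norm_square
    using w covD(2)[OF C] by (auto intro!: pbd_mult pbd_mtr pbd_mmult pbd_cnj)
  moreover have "pbd g"
    unfolding g_def hs_sq_mtr
    using w covD(2)[OF C] covD(2)[OF cov_madj[OF C]] by (auto intro!: pbd_diff pbd_mult pbd_mtr pbd_mmult pbd_cnj)
  ultimately have "of_nat N * (\<integral>x. f x \<partial>\<mu>) = (\<integral>x. g x \<partial>\<mu>)"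
    using A unfolding e by (simp add: pbd_integrable)
  then show ?thesis unfolding f_def g_def .
qed

section \<open>Real observables and variance estimates\<close>

definition rpbd :: "(('k \<Rightarrow> cmat) \<Rightarrow> real) \<Rightarrow> bool" where
  "rpbd f \<longleftrightarrow> pbd (\<lambda>a. complex_of_real (f a))"

lemma rpbd_integrable: "rpbd f \<Longrightarrow> integrable \<mu> f"
  unfolding rpbd_def using pbd_integrable[of "\<lambda>a. complex_of_real (f a)"] by (simp add: complex_of_real_integrable_eq)

lemma rpbd_mult: "rpbd f \<Longrightarrow> rpbd g \<Longrightarrow> rpbd (\<lambda>a. f a * g a)"
  unfolding rpbd_def using pbd_mult by force

lemma rpbd_add: "rpbd f \<Longrightarrow> rpbd g \<Longrightarrow> rpbd (\<lambda>a. f a + g a)"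
  unfolding rpbd_def using pbd_add by force

lemma rpbd_const: "rpbd (\<lambda>a. c)"
  unfolding rpbd_def by simp

lemma rpbd_power: "rpbd f \<Longrightarrow> rpbd (\<lambda>a. f a ^ m)"
  unfolding rpbd_def using pbd_power[of "\<lambda>a. complex_of_real (f a)" m] by simp

lemma rpbd_sum: "(\<And>i. i \<in> I \<Longrightarrow> rpbd (f i)) \<Longrightarrow> rpbd (\<lambda>a. \<Sum>i\<in>I. f i a)"
  unfolding rpbd_def by (simp add: pbd_sum)

lemma rpbd_norm: "pbd F \<Longrightarrow> rpbd (\<lambda>a. cmod (F a))"
  unfolding rpbd_def by (rule pbd_norm)

lemma rpbd_Re: "pbd F \<Longrightarrow> rpbd (\<lambda>a. Re (F a))"
proof -
  assume F: "pbd F"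
  have [measurable]: "F \<in> borel_measurable fam_space" by (rule pbd_meas[OF F])
  show ?thesis unfolding rpbd_def
    by (rule pbd_dominated[OF F]) (auto simp: abs_Re_le_cmod)
qed

lemma rpbd_hs_sq: "(\<And>i j. pbd (\<lambda>a. C a i j)) \<Longrightarrow> rpbd (\<lambda>a. (hs N (C a))\<^sup>2)"
  unfolding rpbd_def hs_sq_mtr by (intro pbd_mtr pbd_mmult) (auto intro: pbd_cnj)

lemmas rpbd_intros = rpbd_mult rpbd_add rpbd_const rpbd_power rpbd_sum rpbd_norm

lemma norm_mtr_twist_le:
  "cmod (mtr N (mmult N (mmult N Q C) (mmult N (madj Q) (madj C)))) \<le> ((hs N (mmult N Q C))\<^sup>2 + (hs N (mmult N C Q))\<^sup>2) / 2"
proof -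
  have "hs N (mmult N (madj Q) (madj C)) = hs N (mmult N C Q)"
    using hs_madj[of N "mmult N C Q"] by (simp del: hs_madj)
  then have "cmod (mtr N (mmult N (mmult N Q C) (mmult N (madj Q) (madj C)))) \<le> hs N (mmult N Q C) * hs N (mmult N C Q)"
    using norm_mtr_mmult_le[of N "mmult N Q C" "mmult N (madj Q) (madj C)"] by simp
  moreover have "x * y \<le> (x\<^sup>2 + y\<^sup>2) / 2" for x y :: real
    using sum_squares_bound[of x y] by simp
  ultimately show ?thesis by (rule order_trans)
qed

text \<open>The first-moment identity for the pair \<open>mmult N (madj Q) Q\<close> and
  \<open>mmult N (C a) (madj (C a))\<close>, whose trace pairing is the squared norm.\<close>

lemma integral_hs_sq:
  assumes C: "cov C" and w: "rpbd w" "\<And>U a. unitary N U \<Longrightarrow> w (cj N U a) = w a"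
  shows "real N * (\<integral>a. w a * (hs N (mmult N Q (C a)))\<^sup>2 \<partial>\<mu>) = (hs N Q)\<^sup>2 * (\<integral>a. w a * (hs N (C a))\<^sup>2 \<partial>\<mu>)"
proof -
  have e: "complex_of_real ((hs N (mmult N Q (C a)))\<^sup>2) = mtr N (mmult N (mmult N (madj Q) Q) (mmult N (C a) (madj (C a))))" for a
    using mtr_cyclic[of N "mmult N Q (mmult N (C a) (madj (C a)))" "madj Q"]
    unfolding hs_sq_mtr by (simp add: mmult_assoc)
  have q: "complex_of_real ((hs N Q)\<^sup>2) = mtr N (mmult N (madj Q) Q)"
    using hs_sq_mtr[of N Q] by (simp add: mtr_cyclic)
  have "complex_of_real (real N * (\<integral>a. w a * (hs N (mmult N Q (C a)))\<^sup>2 \<partial>\<mu>))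
     = of_nat N * (\<integral>a. of_real (w a) * mtr N (mmult N (mmult N (madj Q) Q) (mmult N (C a) (madj (C a)))) \<partial>\<mu>)"
    unfolding e[symmetric] of_real_mult[symmetric] integral_complex_of_real by simp
  also have "\<dots> = complex_of_real ((hs N Q)\<^sup>2) * (\<integral>a. of_real (w a) * mtr N (mmult N (C a) (madj (C a))) \<partial>\<mu>)"
    using integral_mtr_cov[OF cov_mmult[OF C cov_madj[OF C]], of "\<lambda>a. of_real (w a)" "mmult N (madj Q) Q"] w
    unfolding q by (simp add: rpbd_def)
  also have "\<dots> = complex_of_real ((hs N Q)\<^sup>2 * (\<integral>a. w a * (hs N (C a))\<^sup>2 \<partial>\<mu>))"
    unfolding hs_sq_mtr[symmetric] by (simp del: of_real_power flip: of_real_mult)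
  finally show ?thesis by (simp only: of_real_eq_iff)
qed

text \<open>One factor 1/N comes from the second-moment identity, the other from averaging the norms
  of the products. The weight is carried along for the crossing estimate, where it is a random
  norm.\<close>

lemma variance_bound:
  assumes C: "cov C" and t0: "\<And>a. mtr N (C a) = 0"
    and w: "rpbd w" "\<And>U a. unitary N U \<Longrightarrow> w (cj N U a) = w a" "\<And>a. 0 \<le> w a"
  shows "(\<integral>a. w a * (cmod (mtr N (mmult N Q (C a))))\<^sup>2 \<partial>\<mu>) \<le> 2 * (hs N Q)\<^sup>2 * (\<integral>a. w a * (hs N (C a))\<^sup>2 \<partial>\<mu>) / (real N)\<^sup>2"
    (is "?L \<le> _")
proof -
  let ?X = "\<lambda>a. mtr N (mmult N (mmult N Q (C a)) (mmult N (madj Q) (madj (C a))))"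
  have pC: "\<And>i j. pbd (\<lambda>a. C a i j)" "\<And>i j. pbd (\<lambda>a. madj (C a) i j)"
    using covD(2)[OF C] covD(2)[OF cov_madj[OF C]] by auto
  have pX: "pbd ?X" by (intro pbd_mtr pbd_mmult pC pbd_const)
  have r1: "rpbd (\<lambda>a. w a * (hs N (mmult N Q (C a)))\<^sup>2)" "rpbd (\<lambda>a. w a * (hs N (mmult N (C a) Q))\<^sup>2)"
    using w by (auto intro!: rpbd_mult rpbd_hs_sq pbd_mmult pC)
  have swap: "hs N (mmult N (C a) Q) = hs N (mmult N (madj Q) (madj (C a)))" for a
    using hs_madj[of N "mmult N (C a) Q"] by (simp del: hs_madj)
  have i1: "real N * (\<integral>a. w a * (hs N (mmult N Q (C a)))\<^sup>2 \<partial>\<mu>) = (hs N Q)\<^sup>2 * (\<integral>a. w a * (hs N (C a))\<^sup>2 \<partial>\<mu>)"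
    by (rule integral_hs_sq[OF C w(1,2)])
  have i2: "real N * (\<integral>a. w a * (hs N (mmult N (C a) Q))\<^sup>2 \<partial>\<mu>) = (hs N Q)\<^sup>2 * (\<integral>a. w a * (hs N (C a))\<^sup>2 \<partial>\<mu>)"
    unfolding swap using integral_hs_sq[OF cov_madj[OF C] w(1,2), of "madj Q"] by simp
  have Npos: "0 < real N" using N by simp
  have "complex_of_real (real N * ?L) = of_nat N * (\<integral>a. of_real (w a) * of_real ((cmod (mtr N (mmult N Q (C a))))\<^sup>2) \<partial>\<mu>)"
    unfolding of_real_mult[symmetric] integral_complex_of_real by simp
  also have "\<dots> = (\<integral>a. of_real (w a) * (of_real ((hs N (mmult N Q (C a)))\<^sup>2) - ?X a) \<partial>\<mu>)"
    by (rule integral_mtr_sq_eq[OF C t0]) (use w in \<open>auto simp: rpbd_def\<close>)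
  finally have "real N * ?L = Re (\<integral>a. of_real (w a) * (of_real ((hs N (mmult N Q (C a)))\<^sup>2) - ?X a) \<partial>\<mu>)"
    by (metis Re_complex_of_real)
  also have "\<dots> = (\<integral>a. Re (of_real (w a) * (of_real ((hs N (mmult N Q (C a)))\<^sup>2) - ?X a)) \<partial>\<mu>)"
    by (rule integral_Re[symmetric], rule pbd_integrable)
       (intro pbd_mult pbd_diff pX w(1)[unfolded rpbd_def] pbd_mmult pC pbd_const
          rpbd_hs_sq[of "\<lambda>a. mmult N Q (C a)", unfolded rpbd_def])
  \<comment> \<open>The twisted trace is at most half the sum of the two squared norms, hence the
    coefficients 3/2 and 1/2. Both norms have the same weighted average, so they add up to the
    constant 2.\<close>
  also have "\<dots> \<le> (\<integral>a. w a * (hs N (mmult N Q (C a)))\<^sup>2 * (3/2) + w a * (hs N (mmult N (C a) Q))\<^sup>2 * (1/2) \<partial>\<mu>)"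
  proof (rule integral_mono)
    have "rpbd (\<lambda>a. w a * (hs N (mmult N Q (C a)))\<^sup>2 + - 1 * (w a * Re (?X a)))"
      by (rule rpbd_add[OF r1(1) rpbd_mult[OF rpbd_const rpbd_mult[OF w(1) rpbd_Re[OF pX]]]])
    then show "integrable \<mu> (\<lambda>a. Re (of_real (w a) * (of_real ((hs N (mmult N Q (C a)))\<^sup>2) - ?X a)))"
      by (simp add: algebra_simps rpbd_integrable)
    show "integrable \<mu> (\<lambda>a. w a * (hs N (mmult N Q (C a)))\<^sup>2 * (3/2) + w a * (hs N (mmult N (C a) Q))\<^sup>2 * (1/2))"
      by (intro rpbd_integrable rpbd_add rpbd_mult[OF _ rpbd_const] r1)
    fix a
    have "- Re (?X a) \<le> ((hs N (mmult N Q (C a)))\<^sup>2 + (hs N (mmult N (C a) Q))\<^sup>2) / 2"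
      using norm_mtr_twist_le[of Q "C a"] abs_Re_le_cmod[of "?X a"] by linarith
    from mult_left_mono[OF this w(3)[of a]]
    show "Re (of_real (w a) * (of_real ((hs N (mmult N Q (C a)))\<^sup>2) - ?X a))
        \<le> w a * (hs N (mmult N Q (C a)))\<^sup>2 * (3/2) + w a * (hs N (mmult N (C a) Q))\<^sup>2 * (1/2)"
      by (simp add: algebra_simps)
  qed
  also have "\<dots> = (\<integral>a. w a * (hs N (mmult N Q (C a)))\<^sup>2 \<partial>\<mu>) * (3/2) + (\<integral>a. w a * (hs N (mmult N (C a) Q))\<^sup>2 \<partial>\<mu>) * (1/2)"
    using r1[THEN rpbd_integrable] by simp
  finally have "real N * (real N * ?L) \<le> real N * ((\<integral>a. w a * (hs N (mmult N Q (C a)))\<^sup>2 \<partial>\<mu>) * (3/2) + (\<integral>a. w a * (hs N (mmult N (C a) Q))\<^sup>2 \<partial>\<mu>) * (1/2))"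
    using Npos by (intro mult_left_mono) auto
  also have "\<dots> = (real N * (\<integral>a. w a * (hs N (mmult N Q (C a)))\<^sup>2 \<partial>\<mu>)) * (3/2) + (real N * (\<integral>a. w a * (hs N (mmult N (C a) Q))\<^sup>2 \<partial>\<mu>)) * (1/2)"
    by (simp add: algebra_simps)
  also have "\<dots> = 2 * (hs N Q)\<^sup>2 * (\<integral>a. w a * (hs N (C a))\<^sup>2 \<partial>\<mu>)"
    unfolding i1 i2 by simp
  finally show ?thesis using Npos by (simp add: field_simps power2_eq_square)
qed

lemma op_bound_hs: "op_bound N X K \<Longrightarrow> (hs N X)\<^sup>2 \<le> K\<^sup>2 * real N"
proof -
  assume X: "op_bound N X K"
  have "hs N X \<le> K * sqrt (real N)" using op_boundD(1)[OF X, of "idm N"] by (simp add: hs_idm)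
  from power_mono[OF this, of 2] show ?thesis by (simp add: power_mult_distrib)
qed

text \<open>Concentration of the trace of \<open>Q B B'\<close> around its scalar part: this is the
  variance bound for the centred product, whose operator norm is at most
  \<open>2 * (K a)\<^sup>2\<close>. The constant is 2 times 4.\<close>

lemma covariance_bound:
  assumes B: "cov B" "cov B'" and K: "rpbd K" "\<And>a. op_bound N (B a) (K a)" "\<And>a. op_bound N (B' a) (K a)"
  shows "(\<integral>a. (cmod (mtr N (mmult N Q (ctr N (mmult N (B a) (B' a))))))\<^sup>2 \<partial>\<mu>) \<le> 8 * (hs N Q)\<^sup>2 * (\<integral>a. K a ^ 4 \<partial>\<mu>) / real N"
proof -
  let ?C = "\<lambda>a. ctr N (mmult N (B a) (B' a))"
  have C: "cov ?C" by (intro cov_ctr cov_mmult B)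
  have b: "(hs N (?C a))\<^sup>2 \<le> 4 * K a ^ 4 * real N" for a
    using op_bound_hs[OF op_bound_ctr[OF op_bound_mmult[OF K(2)[of a] K(3)[of a]]]]
    by (simp add: power_mult_distrib power4_eq_xxxx power2_eq_square mult_ac)
  have "(\<integral>a. (hs N (?C a))\<^sup>2 \<partial>\<mu>) \<le> (\<integral>a. 4 * K a ^ 4 * real N \<partial>\<mu>)"
    by (intro integral_mono rpbd_integrable rpbd_hs_sq covD(2)[OF C] rpbd_intros K(1) b)
  then have "2 * (hs N Q)\<^sup>2 * (\<integral>a. 1 * (hs N (?C a))\<^sup>2 \<partial>\<mu>) / (real N)\<^sup>2 \<le> 2 * (hs N Q)\<^sup>2 * (4 * (\<integral>a. K a ^ 4 \<partial>\<mu>) * real N) / (real N)\<^sup>2"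
    by (intro divide_right_mono mult_left_mono) auto
  also have "\<dots> = 8 * (hs N Q)\<^sup>2 * (\<integral>a. K a ^ 4 \<partial>\<mu>) / real N"
    using N by (simp add: field_simps power2_eq_square)
  finally show ?thesis using variance_bound[OF C, of "\<lambda>_. 1" Q] by (simp add: rpbd_const)
qed

text \<open>The loop equation for \<open>G\<close> with the weight \<open>cnj Z\<close>. Of the four
  products of traces given by the splitting rule, two vanish by \<open>t0\<close>; the others are
  \<open>N Z\<close> and \<open>Tr (Q B) Tr (Q' B')\<close>. The four traces on the right come from
  differentiating \<open>cnj Z\<close>.\<close>

lemma crossing_identity:
  fixes Q Q' :: cmat
  assumes B: "cov B" "cov B'" and t0: "mtr N Q = 0" "\<And>a. mtr N (B' a) = 0"
  defines "Z \<equiv> \<lambda>a. mtr N (mmult N Q (mmult N (B a) (mmult N Q' (B' a))))"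
    and "G \<equiv> \<lambda>a. mmult N Q (mmult N (B a) (mmult N Q' (B' a)))"
  shows "(\<integral>a. of_nat N * of_real ((cmod (Z a))\<^sup>2)
       + mtr N (mmult N Q (B a)) * mtr N (mmult N Q' (B' a)) * cnj (Z a) \<partial>\<mu>)
    = (\<integral>a. mtr N (mmult N (G a) (mmult N (madj (B' a)) (mmult N (madj Q') (mmult N (madj (B a)) (madj Q)))))
       - mtr N (mmult N (G a) (mmult N (madj Q') (mmult N (madj (B a)) (mmult N (madj Q) (madj (B' a))))))
       + mtr N (mmult N (G a) (mmult N (madj (B a)) (mmult N (madj Q) (mmult N (madj (B' a)) (madj Q')))))
       - mtr N (mmult N (G a) (mmult N (madj Q) (mmult N (madj (B' a)) (mmult N (madj Q') (madj (B a)))))) \<partial>\<mu>)"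
    (is "_ = (\<integral>a. ?H a \<partial>\<mu>)")
proof -
  let ?P = "\<lambda>a. mtr N (mmult N (madj (B' a)) (mmult N (madj Q') (mmult N (madj (B a)) (madj Q))))"
  have P: "?P a = cnj (Z a)" for a unfolding Z_def by (simp add: mmult_assoc flip: mtr_madj)
  let ?D = "\<lambda>X a. mtr N (mmult N (mmult N X (madj (B' a)) - mmult N (madj (B' a)) X) (mmult N (madj Q') (mmult N (madj (B a)) (madj Q)))
     + mmult N (madj (B' a)) (mmult N (madj Q') (mmult N (mmult N X (madj (B a)) - mmult N (madj (B a)) X) (madj Q))))"
  have dP: "der ?P ?D"
    using der_mtr[OF derm_mmult[OF derm_cov[OF cov_madj[OF B(2)]] derm_mmult[OF derm_const[of "madj Q'"]
      derm_mmult[OF derm_cov[OF cov_madj[OF B(1)]] derm_const[of "madj Q"]]]]] by simp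
  let ?DG = "\<lambda>X a. mmult N Q (mmult N (mmult N X (B a) - mmult N (B a) X) (mmult N Q' (B' a))
     + mmult N (B a) (mmult N Q' (mmult N X (B' a) - mmult N (B' a) X)))"
  have dG: "derm G ?DG"
    using derm_mmult[OF derm_const[of Q] derm_mmult[OF derm_cov[OF B(1)] derm_mmult[OF derm_const[of Q'] derm_cov[OF B(2)]]]]
    by (simp add: G_def)
  have 1: "(\<Sum>a<N. \<Sum>b<N. ?DG (unitm a b) x a b)
     = - (mtr N (mmult N Q (B x)) * mtr N (mmult N Q' (B' x))) - of_nat N * Z x" for x
    using sum_unitm_mid[of N Q "mmult N (B x) (mmult N Q' (B' x))"]
      sum_unitm_mid[of N "mmult N Q (B x)" "mmult N Q' (B' x)"]
      sum_unitm_mid[of N "mmult N Q (mmult N (B x) Q')" "B' x"]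
      sum_unitm_end[of N "mmult N Q (mmult N (B x) (mmult N Q' (B' x)))"]
    by (simp add: sum_subtractf sum.distrib mmult_assoc t0 Z_def)
  have 2: "(\<Sum>a<N. \<Sum>b<N. G x a b * ?D (unitm a b) x) = ?H x" for x
  proof -
    have e: "?D (unitm a b) x = mtr N (mmult N (unitm a b)
        (mmult N (madj (B' x)) (mmult N (madj Q') (mmult N (madj (B x)) (madj Q)))
         - mmult N (madj Q') (mmult N (madj (B x)) (mmult N (madj Q) (madj (B' x))))
         + mmult N (madj (B x)) (mmult N (madj Q) (mmult N (madj (B' x)) (madj Q')))
         - mmult N (madj Q) (mmult N (madj (B' x)) (mmult N (madj Q') (madj (B x))))))" for a b
      using mtr_cyclic[of N "madj (B' x)" "mmult N (unitm a b) (mmult N (madj Q') (mmult N (madj (B x)) (madj Q)))"]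
        mtr_cyclic[of N "mmult N (madj (B' x)) (madj Q')" "mmult N (unitm a b) (mmult N (madj (B x)) (madj Q))"]
        mtr_cyclic[of N "mmult N (madj (B' x)) (mmult N (madj Q') (madj (B x)))" "mmult N (unitm a b) (madj Q)"]
      by (simp add: mmult_assoc)
    show ?thesis unfolding e sum_unitm_mtr by simp
  qed
  define f where "f x = of_nat N * complex_of_real ((cmod (Z x))\<^sup>2) + mtr N (mmult N Q (B x)) * mtr N (mmult N Q' (B' x)) * cnj (Z x)" for x
  have pB: "pbd (\<lambda>a. B a i j)" "pbd (\<lambda>a. B' a i j)" "pbd (\<lambda>a. madj (B a) i j)" "pbd (\<lambda>a. madj (B' a) i j)" for i j
    using covD(2)[OF B(1)] covD(2)[OF B(2)] covD(2)[OF cov_madj[OF B(1)]] covD(2)[OF cov_madj[OF B(2)]] by auto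
  have f: "pbd f" unfolding f_def complex_norm_square Z_def
    by (intro pbd_add pbd_mult pbd_cnj pbd_const pbd_mtr pbd_mmult pB)
  have h: "pbd ?H" unfolding G_def
    by (intro pbd_add pbd_diff pbd_const pbd_mtr pbd_mmult pB)
  have "(\<integral>x. ?H x - f x \<partial>\<mu>) = 0"
  proof -
    have "(- (mtr N (mmult N Q (B x)) * mtr N (mmult N Q' (B' x))) - of_nat N * Z x) * ?P x + ?H x = ?H x - f x" for x
      unfolding P f_def complex_norm_square by (simp add: algebra_simps)
    then show ?thesis using loop_equation[OF dG dP] unfolding 1 2 by simp
  qed
  then have "(\<integral>x. f x \<partial>\<mu>) = (\<integral>x. ?H x \<partial>\<mu>)"
    using f h by (subst (asm) Bochner_Integration.integral_diff) (auto intro: pbd_integrable)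
  then show ?thesis unfolding f_def .
qed

text \<open>The term \<open>Tr (Q B) Tr (Q' B') cnj Z\<close> of the crossing identity is absorbed into \<open>N |Z|^2\<close> by Young's inequality.\<close>
lemma crossing_bound:
  assumes B: "cov B" "cov B'" and t0: "mtr N Q = 0" "\<And>a. mtr N (B a) = 0" "\<And>a. mtr N (B' a) = 0"
    and K: "rpbd K" "\<And>a. op_bound N (B a) (K a)" "\<And>a. op_bound N (B' a) (K a)"
  shows "(\<integral>a. (cmod (mtr N (mmult N Q (mmult N (B a) (mmult N Q' (B' a))))))\<^sup>2 \<partial>\<mu>)
    \<le> 10 * (hs N Q)\<^sup>2 * (hs N Q')\<^sup>2 * (\<integral>a. K a ^ 4 \<partial>\<mu>) / real N"
proof -
  define Z where "Z a = mtr N (mmult N Q (mmult N (B a) (mmult N Q' (B' a))))" for a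
  define G where "G a = mmult N Q (mmult N (B a) (mmult N Q' (B' a)))" for a
  define H where "H a = mtr N (mmult N (G a) (mmult N (madj (B' a)) (mmult N (madj Q') (mmult N (madj (B a)) (madj Q)))))
       - mtr N (mmult N (G a) (mmult N (madj Q') (mmult N (madj (B a)) (mmult N (madj Q) (madj (B' a))))))
       + mtr N (mmult N (G a) (mmult N (madj (B a)) (mmult N (madj Q) (mmult N (madj (B' a)) (madj Q')))))
       - mtr N (mmult N (G a) (mmult N (madj Q) (mmult N (madj (B' a)) (mmult N (madj Q') (madj (B a))))))" for a
  define W where "W a = mtr N (mmult N Q (B a)) * mtr N (mmult N Q' (B' a))" for a
  define q where "q = (hs N Q)\<^sup>2 * (hs N Q')\<^sup>2"
  have Npos: "real N \<ge> 1" using N by simp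
  have pB: "pbd (\<lambda>a. B a i j)" "pbd (\<lambda>a. B' a i j)" "pbd (\<lambda>a. madj (B a) i j)" "pbd (\<lambda>a. madj (B' a) i j)" for i j
    using covD(2)[OF B(1)] covD(2)[OF B(2)] covD(2)[OF cov_madj[OF B(1)]] covD(2)[OF cov_madj[OF B(2)]] by auto
  have pS: "pbd Z" and pH: "pbd H" and pW: "pbd W"
    unfolding Z_def H_def G_def W_def by (intro pbd_add pbd_diff pbd_mult pbd_const pbd_mtr pbd_mmult pB)+
  have K0: "0 \<le> K a" for a by (rule op_boundD(2)[OF K(2)])
  have K': "op_bound N (madj (B a)) (K a)" "op_bound N (madj (B' a)) (K a)" for a
    by (intro op_bound_madj K)+
  \<comment> \<open>Operator norms are spent on \<open>B\<close> and \<open>B'\<close>,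
    Hilbert--Schmidt norms on \<open>Q\<close> and \<open>Q'\<close>.\<close>
  have Gb: "hs N (G a) \<le> K a * K a * (hs N Q * hs N Q')" for a
  proof -
    have "hs N (G a) \<le> K a * hs N (mmult N Q (mmult N (B a) Q'))"
      using op_bound_right[OF K(3)[of a], of "mmult N Q (mmult N (B a) Q')"] by (simp add: G_def mmult_assoc)
    also have "\<dots> \<le> K a * (hs N Q * (K a * hs N Q'))"
      by (intro mult_left_mono K0 order_trans[OF hs_mmult_le] op_boundD(1) K hs_nonneg)
    finally show ?thesis by (simp add: mult_ac)
  qed
  have Lb: "hs N (mmult N X (mmult N P (mmult N Y P'))) \<le> K a * K a * (hs N P * hs N P')"
    "hs N (mmult N P (mmult N Y (mmult N P' X))) \<le> K a * K a * (hs N P * hs N P')"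
    if X: "op_bound N X (K a)" and Y: "op_bound N Y (K a)" for X Y P P' a
  proof -
    have "hs N (mmult N X (mmult N P (mmult N Y P'))) \<le> K a * (hs N P * (K a * hs N P'))"
      by (intro order_trans[OF op_boundD(1)[OF X]] mult_left_mono K0 order_trans[OF hs_mmult_le] op_boundD(1) Y hs_nonneg)
    then show "hs N (mmult N X (mmult N P (mmult N Y P'))) \<le> K a * K a * (hs N P * hs N P')"
      by (simp add: mult_ac)
    have "hs N (mmult N P (mmult N Y (mmult N P' X))) \<le> K a * hs N (mmult N P (mmult N Y P'))"
      using op_bound_right[OF X, of "mmult N P (mmult N Y P')"] by (simp add: mmult_assoc)
    also have "\<dots> \<le> K a * (hs N P * (K a * hs N P'))"
      by (intro mult_left_mono K0 order_trans[OF hs_mmult_le] op_boundD(1) Y hs_nonneg)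
    finally show "hs N (mmult N P (mmult N Y (mmult N P' X))) \<le> K a * K a * (hs N P * hs N P')"
      by (simp add: mult_ac)
  qed
  have tr: "cmod (mtr N (mmult N (G a) L)) \<le> q * K a ^ 4" if "hs N L \<le> K a * K a * (hs N Q * hs N Q')" for L a
  proof -
    have "cmod (mtr N (mmult N (G a) L)) \<le> (K a * K a * (hs N Q * hs N Q')) * (K a * K a * (hs N Q * hs N Q'))"
      by (rule order_trans[OF norm_mtr_mmult_le]) (intro mult_mono Gb that hs_nonneg mult_nonneg_nonneg K0)
    then show ?thesis by (simp add: q_def power4_eq_xxxx power2_eq_square mult_ac)
  qed
  have Hb: "cmod (H a) \<le> 4 * q * K a ^ 4" for a
  proof -
    have *: "cmod (w - x + y - z) \<le> 4 * c"
      if "cmod w \<le> c" "cmod x \<le> c" "cmod y \<le> c" "cmod z \<le> c" for w x y z c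
      using that norm_triangle_ineq4[of "w - x + y" z] norm_triangle_ineq[of "w - x" y] norm_triangle_ineq4[of w x] by linarith
    have "cmod (H a) \<le> 4 * (q * K a ^ 4)"
      unfolding H_def
      by (intro * tr)
         (use Lb[OF K'(2,1)[of a], of "madj Q'" "madj Q"] Lb[OF K'(1,2)[of a], of "madj Q" "madj Q'"] in \<open>simp_all add: mult.commute[of "hs N Q"]\<close>)
    then show ?thesis by simp
  qed
  \<comment> \<open>The trace with \<open>B'\<close> is bounded pathwise by Cauchy--Schwarz, which
    leaves the invariant weight \<open>?w\<close>; under this weight the variance bound applies to
    the trace with \<open>B\<close>.\<close>
  have Wb: "(\<integral>a. (cmod (W a))\<^sup>2 \<partial>\<mu>) \<le> 2 * q * (\<integral>a. K a ^ 4 \<partial>\<mu>)"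
  proof -
    let ?w = "\<lambda>a. (hs N (B' a))\<^sup>2"
    have w: "rpbd ?w" "\<And>U a. unitary N U \<Longrightarrow> ?w (cj N U a) = ?w a"
      using covD[OF B(2)] by (auto intro!: rpbd_hs_sq simp: hs_conj)
    have "(\<integral>a. (cmod (W a))\<^sup>2 \<partial>\<mu>) \<le> (\<integral>a. (hs N Q')\<^sup>2 * (?w a * (cmod (mtr N (mmult N Q (B a))))\<^sup>2) \<partial>\<mu>)"
    proof (rule integral_mono)
      show "integrable \<mu> (\<lambda>a. (cmod (W a))\<^sup>2)"
        by (intro rpbd_integrable rpbd_power rpbd_norm pW)
      show "integrable \<mu> (\<lambda>a. (hs N Q')\<^sup>2 * (?w a * (cmod (mtr N (mmult N Q (B a))))\<^sup>2))"
        by (intro rpbd_integrable rpbd_intros w pbd_mtr pbd_mmult pbd_const pB)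
      fix a
      have "(cmod (mtr N (mmult N Q' (B' a))))\<^sup>2 \<le> (hs N Q' * hs N (B' a))\<^sup>2"
        by (intro power_mono norm_mtr_mmult_le) simp
      from mult_left_mono[OF this, of "(cmod (mtr N (mmult N Q (B a))))\<^sup>2"]
      show "(cmod (W a))\<^sup>2 \<le> (hs N Q')\<^sup>2 * (?w a * (cmod (mtr N (mmult N Q (B a))))\<^sup>2)"
        by (simp add: W_def norm_mult power_mult_distrib mult_ac)
    qed
    also have "\<dots> = (hs N Q')\<^sup>2 * (\<integral>a. ?w a * (cmod (mtr N (mmult N Q (B a))))\<^sup>2 \<partial>\<mu>)" by simp
    also have "\<dots> \<le> (hs N Q')\<^sup>2 * (2 * (hs N Q)\<^sup>2 * (\<integral>a. ?w a * (hs N (B a))\<^sup>2 \<partial>\<mu>) / (real N)\<^sup>2)"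
      by (intro mult_left_mono variance_bound B t0 w) auto
    also have "\<dots> \<le> (hs N Q')\<^sup>2 * (2 * (hs N Q)\<^sup>2 * (\<integral>a. (real N)\<^sup>2 * K a ^ 4 \<partial>\<mu>) / (real N)\<^sup>2)"
    proof (intro mult_left_mono divide_right_mono integral_mono)
      show "integrable \<mu> (\<lambda>a. ?w a * (hs N (B a))\<^sup>2)" "integrable \<mu> (\<lambda>a. (real N)\<^sup>2 * K a ^ 4)"
        by (intro rpbd_integrable rpbd_intros w rpbd_hs_sq pB K)+
      show "?w a * (hs N (B a))\<^sup>2 \<le> (real N)\<^sup>2 * K a ^ 4" for a
        using mult_mono[OF op_bound_hs[OF K(3)[of a]] op_bound_hs[OF K(2)[of a]]] K0[of a]
        by (simp add: power4_eq_xxxx power2_eq_square mult_ac)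
    qed auto
    also have "\<dots> = 2 * q * (\<integral>a. K a ^ 4 \<partial>\<mu>)" using Npos by (simp add: q_def)
    finally show ?thesis .
  qed
  have iS: "integrable \<mu> (\<lambda>a. (cmod (Z a))\<^sup>2)" and iW: "integrable \<mu> (\<lambda>a. (cmod (W a))\<^sup>2)" and iK: "integrable \<mu> (\<lambda>a. K a ^ 4)"
    by (intro rpbd_integrable rpbd_intros pS pW K)+
  define f where "f a = of_nat N * complex_of_real ((cmod (Z a))\<^sup>2) + W a * cnj (Z a)" for a
  have pf: "pbd f" unfolding f_def complex_norm_square
    by (intro pbd_add pbd_mult pbd_cnj pbd_const pS pW)
  have f: "(\<integral>a. f a \<partial>\<mu>) = (\<integral>a. H a \<partial>\<mu>)"
    using crossing_identity[OF B t0(1,3), of Q'] unfolding f_def W_def Z_def H_def G_def .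
  have "(\<integral>a. (real N / 2) * (cmod (Z a))\<^sup>2 - (cmod (W a))\<^sup>2 / (2 * real N) \<partial>\<mu>) \<le> (\<integral>a. Re (f a) \<partial>\<mu>)"
  proof (rule integral_mono)
    fix a
    have "cmod (W a) * cmod (Z a) \<le> (real N / 2) * (cmod (Z a))\<^sup>2 + (cmod (W a))\<^sup>2 / (2 * real N)"
    proof -
      have "0 \<le> (real N * cmod (Z a) - cmod (W a))\<^sup>2" by simp
      then have "2 * real N * (cmod (W a) * cmod (Z a)) \<le> (real N)\<^sup>2 * (cmod (Z a))\<^sup>2 + (cmod (W a))\<^sup>2"
        by (simp add: power2_diff power_mult_distrib mult_ac)
      then show ?thesis using Npos by (simp add: field_simps power2_eq_square)
    qed
    moreover have "- (cmod (W a) * cmod (Z a)) \<le> Re (W a * cnj (Z a))"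
      using abs_Re_le_cmod[of "W a * cnj (Z a)"] by (simp add: norm_mult)
    ultimately show "(real N / 2) * (cmod (Z a))\<^sup>2 - (cmod (W a))\<^sup>2 / (2 * real N) \<le> Re (f a)"
      by (simp add: f_def)
  qed (use iS iW pf in \<open>auto intro!: rpbd_integrable rpbd_Re\<close>)
  also have "\<dots> = Re (\<integral>a. H a \<partial>\<mu>)" using pbd_integrable[OF pf] by (simp add: f)
  also have "\<dots> \<le> cmod (\<integral>a. H a \<partial>\<mu>)" by (rule complex_Re_le_cmod)
  also have "\<dots> \<le> (\<integral>a. cmod (H a) \<partial>\<mu>)" by (rule integral_norm_bound)
  also have "\<dots> \<le> (\<integral>a. 4 * q * K a ^ 4 \<partial>\<mu>)"
    by (intro integral_mono rpbd_integrable rpbd_intros pH K Hb)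
  finally have "(real N / 2) * (\<integral>a. (cmod (Z a))\<^sup>2 \<partial>\<mu>) - (\<integral>a. (cmod (W a))\<^sup>2 \<partial>\<mu>) / (2 * real N) \<le> 4 * q * (\<integral>a. K a ^ 4 \<partial>\<mu>)"
    using iS iW by simp
  moreover have "(\<integral>a. (cmod (W a))\<^sup>2 \<partial>\<mu>) / (2 * real N) \<le> 2 * q * (\<integral>a. K a ^ 4 \<partial>\<mu>) / 2"
  proof -
    have "(\<integral>a. (cmod (W a))\<^sup>2 \<partial>\<mu>) / (2 * real N) \<le> (\<integral>a. (cmod (W a))\<^sup>2 \<partial>\<mu>) / 2"
      using Npos by (intro divide_left_mono) auto
    then show ?thesis using Wb by linarith
  qed
  \<comment> \<open>4 from the four merged traces plus half of the 2 in \<open>Wb\<close>; dividing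
    by \<open>N / 2\<close> gives the constant 10.\<close>
  ultimately have "(real N / 2) * (\<integral>a. (cmod (Z a))\<^sup>2 \<partial>\<mu>) \<le> 5 * q * (\<integral>a. K a ^ 4 \<partial>\<mu>)"
    by linarith
  then show ?thesis using Npos by (simp add: Z_def q_def field_simps)
qed

text \<open>Stein's lemma in matrix form: the weight contains the exponential itself, and merging
  its derivative with \<open>Q i\<close> times \<open>B i\<close> produces the traces that play the
  role of a variance.\<close>

lemma stein_identity:
  fixes B :: "'j \<Rightarrow> ('k \<Rightarrow> cmat) \<Rightarrow> cmat" and s :: real
  assumes "finite J" and i: "i \<in> J" and B: "\<And>j. j \<in> J \<Longrightarrow> cov (B j)"
    and t0: "\<And>j a. j \<in> J \<Longrightarrow> mtr N (B j a) = 0"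
    and re: "\<And>a. Im (\<Sum>j\<in>J. mtr N (mmult N (Q j) (B j a))) = 0"
    and h: "pbd h" "\<And>U a. unitary N U \<Longrightarrow> h (cj N U a) = h a"
  defines "E \<equiv> \<lambda>a. h a * exp (\<i> * of_real s * (\<Sum>j\<in>J. mtr N (mmult N (Q j) (B j a))))"
  shows "of_nat N * (\<integral>a. mtr N (mmult N (Q i) (B i a)) * E a \<partial>\<mu>) =
    \<i> * of_real s * (\<Sum>j\<in>J. \<integral>a. (mtr N (mmult N (mmult N (Q j) (Q i)) (mmult N (B i a) (B j a)))
        - mtr N (mmult N (Q i) (mmult N (B i a) (mmult N (Q j) (B j a))))) * E a \<partial>\<mu>)"
proof -
  let ?Y = "\<lambda>a. \<Sum>j\<in>J. mtr N (mmult N (Q j) (B j a))"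
  let ?DY = "\<lambda>X a. \<Sum>j\<in>J. mtr N (mmult N (Q j) (mmult N X (B j a) - mmult N (B j a) X))"
  let ?e = "\<lambda>a. exp (\<i> * of_real s * ?Y a)"
  let ?L = "\<lambda>j a. mtr N (mmult N (mmult N (Q j) (Q i)) (mmult N (B i a) (B j a)))
        - mtr N (mmult N (Q i) (mmult N (B i a) (mmult N (Q j) (B j a))))"
  have dY: "der ?Y ?DY" by (intro der_sum derm_mtr_left derm_cov B)
  have dE: "der E (\<lambda>X a. h a * (\<i> * of_real s * ?DY X a * ?e a))"
    using der_mult[OF der_invariant[OF h] der_iexp[OF dY re]] by (simp add: E_def)
  have pE: "pbd E" using dE by (simp add: der_def)
  have 1: "(\<Sum>a<N. \<Sum>b<N. mmult N (Q i) (mmult N (unitm a b) (B i x) - mmult N (B i x) (unitm a b)) a b)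
      = - of_nat N * mtr N (mmult N (Q i) (B i x))" for x
    using sum_unitm_mid[of N "Q i" "B i x"] sum_unitm_end[of N "mmult N (Q i) (B i x)"]
    by (simp add: sum_subtractf mmult_assoc t0[OF i])
  have 2: "(\<Sum>a<N. \<Sum>b<N. mmult N (Q i) (B i x) a b * (h x * (\<i> * of_real s * ?DY (unitm a b) x * ?e x)))
      = \<i> * of_real s * (\<Sum>j\<in>J. ?L j x * E x)" for x
  proof -
    let ?M = "\<Sum>j\<in>J. mmult N (B j x) (Q j) - mmult N (Q j) (B j x)"
    have e: "mtr N (mmult N (Q j) (mmult N (unitm a b) (B j x) - mmult N (B j x) (unitm a b)))
       = mtr N (mmult N (unitm a b) (mmult N (B j x) (Q j) - mmult N (Q j) (B j x)))" for a b j
      using mtr_cyclic[of N "Q j" "mmult N (unitm a b) (B j x)"] mtr_cyclic[of N "mmult N (Q j) (B j x)" "unitm a b"]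
      by (simp add: mmult_assoc)
    have "(\<Sum>a<N. \<Sum>b<N. mmult N (Q i) (B i x) a b * (h x * (\<i> * of_real s * ?DY (unitm a b) x * ?e x)))
      = \<i> * of_real s * (\<Sum>j\<in>J. (\<Sum>a<N. \<Sum>b<N. mmult N (Q i) (B i x) a b * mtr N (mmult N (unitm a b) (mmult N (B j x) (Q j) - mmult N (Q j) (B j x)))) * E x)"
    proof -
      have "(\<Sum>j\<in>J. (\<Sum>a<N. \<Sum>b<N. mmult N (Q i) (B i x) a b * mtr N (mmult N (unitm a b) (mmult N (B j x) (Q j) - mmult N (Q j) (B j x)))) * E x)
        = (\<Sum>a<N. \<Sum>b<N. \<Sum>j\<in>J. mmult N (Q i) (B i x) a b * mtr N (mmult N (unitm a b) (mmult N (B j x) (Q j) - mmult N (Q j) (B j x))) * E x)"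
        unfolding sum_distrib_right
        by (subst sum.swap, rule sum.cong[OF refl], rule sum.swap)
      then show ?thesis
        unfolding e by (simp only: sum_distrib_left sum_distrib_right E_def mult_ac)
    qed
    also have "\<dots> = \<i> * of_real s * (\<Sum>j\<in>J. ?L j x * E x)"
    proof -
      have "mtr N (mmult N (mmult N (Q i) (B i x)) (mmult N (B j x) (Q j) - mmult N (Q j) (B j x))) = ?L j x" for j
        using mtr_cyclic[of N "mmult N (Q i) (mmult N (B i x) (B j x))" "Q j"] by (simp add: mmult_assoc)
      then show ?thesis unfolding sum_unitm_mtr by simp
    qed
    finally show ?thesis .
  qed
  have pB: "pbd (\<lambda>a. B j a i' j')" if "j \<in> J" for j i' j' using covD(2)[OF B[OF that]] .
  have pL: "pbd (\<lambda>a. ?L j a * E a)" if "j \<in> J" for j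
    by (intro pbd_mult pbd_diff pE pbd_mtr pbd_mmult pbd_const pB that i)
  have pT: "pbd (\<lambda>a. mtr N (mmult N (Q i) (B i a)) * E a)"
    by (intro pbd_mult pE pbd_mtr pbd_mmult pbd_const pB i)
  have "(\<integral>x. - (of_nat N * (mtr N (mmult N (Q i) (B i x)) * E x)) + \<i> * of_real s * (\<Sum>j\<in>J. ?L j x * E x) \<partial>\<mu>) = 0"
    using loop_equation[OF derm_mmult[OF derm_const[of "Q i"] derm_cov[OF B[OF i]]] dE] 1 2
    by (simp add: mult.assoc)
  moreover have "(\<integral>x. (\<Sum>j\<in>J. ?L j x * E x) \<partial>\<mu>) = (\<Sum>j\<in>J. \<integral>x. ?L j x * E x \<partial>\<mu>)"
    by (rule Bochner_Integration.integral_sum) (intro pbd_integrable pL)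
  moreover have "integrable \<mu> (\<lambda>x. \<Sum>j\<in>J. ?L j x * E x)" by (intro pbd_integrable pbd_sum pL)
  ultimately show ?thesis using pbd_integrable[OF pT] by simp
qed

end

section \<open>Convergence of characteristic functions\<close>

text \<open>Characteristic functions are differentiated under the integral by a Taylor estimate with
  quadratic remainder, which second moments control.\<close>

lemma has_vector_derivative_quadratic:
  fixes f :: "real \<Rightarrow> complex"
  assumes "\<And>t. cmod (f (s + t) - f s - of_real t * D) \<le> C * t\<^sup>2"
  shows "(f has_vector_derivative D) (at s)"
  unfolding has_vector_derivative_def has_derivative_at2
proof (intro conjI bounded_linear_scaleR_left)
  have "\<forall>\<^sub>F y in at s. norm ((1 / norm (y - s)) *\<^sub>R (f y - (f s + (y - s) *\<^sub>R D))) \<le> C * \<bar>y - s\<bar>"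
    unfolding eventually_at_filter
  proof (intro always_eventually allI impI)
    fix y assume "y \<noteq> s"
    then have "cmod (f y - (f s + (y - s) *\<^sub>R D)) \<le> C * \<bar>y - s\<bar> * \<bar>y - s\<bar>"
      using assms[of "y - s"] by (simp add: scaleR_conv_of_real algebra_simps power2_eq_square abs_mult_self)
    with \<open>y \<noteq> s\<close> show "norm ((1 / norm (y - s)) *\<^sub>R (f y - (f s + (y - s) *\<^sub>R D))) \<le> C * \<bar>y - s\<bar>"
      by (simp add: divide_le_eq)
  qed
  moreover have "((\<lambda>y. C * \<bar>y - s\<bar>) \<longlongrightarrow> 0) (at s)"
    by (auto intro!: tendsto_eq_intros)
  ultimately show "((\<lambda>y. (1 / norm (y - s)) *\<^sub>R (f y - (f s + (y - s) *\<^sub>R D))) \<longlongrightarrow> 0) (at s)"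
    by (rule Lim_null_comparison)
qed

context ens
begin

text \<open>Nonnegativity of the variance of \<open>\<bar>f\<bar>\<close>.\<close>

lemma integral_norm_le_sqrt:
  assumes "rpbd f" shows "(\<integral>a. \<bar>f a\<bar> \<partial>\<mu>) \<le> sqrt (\<integral>a. (f a)\<^sup>2 \<partial>\<mu>)"
proof -
  define m where "m = (\<integral>a. \<bar>f a\<bar> \<partial>\<mu>)"
  have i1: "integrable \<mu> (\<lambda>a. \<bar>f a\<bar>)" using rpbd_integrable[OF assms] by simp
  have i2: "integrable \<mu> (\<lambda>a. (f a)\<^sup>2)" by (intro rpbd_integrable rpbd_power assms)
  have "0 \<le> (\<integral>a. (\<bar>f a\<bar> - m)\<^sup>2 \<partial>\<mu>)" by simp
  also have "(\<lambda>a. (\<bar>f a\<bar> - m)\<^sup>2) = (\<lambda>a. (f a)\<^sup>2 - 2 * m * \<bar>f a\<bar> + m\<^sup>2)"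
    by (simp add: fun_eq_iff power2_diff)
  also have "(\<integral>a. (f a)\<^sup>2 - 2 * m * \<bar>f a\<bar> + m\<^sup>2 \<partial>\<mu>) = (\<integral>a. (f a)\<^sup>2 \<partial>\<mu>) - m\<^sup>2"
    using i1 i2 prob_space by (simp add: m_def[symmetric] power2_eq_square)
  finally show ?thesis unfolding m_def[symmetric] by (intro real_le_rsqrt) simp
qed

text \<open>\<phi> solves \<phi>' = - s V \<phi> up to an error of at most
  \<open>\<bar>s\<bar> * (H * R)\<close>, and an integrating factor compares it with the exact
  solution on [0, 1]. \<open>V\<close> is complex here, as \<open>v\<close> is arbitrary, hence its
  norm in the exponent.\<close>

lemma charfun_bound:
  fixes B :: "'j \<Rightarrow> ('k \<Rightarrow> cmat) \<Rightarrow> cmat" and v :: "'j \<Rightarrow> 'j \<Rightarrow> complex"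
  assumes J: "finite J" and B: "\<And>j. j \<in> J \<Longrightarrow> cov (B j)"
    and t0: "\<And>j a. j \<in> J \<Longrightarrow> mtr N (B j a) = 0"
    and re: "\<And>a. Im (\<Sum>j\<in>J. mtr N (mmult N (Q j) (B j a))) = 0"
    and h: "h \<in> borel_measurable fam_space" "\<And>a. cmod (h a) \<le> H" "\<And>U a. unitary N U \<Longrightarrow> h (cj N U a) = h a"
  defines "L \<equiv> \<lambda>i j a. mtr N (mmult N (mmult N (Q j) (Q i)) (mmult N (B i a) (B j a)))
        - mtr N (mmult N (Q i) (mmult N (B i a) (mmult N (Q j) (B j a))))"
    and "V \<equiv> \<Sum>i\<in>J. \<Sum>j\<in>J. v i j"
  shows "cmod ((\<integral>a. h a * exp (\<i> * (\<Sum>j\<in>J. mtr N (mmult N (Q j) (B j a)))) \<partial>\<mu>) - exp (- V / 2) * (\<integral>a. h a \<partial>\<mu>))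
     \<le> exp (cmod V) * H * (\<Sum>i\<in>J. \<Sum>j\<in>J. \<integral>a. cmod (L i j a / of_nat N - v i j) \<partial>\<mu>)"
proof -
  define Y where "Y a = Re (\<Sum>j\<in>J. mtr N (mmult N (Q j) (B j a)))" for a
  have Y: "(\<Sum>j\<in>J. mtr N (mmult N (Q j) (B j a))) = of_real (Y a)" for a
    using re[of a] by (simp add: Y_def complex_eq_iff)
  define E where "E s a = h a * exp (\<i> * of_real s * of_real (Y a))" for s a
  define \<phi> where "\<phi> s = (\<integral>a. E s a \<partial>\<mu>)" for s
  define R where "R = (\<Sum>i\<in>J. \<Sum>j\<in>J. \<integral>a. cmod (L i j a / of_nat N - v i j) \<partial>\<mu>)"
  have H: "0 \<le> H" using h(2) norm_ge_zero order_trans by blast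
  have pB: "pbd (\<lambda>a. B j a i' j')" if "j \<in> J" for j i' j' using covD(2)[OF B[OF that]] .
  have pY: "pbd (\<lambda>a. complex_of_real (Y a))"
    unfolding Y[symmetric] by (intro pbd_sum pbd_mtr pbd_mmult pbd_const pB)
  have [measurable]: "Y \<in> borel_measurable fam_space"
    using measurable_compose[OF pbd_meas[OF pY] borel_measurable_Re] by simp
  note [measurable] = h(1)
  have pL: "pbd (L i j)" if "i \<in> J" "j \<in> J" for i j
    unfolding L_def by (intro pbd_diff pbd_mtr pbd_mmult pbd_const pB that)
  have nE: "cmod (E s a) \<le> H" for s a
    using h(2)[of a] by (simp add: E_def norm_mult flip: of_real_mult)
  have pE: "pbd (E s)" for s
    by (rule pbd_bounded[OF _ nE]) (simp add: E_def)
  have ph: "pbd h" by (rule pbd_bounded[OF h(1,2)])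
  have stein: "cmod ((\<integral>a. of_real (Y a) * E s a \<partial>\<mu>) - \<i> * of_real s * V * \<phi> s) \<le> \<bar>s\<bar> * (H * R)" for s
  proof -
    have pT: "pbd (\<lambda>a. mtr N (mmult N (Q i) (B i a)) * E s a)" if "i \<in> J" for i
      by (intro pbd_mult pE pbd_mtr pbd_mmult pbd_const pB that)
    have T: "(\<integral>a. mtr N (mmult N (Q i) (B i a)) * E s a \<partial>\<mu>)
       = \<i> * of_real s * (\<Sum>j\<in>J. \<integral>a. L i j a / of_nat N * E s a \<partial>\<mu>)" if i: "i \<in> J" for i
    proof -
      have "of_nat N * (\<integral>a. mtr N (mmult N (Q i) (B i a)) * E s a \<partial>\<mu>)
         = \<i> * of_real s * (\<Sum>j\<in>J. \<integral>a. L i j a * E s a \<partial>\<mu>)"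
        using stein_identity[OF J i B t0 re ph h(3), of s] unfolding E_def L_def Y by simp
      then have "(\<integral>a. mtr N (mmult N (Q i) (B i a)) * E s a \<partial>\<mu>)
         = \<i> * of_real s * (\<Sum>j\<in>J. (\<integral>a. L i j a * E s a \<partial>\<mu>) / of_nat N)"
        using N by (simp add: field_simps sum_divide_distrib[symmetric])
      then show ?thesis by simp
    qed
    have "(\<integral>a. of_real (Y a) * E s a \<partial>\<mu>) = (\<Sum>i\<in>J. \<integral>a. mtr N (mmult N (Q i) (B i a)) * E s a \<partial>\<mu>)"
      unfolding Y[symmetric] sum_distrib_right
      by (rule Bochner_Integration.integral_sum) (intro pbd_integrable pT)
    also have "\<dots> = \<i> * of_real s * (\<Sum>i\<in>J. \<Sum>j\<in>J. \<integral>a. L i j a / of_nat N * E s a \<partial>\<mu>)"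
      by (simp add: T sum_distrib_left)
    finally have "(\<integral>a. of_real (Y a) * E s a \<partial>\<mu>) - \<i> * of_real s * V * \<phi> s
      = \<i> * of_real s * (\<Sum>i\<in>J. \<Sum>j\<in>J. (\<integral>a. L i j a / of_nat N * E s a \<partial>\<mu>) - v i j * \<phi> s)"
      by (simp add: V_def sum_subtractf algebra_simps sum_distrib_left)
    also have "\<dots> = \<i> * of_real s * (\<Sum>i\<in>J. \<Sum>j\<in>J. \<integral>a. (L i j a / of_nat N - v i j) * E s a \<partial>\<mu>)"
    proof -
      have "(\<integral>a. L i j a / of_nat N * E s a \<partial>\<mu>) - v i j * \<phi> s = (\<integral>a. (L i j a / of_nat N - v i j) * E s a \<partial>\<mu>)"
        if ij: "i \<in> J" "j \<in> J" for i j
      proof -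
        have "pbd (\<lambda>a. L i j a / of_nat N * E s a)" unfolding divide_inverse
          by (intro pbd_mult pE pL ij pbd_const)
        then show ?thesis using pbd_integrable[OF pE[of s]]
          by (simp add: \<phi>_def left_diff_distrib pbd_integrable)
      qed
      then show ?thesis by simp
    qed
    finally have "cmod ((\<integral>a. of_real (Y a) * E s a \<partial>\<mu>) - \<i> * of_real s * V * \<phi> s)
      = \<bar>s\<bar> * cmod (\<Sum>i\<in>J. \<Sum>j\<in>J. \<integral>a. (L i j a / of_nat N - v i j) * E s a \<partial>\<mu>)"
      by (simp add: norm_mult)
    also have "\<dots> \<le> \<bar>s\<bar> * (\<Sum>i\<in>J. \<Sum>j\<in>J. H * (\<integral>a. cmod (L i j a / of_nat N - v i j) \<partial>\<mu>))"
    proof (intro mult_left_mono order_trans[OF norm_sum] sum_mono)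
      fix i j assume ij: "i \<in> J" "j \<in> J"
      have pD: "pbd (\<lambda>a. L i j a / of_nat N - v i j)" unfolding divide_inverse
        by (intro pbd_diff pbd_mult pL ij pbd_const)
      have "cmod (\<integral>a. (L i j a / of_nat N - v i j) * E s a \<partial>\<mu>) \<le> (\<integral>a. cmod ((L i j a / of_nat N - v i j) * E s a) \<partial>\<mu>)"
        by (rule integral_norm_bound)
      also have "\<dots> \<le> (\<integral>a. H * cmod (L i j a / of_nat N - v i j) \<partial>\<mu>)"
      proof (rule integral_mono)
        show "integrable \<mu> (\<lambda>a. cmod ((L i j a / of_nat N - v i j) * E s a))"
          by (intro rpbd_integrable rpbd_norm pbd_mult pD pE)
        show "integrable \<mu> (\<lambda>a. H * cmod (L i j a / of_nat N - v i j))"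
          by (intro rpbd_integrable rpbd_norm rpbd_mult rpbd_const pD)
        show "cmod ((L i j a / of_nat N - v i j) * E s a) \<le> H * cmod (L i j a / of_nat N - v i j)" for a
          using mult_left_mono[OF nE[of s a], of "cmod (L i j a / of_nat N - v i j)"] by (simp add: norm_mult mult.commute)
      qed
      finally show "cmod (\<integral>a. (L i j a / of_nat N - v i j) * E s a \<partial>\<mu>) \<le> H * (\<integral>a. cmod (L i j a / of_nat N - v i j) \<partial>\<mu>)"
        by simp
    qed simp
    also have "\<dots> = \<bar>s\<bar> * (H * R)" by (simp add: R_def sum_distrib_left)
    finally show ?thesis .
  qed
  have iY2: "integrable \<mu> (\<lambda>a. (Y a)\<^sup>2)"
    by (intro rpbd_integrable rpbd_power) (simp add: rpbd_def pY)
  have d\<phi>: "(\<phi> has_vector_derivative \<i> * (\<integral>a. of_real (Y a) * E s a \<partial>\<mu>)) (at s)" for s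
  proof (rule has_vector_derivative_quadratic[where C = "H * (\<integral>a. (Y a)\<^sup>2 \<partial>\<mu>) / 2"])
    fix t
    have iE: "integrable \<mu> (E r)" for r by (rule pbd_integrable[OF pE])
    have iYE: "integrable \<mu> (\<lambda>a. of_real (Y a) * E s a)" by (intro pbd_integrable pbd_mult pY pE)
    have "\<phi> (s + t) - \<phi> s - of_real t * (\<i> * (\<integral>a. of_real (Y a) * E s a \<partial>\<mu>))
       = (\<integral>a. E (s + t) a - E s a - of_real t * (\<i> * (of_real (Y a) * E s a)) \<partial>\<mu>)"
      unfolding \<phi>_def using iE iYE by simp
    also have "cmod \<dots> \<le> (\<integral>a. H * (t\<^sup>2 * (Y a)\<^sup>2 / 2) \<partial>\<mu>)"
    proof (rule order_trans[OF integral_norm_bound integral_mono])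
      show "integrable \<mu> (\<lambda>a. cmod (E (s + t) a - E s a - of_real t * (\<i> * (of_real (Y a) * E s a))))"
        by (intro rpbd_integrable rpbd_norm pbd_diff pbd_mult pbd_const pE pY)
      show "integrable \<mu> (\<lambda>a. H * (t\<^sup>2 * (Y a)\<^sup>2 / 2))" using iY2 by simp
      fix a
      have "E (s + t) a - E s a - of_real t * (\<i> * (of_real (Y a) * E s a))
         = E s a * (iexp (t * Y a) - (\<Sum>k\<le>1. (\<i> * (t * Y a))^k / fact k))"
        by (simp add: E_def exp_add algebra_simps)
      then have "cmod (E (s + t) a - E s a - of_real t * (\<i> * (of_real (Y a) * E s a)))
         = cmod (E s a) * cmod (iexp (t * Y a) - (\<Sum>k\<le>1. (\<i> * (t * Y a))^k / fact k))"
        by (simp only: norm_mult)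
      also have "\<dots> \<le> H * (\<bar>t * Y a\<bar> ^ Suc 1 / fact (Suc 1))"
        by (intro mult_mono nE iexp_approx1 H) simp
      finally show "cmod (E (s + t) a - E s a - of_real t * (\<i> * (of_real (Y a) * E s a))) \<le> H * (t\<^sup>2 * (Y a)\<^sup>2 / 2)"
        by (simp add: power_mult_distrib power2_eq_square abs_mult_self mult_ac)
    qed
    also have "\<dots> = H * (\<integral>a. (Y a)\<^sup>2 \<partial>\<mu>) / 2 * t\<^sup>2" by simp
    finally show "cmod (\<phi> (s + t) - \<phi> s - of_real t * (\<i> * (\<integral>a. of_real (Y a) * E s a \<partial>\<mu>))) \<le> H * (\<integral>a. (Y a)\<^sup>2 \<partial>\<mu>) / 2 * t\<^sup>2" .
  qed
  \<comment> \<open>Integrating factor: the terms with \<open>V\<close> cancel in the derivative,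
    and what remains is the factor times \<i> times the error bounded in
    \<open>stein\<close>.\<close>
  define \<psi> where "\<psi> s = exp (V * (of_real s)\<^sup>2 / 2) * \<phi> s" for s :: real
  let ?D = "\<lambda>s. exp (V * (of_real s)\<^sup>2 / 2) * (\<i> * ((\<integral>a. of_real (Y a) * E s a \<partial>\<mu>) - \<i> * of_real s * V * \<phi> s))"
  have d\<psi>: "(\<psi> has_vector_derivative ?D s) (at s)" for s
  proof -
    have "((\<lambda>s. V * (of_real s)\<^sup>2 / 2) has_vector_derivative V * of_real s) (at s)"
    proof -
      have "((\<lambda>z. V * z\<^sup>2 / 2) has_field_derivative V * of_real s) (at (of_real s))"
        by (auto intro!: derivative_eq_intros)
      from has_vector_derivative_real_field[OF this] show ?thesis by simp
    qed
    from field_vector_diff_chain_at[OF this DERIV_exp]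
    have "((\<lambda>s. exp (V * (of_real s)\<^sup>2 / 2)) has_vector_derivative V * of_real s * exp (V * (of_real s)\<^sup>2 / 2)) (at s)"
      by (simp add: o_def)
    from has_vector_derivative_mult[OF this d\<phi>[of s]] show ?thesis
      unfolding \<psi>_def by (rule back_subst[where P = "\<lambda>x. (_ has_vector_derivative x) (at s)"]) (simp add: algebra_simps)
  qed
  have "cmod (\<psi> 1 - \<psi> 0) \<le> (exp (cmod V / 2) * (H * R)) * norm (1 - 0 :: real)"
  proof (rule differentiable_bound[where S = "{0..1}" and f = \<psi> and f' = "\<lambda>s h. h *\<^sub>R ?D s"])
    fix s :: real assume s: "s \<in> {0..1}"
    show "(\<psi> has_derivative (\<lambda>h. h *\<^sub>R ?D s)) (at s within {0..1})"
      using d\<psi>[of s] by (auto simp: has_vector_derivative_def intro: has_derivative_at_withinI)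
    have R0: "0 \<le> R" unfolding R_def by (intro sum_nonneg) simp
    have "Re (V * (of_real s)\<^sup>2 / 2) \<le> cmod V / 2"
    proof -
      have "Re (V * (of_real s)\<^sup>2 / 2) \<le> cmod (V * (of_real s)\<^sup>2 / 2)" by (rule complex_Re_le_cmod)
      also have "\<dots> = cmod V * s\<^sup>2 / 2" by (simp add: norm_mult norm_divide norm_power)
      also have "\<dots> \<le> cmod V * 1 / 2" using s by (intro divide_right_mono mult_left_mono) (auto simp: power_le_one)
      finally show ?thesis by simp
    qed
    then have "cmod (exp (V * (of_real s)\<^sup>2 / 2)) \<le> exp (cmod V / 2)" by simp
    moreover have "cmod (\<i> * ((\<integral>a. of_real (Y a) * E s a \<partial>\<mu>) - \<i> * of_real s * V * \<phi> s)) \<le> H * R"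
    proof -
      have "\<bar>s\<bar> * (H * R) \<le> 1 * (H * R)" using s H R0 by (intro mult_right_mono) auto
      then show ?thesis using stein[of s] by (simp add: norm_mult)
    qed
    ultimately have "cmod (?D s) \<le> exp (cmod V / 2) * (H * R)"
      unfolding norm_mult[of "exp _"] by (intro mult_mono) auto
    then show "onorm (\<lambda>h. h *\<^sub>R ?D s) \<le> exp (cmod V / 2) * (H * R)"
      by (intro onorm_le) (simp add: mult_left_mono mult.commute)
  qed auto
  then have b: "cmod (exp (V / 2) * \<phi> 1 - \<phi> 0) \<le> exp (cmod V / 2) * (H * R)"
    by (simp add: \<psi>_def)
  have "\<phi> 1 - exp (- V / 2) * \<phi> 0 = exp (- V / 2) * (exp (V / 2) * \<phi> 1 - \<phi> 0)"
    by (simp add: right_diff_distrib mult.assoc[symmetric] exp_minus)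
  then have "cmod (\<phi> 1 - exp (- V / 2) * \<phi> 0) = exp (- Re V / 2) * cmod (exp (V / 2) * \<phi> 1 - \<phi> 0)"
    by (simp add: norm_mult)
  \<comment> \<open>One factor \<open>exp (cmod V / 2)\<close> undoes the integrating factor, the
    other bounds the derivative of \<psi>.\<close>
  also have "\<dots> \<le> exp (cmod V / 2) * (exp (cmod V / 2) * (H * R))"
    using b abs_Re_le_cmod[of V] by (intro mult_mono) auto
  also have "\<dots> = exp (cmod V) * H * R" by (simp add: mult.assoc[symmetric] flip: exp_add)
  finally show ?thesis
    by (simp add: \<phi>_def E_def Y R_def)
qed

text \<open>Four sources of error: the fluctuation of the centred product (\<open>X\<close>), the
  crossing trace (\<open>Z\<close>), the convergence of the normalised trace of \<open>B B'\<close>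
  (\<open>t\<close>), and that of \<open>Q' Q\<close>. The first two use operator norms and, with
  the fourth moment of \<open>K\<close> of order \<open>sqrt N\<close>, decay like N^(-1/4).\<close>

lemma error_bound:
  assumes B: "cov B" "cov B'" and t0: "mtr N Q = 0" "\<And>a. mtr N (B a) = 0" "\<And>a. mtr N (B' a) = 0"
    and K: "rpbd K" "\<And>a. op_bound N (B a) (K a)" "\<And>a. op_bound N (B' a) (K a)"
    and C: "(hs N Q)\<^sup>2 \<le> C * real N" "(hs N Q')\<^sup>2 \<le> C * real N" and C': "(\<integral>a. K a ^ 4 \<partial>\<mu>) \<le> C' * sqrt (real N)"
  shows "(\<integral>a. cmod ((mtr N (mmult N (mmult N Q' Q) (mmult N (B a) (B' a)))
        - mtr N (mmult N Q (mmult N (B a) (mmult N Q' (B' a))))) / of_nat N - q * b) \<partial>\<mu>)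
    \<le> 2 * sqrt (10 * C\<^sup>2 * C' / sqrt (real N))
      + cmod (mtr N (mmult N Q' Q) / of_nat N) * sqrt (\<integral>a. (cmod (mtr N (mmult N (B a) (B' a)) / of_nat N - b))\<^sup>2 \<partial>\<mu>)
      + cmod (mtr N (mmult N Q' Q) / of_nat N - q) * cmod b"
proof -
  let ?P = "mmult N Q' Q"
  define X where "X a = mtr N (mmult N ?P (ctr N (mmult N (B a) (B' a))))" for a
  define Z where "Z a = mtr N (mmult N Q (mmult N (B a) (mmult N Q' (B' a))))" for a
  define t where "t a = mtr N (mmult N (B a) (B' a)) / of_nat N - b" for a
  define p where "p = mtr N ?P / of_nat N"
  have Npos: "0 < real N" using N by simp
  have C0: "0 \<le> C" using order_trans[OF zero_le_power2 C(1)] Npos by (simp add: zero_le_mult_iff)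
  have C'0: "0 \<le> C'"
  proof -
    have "0 \<le> (\<integral>a. K a ^ 4 \<partial>\<mu>)" by simp
    then show ?thesis using C' Npos by (smt (verit) mult_neg_pos real_sqrt_gt_zero)
  qed
  have pB: "pbd (\<lambda>a. B a i j)" "pbd (\<lambda>a. B' a i j)" for i j
    using covD(2)[OF B(1)] covD(2)[OF B(2)] by auto
  have pX: "pbd X" and pZ: "pbd Z" and pt: "pbd t"
    unfolding X_def Z_def t_def divide_inverse
    by (intro pbd_mtr pbd_mmult pbd_const pbd_mult pbd_diff pB covD(2)[OF cov_ctr[OF cov_mmult[OF B]]])+
  \<comment> \<open>Shared by \<open>X\<close> and \<open>Z\<close>; the 10 of
    \<open>crossing_bound\<close> also covers the 8 of \<open>covariance_bound\<close>.\<close>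
  have sq: "(\<integral>a. cmod (F a) \<partial>\<mu>) / real N \<le> sqrt (10 * C\<^sup>2 * C' / sqrt (real N))"
    if F: "pbd F" and b: "(\<integral>a. (cmod (F a))\<^sup>2 \<partial>\<mu>) \<le> 10 * (C * real N)\<^sup>2 * (C' * sqrt (real N)) / real N" for F
  proof -
    have "(\<integral>a. cmod (F a) \<partial>\<mu>) / real N \<le> sqrt (\<integral>a. (cmod (F a))\<^sup>2 \<partial>\<mu>) / real N"
      using integral_norm_le_sqrt[OF rpbd_norm[OF F]] by (intro divide_right_mono) auto
    also have "\<dots> \<le> sqrt (10 * (C * real N)\<^sup>2 * (C' * sqrt (real N)) / real N) / real N"
      using b by (intro divide_right_mono real_sqrt_le_mono) auto
    also have "\<dots> = sqrt (10 * (C * real N)\<^sup>2 * (C' * sqrt (real N)) / real N / (real N)\<^sup>2)"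
      by (simp only: real_sqrt_divide real_sqrt_abs abs_of_nat)
    also have "10 * (C * real N)\<^sup>2 * (C' * sqrt (real N)) / real N / (real N)\<^sup>2 = 10 * C\<^sup>2 * C' * (sqrt (real N) / real N)"
      using Npos by (simp add: power_mult_distrib)
    also have "sqrt (real N) / real N = 1 / sqrt (real N)"
      using Npos by (simp add: field_simps)
    finally show ?thesis by simp
  qed
  have "(\<integral>a. (cmod (X a))\<^sup>2 \<partial>\<mu>) \<le> 8 * (hs N ?P)\<^sup>2 * (\<integral>a. K a ^ 4 \<partial>\<mu>) / real N"
    unfolding X_def by (rule covariance_bound[OF B K])
  also have "\<dots> \<le> 10 * (C * real N)\<^sup>2 * (C' * sqrt (real N)) / real N"
  proof (intro divide_right_mono mult_mono C')
    have "(hs N ?P)\<^sup>2 \<le> (hs N Q')\<^sup>2 * (hs N Q)\<^sup>2"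
      using power_mono[OF hs_mmult_le[of N Q' Q], of 2] by (simp add: power_mult_distrib)
    also have "\<dots> \<le> (C * real N) * (C * real N)" using C C0 by (intro mult_mono) auto
    finally show "(hs N ?P)\<^sup>2 \<le> (C * real N)\<^sup>2" by (simp add: power2_eq_square)
  qed auto
  finally have 1: "(\<integral>a. cmod (X a) \<partial>\<mu>) / real N \<le> sqrt (10 * C\<^sup>2 * C' / sqrt (real N))"
    by (rule sq[OF pX])
  have "(\<integral>a. (cmod (Z a))\<^sup>2 \<partial>\<mu>) \<le> 10 * (hs N Q)\<^sup>2 * (hs N Q')\<^sup>2 * (\<integral>a. K a ^ 4 \<partial>\<mu>) / real N"
    unfolding Z_def by (rule crossing_bound[OF B t0 K])
  also have "\<dots> \<le> 10 * (C * real N)\<^sup>2 * (C' * sqrt (real N)) / real N"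
    unfolding mult.assoc[of 10] power2_eq_square[of "C * real N"]
    using C C0 by (intro divide_right_mono mult_mono C') auto
  finally have 2: "(\<integral>a. cmod (Z a) \<partial>\<mu>) / real N \<le> sqrt (10 * C\<^sup>2 * C' / sqrt (real N))"
    by (rule sq[OF pZ])
  have split: "(mtr N (mmult N ?P (mmult N (B a) (B' a))) - Z a) / of_nat N - q * b
      = X a / of_nat N - Z a / of_nat N + p * t a + (p - q) * b" for a
  proof -
    have "mtr N (mmult N ?P (mmult N (B a) (B' a))) = X a + of_nat N * p * (t a + b)"
      using Npos by (simp add: X_def ctr_def p_def t_def)
    then show ?thesis using Npos by (simp add: field_simps)
  qed
  have "(\<integral>a. cmod ((mtr N (mmult N ?P (mmult N (B a) (B' a))) - Z a) / of_nat N - q * b) \<partial>\<mu>)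
    \<le> (\<integral>a. cmod (X a) / real N + cmod (Z a) / real N + cmod p * cmod (t a) + cmod (p - q) * cmod b \<partial>\<mu>)"
    unfolding split
  proof (rule integral_mono)
    show "integrable \<mu> (\<lambda>a. cmod (X a / of_nat N - Z a / of_nat N + p * t a + (p - q) * b))"
      unfolding divide_inverse
      by (intro rpbd_integrable rpbd_norm pbd_add pbd_diff pbd_mult pbd_const pX pZ pt)
    show "integrable \<mu> (\<lambda>a. cmod (X a) / real N + cmod (Z a) / real N + cmod p * cmod (t a) + cmod (p - q) * cmod b)"
      unfolding divide_inverse
      by (intro rpbd_integrable rpbd_add rpbd_mult rpbd_const rpbd_norm pX pZ pt)
    fix a
    have "cmod (x - y + z + w) \<le> cmod x + cmod y + cmod z + cmod w" for x y z w
      using norm_triangle_ineq4[of x y] norm_triangle_ineq[of "x - y" z] norm_triangle_ineq[of "x - y + z" w] by linarith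
    from this[of "X a / of_nat N" "Z a / of_nat N" "p * t a" "(p - q) * b"]
    show "cmod (X a / of_nat N - Z a / of_nat N + p * t a + (p - q) * b)
       \<le> cmod (X a) / real N + cmod (Z a) / real N + cmod p * cmod (t a) + cmod (p - q) * cmod b"
      by (simp add: norm_mult norm_divide)
  qed
  also have "\<dots> = (\<integral>a. cmod (X a) \<partial>\<mu>) / real N + (\<integral>a. cmod (Z a) \<partial>\<mu>) / real N + cmod p * (\<integral>a. cmod (t a) \<partial>\<mu>) + cmod (p - q) * cmod b"
    using pX pZ pt prob_space by (simp add: rpbd_norm rpbd_integrable)
  also have "\<dots> \<le> 2 * sqrt (10 * C\<^sup>2 * C' / sqrt (real N)) + cmod p * sqrt (\<integral>a. (cmod (t a))\<^sup>2 \<partial>\<mu>) + cmod (p - q) * cmod b"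
  proof -
    have "cmod p * (\<integral>a. cmod (t a) \<partial>\<mu>) \<le> cmod p * sqrt (\<integral>a. (cmod (t a))\<^sup>2 \<partial>\<mu>)"
      using integral_norm_le_sqrt[OF rpbd_norm[OF pt]] by (intro mult_left_mono) auto
    with 1 2 show ?thesis by linarith
  qed
  finally show ?thesis unfolding Z_def p_def t_def .
qed

end

text \<open>\<open>h\<close> varies with \<open>N\<close> because the traces it sees are centred at
  \<open>N\<close>-dependent means; its bound \<open>H\<close> is uniform. The order in
  \<open>q j i * b i j\<close> is that of the product
  \<open>Q\<^sub>j Q\<^sub>i B\<^sub>i B\<^sub>j\<close>.\<close>

lemma charfun_convergence:
  fixes \<mu> :: "nat \<Rightarrow> ('k \<Rightarrow> cmat) measure" and B :: "nat \<Rightarrow> 'j \<Rightarrow> ('k \<Rightarrow> cmat) \<Rightarrow> cmat"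
    and Q :: "nat \<Rightarrow> 'j \<Rightarrow> cmat"
  assumes ens: "\<And>N. N \<ge> 1 \<Longrightarrow> ens (\<mu> N) N S"
    and J: "finite J" and B: "\<And>N j. N \<ge> 1 \<Longrightarrow> j \<in> J \<Longrightarrow> ens.cov N S (B N j)"
    and t0: "\<And>N j a. N \<ge> 1 \<Longrightarrow> j \<in> J \<Longrightarrow> mtr N (B N j a) = 0"
    and q0: "\<And>N j. N \<ge> 1 \<Longrightarrow> j \<in> J \<Longrightarrow> mtr N (Q N j) = 0"
    and re: "\<And>N a. N \<ge> 1 \<Longrightarrow> Im (\<Sum>j\<in>J. mtr N (mmult N (Q N j) (B N j a))) = 0"
    and K: "\<And>N. N \<ge> 1 \<Longrightarrow> ens.rpbd N S (K N)"
      "\<And>N j a. N \<ge> 1 \<Longrightarrow> j \<in> J \<Longrightarrow> op_bound N (B N j a) (K N a)"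
    and K4: "\<And>N. N \<ge> 1 \<Longrightarrow> (\<integral>a. K N a ^ 4 \<partial>\<mu> N) \<le> C' * sqrt (real N)"
    and C: "\<And>N j. N \<ge> 1 \<Longrightarrow> j \<in> J \<Longrightarrow> (hs N (Q N j))\<^sup>2 \<le> C * real N"
    and q: "\<And>i j. i \<in> J \<Longrightarrow> j \<in> J \<Longrightarrow> (\<lambda>N. mtr N (mmult N (Q N i) (Q N j)) / of_nat N) \<longlonglongrightarrow> q i j"
    and b: "\<And>i j. i \<in> J \<Longrightarrow> j \<in> J \<Longrightarrow>
      (\<lambda>N. \<integral>a. (cmod (mtr N (mmult N (B N i a) (B N j a)) / of_nat N - b i j))\<^sup>2 \<partial>\<mu> N) \<longlonglongrightarrow> 0"
    and h: "\<And>N. N \<ge> 1 \<Longrightarrow> h N \<in> borel_measurable fam_space" "\<And>N a. N \<ge> 1 \<Longrightarrow> cmod (h N a) \<le> H"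
      "\<And>N U a. N \<ge> 1 \<Longrightarrow> unitary N U \<Longrightarrow> h N (cj N U a) = h N a"
  shows "(\<lambda>N. (\<integral>a. h N a * exp (\<i> * (\<Sum>j\<in>J. mtr N (mmult N (Q N j) (B N j a)))) \<partial>\<mu> N)
     - exp (- (\<Sum>i\<in>J. \<Sum>j\<in>J. q j i * b i j) / 2) * (\<integral>a. h N a \<partial>\<mu> N)) \<longlonglongrightarrow> 0"
proof -
  define V where "V = (\<Sum>i\<in>J. \<Sum>j\<in>J. q j i * b i j)"
  define e where "e i j N = 2 * sqrt (10 * C\<^sup>2 * C' / sqrt (real N))
      + cmod (mtr N (mmult N (Q N j) (Q N i)) / of_nat N) * sqrt (\<integral>a. (cmod (mtr N (mmult N (B N i a) (B N j a)) / of_nat N - b i j))\<^sup>2 \<partial>\<mu> N)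
      + cmod (mtr N (mmult N (Q N j) (Q N i)) / of_nat N - q j i) * cmod (b i j)" for i j N
  have H0: "0 \<le> H" using h(2)[of 1] norm_ge_zero order_trans by blast
  have "(\<lambda>N. exp (cmod V) * H * (\<Sum>i\<in>J. \<Sum>j\<in>J. e i j N)) \<longlonglongrightarrow> exp (cmod V) * H * (\<Sum>i\<in>J. \<Sum>j\<in>J. 0)"
  proof (intro tendsto_mult tendsto_const tendsto_sum)
    fix i j assume ij: "i \<in> J" "j \<in> J"
    have "(\<lambda>N. 10 * C\<^sup>2 * C' / sqrt (real N)) \<longlonglongrightarrow> 0"
      by (intro tendsto_divide_0[OF tendsto_const] filterlim_at_top_imp_at_infinity
          filterlim_compose[OF sqrt_at_top filterlim_real_sequentially])
    then have 1: "(\<lambda>N. 2 * sqrt (10 * C\<^sup>2 * C' / sqrt (real N))) \<longlonglongrightarrow> 2 * sqrt 0"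
      by (intro tendsto_intros)
    have 2: "(\<lambda>N. cmod (mtr N (mmult N (Q N j) (Q N i)) / of_nat N)) \<longlonglongrightarrow> cmod (q j i)"
      by (intro tendsto_norm q ij)
    have 3: "(\<lambda>N. sqrt (\<integral>a. (cmod (mtr N (mmult N (B N i a) (B N j a)) / of_nat N - b i j))\<^sup>2 \<partial>\<mu> N)) \<longlonglongrightarrow> sqrt 0"
      by (intro tendsto_real_sqrt b ij)
    have 4: "(\<lambda>N. cmod (mtr N (mmult N (Q N j) (Q N i)) / of_nat N - q j i)) \<longlonglongrightarrow> cmod (q j i - q j i)"
      by (intro tendsto_norm tendsto_diff tendsto_const q ij)
    show "e i j \<longlonglongrightarrow> 0"
      unfolding e_def using tendsto_add[OF tendsto_add[OF 1 tendsto_mult[OF 2 3]] tendsto_mult[OF 4 tendsto_const[of "cmod (b i j)"]]]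
      by simp
  qed
  then have lim: "(\<lambda>N. exp (cmod V) * H * (\<Sum>i\<in>J. \<Sum>j\<in>J. e i j N)) \<longlonglongrightarrow> 0" by simp
  have "\<forall>\<^sub>F N in sequentially. cmod ((\<integral>a. h N a * exp (\<i> * (\<Sum>j\<in>J. mtr N (mmult N (Q N j) (B N j a)))) \<partial>\<mu> N)
     - exp (- V / 2) * (\<integral>a. h N a \<partial>\<mu> N)) \<le> exp (cmod V) * H * (\<Sum>i\<in>J. \<Sum>j\<in>J. e i j N)"
    using eventually_ge_at_top[of 1]
  proof eventually_elim
    case (elim N)
    interpret ens "\<mu> N" N S by (rule ens[OF elim])
    have "cmod ((\<integral>a. h N a * exp (\<i> * (\<Sum>j\<in>J. mtr N (mmult N (Q N j) (B N j a)))) \<partial>\<mu> N)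
      - exp (- V / 2) * (\<integral>a. h N a \<partial>\<mu> N)) \<le> exp (cmod V) * H * (\<Sum>i\<in>J. \<Sum>j\<in>J. \<integral>a. cmod ((mtr N (mmult N (mmult N (Q N j) (Q N i)) (mmult N (B N i a) (B N j a)))
        - mtr N (mmult N (Q N i) (mmult N (B N i a) (mmult N (Q N j) (B N j a))))) / of_nat N - q j i * b i j) \<partial>\<mu> N)"
      unfolding V_def
      by (rule charfun_bound[OF J]) (use elim B t0 re h in auto)
    also have "\<dots> \<le> exp (cmod V) * H * (\<Sum>i\<in>J. \<Sum>j\<in>J. e i j N)"
      unfolding e_def
      by (intro mult_left_mono sum_mono error_bound[where K = "K N"]) (use elim B t0 q0 K K4 C H0 in auto)
    finally show ?case .
  qed
  from Lim_null_comparison[OF this lim] show ?thesis by (simp add: V_def)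
qed

section \<open>The random matrix model\<close>

text \<open>Any constant will do: it serves to pass a fourth power inside the sum over
  \<open>S\<close> in \<open>kap_bound\<close>.\<close>

lemma sum_power_bound:
  assumes "finite S"
  shows "\<exists>c\<ge>0. \<forall>x :: 'k \<Rightarrow> real. (\<forall>k\<in>S. 0 \<le> x k) \<longrightarrow> (\<Sum>k\<in>S. x k) ^ Suc m \<le> c * (\<Sum>k\<in>S. x k ^ Suc m)"
  using assms
proof (induction S)
  case (insert i S)
  then obtain c where c: "c \<ge> 0"
    "\<And>x :: 'k \<Rightarrow> real. (\<And>k. k \<in> S \<Longrightarrow> 0 \<le> x k) \<Longrightarrow> (\<Sum>k\<in>S. x k) ^ Suc m \<le> c * (\<Sum>k\<in>S. x k ^ Suc m)" by blast
  have "(\<Sum>k\<in>insert i S. x k) ^ Suc m \<le> (2 ^ Suc m * (1 + c)) * (\<Sum>k\<in>insert i S. x k ^ Suc m)"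
    if x: "\<And>k. k \<in> insert i S \<Longrightarrow> 0 \<le> x k" for x :: "'k \<Rightarrow> real"
  proof -
    have s: "0 \<le> (\<Sum>k\<in>S. x k ^ Suc m)" using x by (intro sum_nonneg zero_le_power) auto
    have xi: "0 \<le> x i ^ Suc m" using x by (intro zero_le_power) auto
    have "(\<Sum>k\<in>insert i S. x k) ^ Suc m \<le> 2 ^ Suc m * (x i ^ Suc m + (\<Sum>k\<in>S. x k) ^ Suc m)"
      using insert.hyps x sum_power_le_two[of "x i" "\<Sum>k\<in>S. x k" "Suc m"] by (simp add: sum_nonneg)
    also have "\<dots> \<le> 2 ^ Suc m * ((1 + c) * (x i ^ Suc m + (\<Sum>k\<in>S. x k ^ Suc m)))"
    proof (rule mult_left_mono)
      have "(\<Sum>k\<in>S. x k) ^ Suc m \<le> c * (\<Sum>k\<in>S. x k ^ Suc m)" using c(2) x by simp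
      moreover have "0 \<le> c * x i ^ Suc m" using c(1) xi by simp
      ultimately show "x i ^ Suc m + (\<Sum>k\<in>S. x k) ^ Suc m \<le> (1 + c) * (x i ^ Suc m + (\<Sum>k\<in>S. x k ^ Suc m))"
        using s by (simp only: distrib_right distrib_left mult_1)
    qed simp
    finally show ?thesis using insert.hyps by (simp add: mult.assoc)
  qed
  then show ?case using c(1) by (intro exI[of _ "2 ^ Suc m * (1 + c)"]) auto
qed auto

text \<open>Pythagoras: centring removes the squared norm of the scalar part.\<close>

lemma hs_ctr_le: "hs N (ctr N X) \<le> hs N X"
proof (cases "N \<ge> 1")
  case True
  have "complex_of_real ((hs N (ctr N X))\<^sup>2) = of_real ((hs N X)\<^sup>2) - mtr N X * cnj (mtr N X) / of_nat N"
    unfolding hs_sq_mtr madj_ctr using mtr_ctr_mmult[OF True, of X "madj X"] by simp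
  also have "\<dots> = of_real ((hs N X)\<^sup>2 - (cmod (mtr N X))\<^sup>2 / real N)"
    by (simp add: complex_norm_square[symmetric] del: of_real_power)
  finally have "(hs N (ctr N X))\<^sup>2 = (hs N X)\<^sup>2 - (cmod (mtr N X))\<^sup>2 / real N" by (simp only: of_real_eq_iff)
  then have "(hs N (ctr N X))\<^sup>2 \<le> (hs N X)\<^sup>2" by simp
  then show ?thesis by (rule power2_le_imp_le) simp
next
  case False
  then have "N = 0" by simp
  then show ?thesis by (simp add: hs_def)
qed

lemma kap_msk [simp]: "kap N (msk N X) = kap N X"
proof -
  have "mmult N X (madj (msk N X)) = mmult N X (madj X)"
    using mmult_msk(2)[of N X "madj X"] by simp
  then show ?thesis by (simp add: kap_def)
qed

lemma ctr_msk [simp]: "ctr N (msk N X) = ctr N X"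
  by (simp add: ctr_def)

text \<open>Submultiplicativity; it places \<open>kap\<close> under the dominating function
  \<open>R\<close>.\<close>

lemma kap_le_hs: "kap N X \<le> hs N X"
proof -
  have "kap N X ^ 4 = hs N (mmult N (mmult N X (madj X)) (mmult N X (madj X)))"
    by (simp add: kap_def)
  also have "\<dots> \<le> hs N (mmult N X (madj X)) * hs N (mmult N X (madj X))" by (rule hs_mmult_le)
  also have "\<dots> \<le> (hs N X * hs N (madj X)) * (hs N X * hs N (madj X))"
    by (intro mult_mono hs_mmult_le) auto
  also have "\<dots> = hs N X ^ 4" by (simp add: power4_eq_xxxx mult_ac)
  finally show ?thesis by (rule power_mono_iff[THEN iffD1, rotated -1]) auto
qed

lemma mmult_measurable:
  assumes "\<And>i j. (\<lambda>a. C a i j) \<in> borel_measurable M" "\<And>i j. (\<lambda>a. C' a i j) \<in> borel_measurable M"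
  shows "(\<lambda>a. mmult N (C a) (C' a) i j) \<in> borel_measurable M"
  using assms by (cases "i < N \<and> j < N") (auto simp: mmult_def intro!: borel_measurable_sum borel_measurable_times)

lemma madj_measurable:
  assumes "\<And>i j. (\<lambda>a. C a i j) \<in> borel_measurable M"
  shows "(\<lambda>a. madj (C a) i j) \<in> borel_measurable M"
  using measurable_compose[OF assms[of j i] borel_measurable_continuous_onI[OF continuous_on_cnj[OF continuous_on_id]]]
  by simp

lemma kap_measurable: "(\<lambda>a. kap N (a k)) \<in> borel_measurable (fam_space :: ('k \<Rightarrow> cmat) measure)"
proof -
  have "(\<lambda>a. hs N (mmult N (mmult N (a k) (madj (a k))) (mmult N (a k) (madj (a k))))) \<in> borel_measurable (fam_space :: ('k \<Rightarrow> cmat) measure)"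
    unfolding hs_def L2_set_def
    by (intro measurable_compose[OF _ borel_measurable_sqrt] borel_measurable_sum borel_measurable_power measurable_compose[OF _ borel_measurable_norm]
        mmult_measurable madj_measurable fam_entry_measurable)
  from measurable_compose[OF this borel_measurable_continuous_onI[OF continuous_on_real_root[OF continuous_on_id]]]
  show ?thesis by (simp add: kap_def)
qed

context ens
begin

lemma kap_rpbd:
  assumes k: "k \<in> S" shows "rpbd (\<lambda>a. kap N (a k))"
  unfolding rpbd_def
proof (rule pbdI[where c = 1 and m = 1])
  show "(\<lambda>a. complex_of_real (kap N (a k))) \<in> borel_measurable fam_space"
    by (rule measurable_compose[OF kap_measurable borel_measurable_of_real])
  fix a :: "'k \<Rightarrow> cmat"
  have "kap N (a k) \<le> hs N (a k)" by (rule kap_le_hs)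
  also have "\<dots> \<le> R a" unfolding R_def using k fin_S by (intro member_le_sum) auto
  finally show "cmod (complex_of_real (kap N (a k))) \<le> 1 * (1 + R a) ^ 1" by simp
qed

text \<open>The first-moment identity with weight 1. The centred part thus has mean exactly zero,
  and its fluctuation is the trace itself.\<close>

lemma expectation_mtr_ctr_zero:
  assumes "cov C" shows "(\<integral>a. mtr N (mmult N Q (ctr N (C a))) \<partial>\<mu>) = 0"
  using integral_mtr_cov[OF cov_ctr[OF assms], of "\<lambda>_. 1" Q] N by simp

end

text \<open>The hypotheses up to (d). The Gaussian part, including the positivity of its covariance
  form, is settled here; the limit of the traces enters in \<open>fdd_limit\<close>.\<close>

locale rm_model =
  fixes \<Omega> :: "nat \<Rightarrow> 'a measure"
    and A :: "nat \<Rightarrow> 'k \<Rightarrow> 'a \<Rightarrow> cmat"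
    and M :: "nat \<Rightarrow> 'l \<Rightarrow> cmat"
    and \<tau> \<tau>c :: "'k \<Rightarrow> 'k \<Rightarrow> complex"
    and \<eta> \<beta> :: "'l \<Rightarrow> 'l \<Rightarrow> complex"
  assumes prob: "\<And>N. N \<ge> 1 \<Longrightarrow> prob_space (\<Omega> N)"
    and meas: "\<And>N k i j. N \<ge> 1 \<Longrightarrow> (\<lambda>\<omega>. A N k \<omega> i j) \<in> borel_measurable (\<Omega> N)"
    and a_inv: "\<And>N U. N \<ge> 1 \<Longrightarrow> unitary N U \<Longrightarrow>
        distr (\<Omega> N) fam_space (\<lambda>\<omega> k. msk N (A N k \<omega>))
      = distr (\<Omega> N) fam_space (\<lambda>\<omega> k. mmult N (mmult N U (A N k \<omega>)) (madj U))"
    and b_bdd: "\<And>k p q. p \<ge> 1 \<Longrightarrow> q \<ge> 1 \<Longrightarrow> (\<exists>C. \<forall>N\<ge>1.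
        integrable (\<Omega> N) (\<lambda>\<omega>. (cmod (mtr N (mpow N (mmult N (A N k \<omega>) (madj (A N k \<omega>))) p) / of_nat N)) ^ q)
      \<and> (\<integral>\<omega>. (cmod (mtr N (mpow N (mmult N (A N k \<omega>) (madj (A N k \<omega>))) p) / of_nat N)) ^ q \<partial>\<Omega> N) \<le> C)"
    and c1: "\<And>k k'. l2_conv \<Omega> (\<lambda>N \<omega>. mtr N (mmult N (A N k \<omega>) (A N k' \<omega>)) / of_nat N
                 - mtr N (A N k \<omega>) / of_nat N * (mtr N (A N k' \<omega>) / of_nat N)) (\<tau> k k')"
    and c2: "\<And>k k'. l2_conv \<Omega> (\<lambda>N \<omega>. mtr N (mmult N (A N k \<omega>) (madj (A N k' \<omega>))) / of_nat N
                 - mtr N (A N k \<omega>) / of_nat N * (mtr N (madj (A N k' \<omega>)) / of_nat N)) (\<tau>c k k')"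
    and d1: "\<And>l l'. (\<lambda>N. mtr N (mmult N (M N l) (M N l')) / of_nat N
                 - mtr N (M N l) / of_nat N * (mtr N (M N l') / of_nat N)) \<longlonglongrightarrow> \<eta> l l'"
    and d2: "\<And>l l'. (\<lambda>N. mtr N (mmult N (M N l) (madj (M N l'))) / of_nat N
                 - mtr N (M N l) / of_nat N * (mtr N (madj (M N l')) / of_nat N)) \<longlonglongrightarrow> \<beta> l l'"
begin

text \<open>Masking matches the left side of \<open>a_inv\<close>, and the conjugated matrices on
  its right side are masked by construction.\<close>

definition obs :: "nat \<Rightarrow> 'a \<Rightarrow> 'k \<Rightarrow> cmat" where "obs N \<omega> = (\<lambda>k. msk N (A N k \<omega>))"

definition law :: "nat \<Rightarrow> ('k \<Rightarrow> cmat) measure" where "law N = distr (\<Omega> N) fam_space (obs N)"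

lemma obs_measurable: "N \<ge> 1 \<Longrightarrow> obs N \<in> measurable (\<Omega> N) fam_space"
  by (rule fam_measurableI) (use meas in \<open>simp add: obs_def msk_def\<close>)

lemma integral_law:
  fixes F :: "('k \<Rightarrow> cmat) \<Rightarrow> 'c :: {banach, second_countable_topology}"
  shows "N \<ge> 1 \<Longrightarrow> F \<in> borel_measurable fam_space \<Longrightarrow> (\<integral>a. F a \<partial>law N) = (\<integral>\<omega>. F (obs N \<omega>) \<partial>\<Omega> N)"
  unfolding law_def by (rule integral_distr[OF obs_measurable])

lemma integrable_law:
  fixes F :: "('k \<Rightarrow> cmat) \<Rightarrow> 'c :: {banach, second_countable_topology}"
  shows "N \<ge> 1 \<Longrightarrow> F \<in> borel_measurable fam_space \<Longrightarrow> integrable (law N) F \<longleftrightarrow> integrable (\<Omega> N) (\<lambda>\<omega>. F (obs N \<omega>))"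
  unfolding law_def by (rule integrable_distr_eq[OF obs_measurable])

lemma hs_measurable [measurable]: "(\<lambda>a. hs N (a k)) \<in> borel_measurable (fam_space :: ('k \<Rightarrow> cmat) measure)"
  unfolding hs_def L2_set_def by measurable

lemma hs_sq_moment:
  assumes "q \<ge> 1"
  shows "\<exists>C. \<forall>N\<ge>1. integrable (\<Omega> N) (\<lambda>\<omega>. ((hs N (A N k \<omega>))\<^sup>2 / real N) ^ q)
     \<and> (\<integral>\<omega>. ((hs N (A N k \<omega>))\<^sup>2 / real N) ^ q \<partial>\<Omega> N) \<le> C"
proof -
  have "cmod (mtr N (mpow N (mmult N X (madj X)) 1) / of_nat N) = (hs N X)\<^sup>2 / real N" for N X
    using hs_sq_mtr[of N X, symmetric] by (simp add: norm_divide del: of_real_power)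
  then show ?thesis using b_bdd[of 1 q k] assms by simp
qed

lemma ens_law:
  assumes N: "N \<ge> 1" and S: "finite S"
  shows "ens (law N) N S"
proof -
  interpret prob_space "\<Omega> N" by (rule prob[OF N])
  have p: "prob_space (law N)" unfolding law_def by (rule prob_space_distr[OF obs_measurable[OF N]])
  show ?thesis
  proof (rule ens.intro[OF p], unfold_locales)
    show "N \<ge> 1" "sets (law N) = sets fam_space" "finite S" using N S by (auto simp: law_def)
    fix U assume U: "unitary N U"
    have "distr (law N) fam_space (cj N U) = distr (\<Omega> N) fam_space (cj N U \<circ> obs N)"
      unfolding law_def by (rule distr_distr[OF cj_measurable obs_measurable[OF N]])
    also have "cj N U \<circ> obs N = (\<lambda>\<omega> k. mmult N (mmult N U (A N k \<omega>)) (madj U))"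
      by (simp add: fun_eq_iff cj_def obs_def)
    finally show "distr (law N) fam_space (cj N U) = law N"
      using a_inv[OF N U] by (simp add: law_def obs_def[abs_def])
  next
    fix k m
    \<comment> \<open>The exponent is \<open>Suc m\<close> because the moment hypothesis starts at
      1; the constant 1 added below covers norms less than 1.\<close>
    have "integrable (\<Omega> N) (\<lambda>\<omega>. ((hs N (A N k \<omega>))\<^sup>2 / real N) ^ Suc m)"
      using hs_sq_moment[of "Suc m" k] N by auto
    then have i: "integrable (\<Omega> N) (\<lambda>\<omega>. 1 + real N ^ Suc m * ((hs N (A N k \<omega>))\<^sup>2 / real N) ^ Suc m)"
      by (intro Bochner_Integration.integrable_add integrable_const integrable_mult_right)
    have e: "real N ^ Suc m * (x / real N) ^ Suc m = x ^ Suc m" for x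
      using N by (simp add: power_divide)
    have "integrable (\<Omega> N) (\<lambda>\<omega>. hs N (obs N \<omega> k) ^ m)"
    proof (rule Bochner_Integration.integrable_bound[OF i[unfolded e]])
      show "(\<lambda>\<omega>. hs N (obs N \<omega> k) ^ m) \<in> borel_measurable (\<Omega> N)"
        using measurable_compose[OF obs_measurable[OF N] hs_measurable[of N k]] by simp
      have "x ^ m \<le> 1 + (x\<^sup>2) ^ Suc m" if "0 \<le> x" for x :: real
      proof (cases "x \<le> 1")
        case True
        then have "x ^ m \<le> 1" using that by (simp add: power_le_one)
        moreover have "0 \<le> (x\<^sup>2) ^ Suc m" by (rule zero_le_power) simp
        ultimately show ?thesis by linarith
      next
        case False
        then have "x ^ m \<le> x ^ (2 * Suc m)" by (intro power_increasing) auto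
        then show ?thesis unfolding power_mult by linarith
      qed
      from this[OF hs_nonneg]
      show "AE \<omega> in \<Omega> N. norm (hs N (obs N \<omega> k) ^ m) \<le> norm (1 + ((hs N (A N k \<omega>))\<^sup>2) ^ Suc m)"
        by (intro AE_I2) (simp add: obs_def del: power_Suc)
    qed
    then show "integrable (law N) (\<lambda>a. hs N (a k) ^ m)"
      by (subst integrable_law[OF N]) auto
  qed
qed

section \<open>Limits and symmetry of the covariance data\<close>

abbreviation cA :: "nat \<Rightarrow> 'k \<Rightarrow> ('k \<Rightarrow> cmat) \<Rightarrow> cmat" where "cA N k a \<equiv> ctr N (a k)"

lemma l2_law:
  assumes N: "N \<ge> 1" and F: "F \<in> borel_measurable fam_space"
    and eq: "\<And>\<omega>. F (obs N \<omega>) = X \<omega>"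
  shows "(\<integral>a. (cmod (F a - c))\<^sup>2 \<partial>law N) = (\<integral>\<omega>. (cmod (X \<omega> - c))\<^sup>2 \<partial>\<Omega> N)"
  using F by (subst integral_law[OF N]) (auto simp: eq)

lemma mtr_mmult_measurable:
  assumes "\<And>i j. (\<lambda>a. C a i j) \<in> borel_measurable fam_space" "\<And>i j. (\<lambda>a. C' a i j) \<in> borel_measurable fam_space"
  shows "(\<lambda>a. mtr N (mmult N (C a) (C' a))) \<in> borel_measurable fam_space"
  unfolding mtr_mmult using assms by (intro borel_measurable_sum borel_measurable_times)

lemma cA_measurable: "(\<lambda>a. cA N k a i j) \<in> borel_measurable fam_space"
  "(\<lambda>a. madj (cA N k a) i j) \<in> borel_measurable fam_space"
proof -
  have 1: "(\<lambda>a. cA N k a i j) \<in> borel_measurable fam_space" for i j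
    unfolding ctr_def mtr_def msk_def idm_def mat_entry by measurable
  show "(\<lambda>a. cA N k a i j) \<in> borel_measurable fam_space" by (rule 1)
  show "(\<lambda>a. madj (cA N k a) i j) \<in> borel_measurable fam_space"
    by (rule madj_measurable[OF 1])
qed

text \<open>For centred matrices the normalised trace of a product is exactly the difference
  appearing in hypothesis (c).\<close>

lemma tau_limits:
  "(\<lambda>N. \<integral>a. (cmod (mtr N (mmult N (cA N k a) (cA N k' a)) / of_nat N - \<tau> k k'))\<^sup>2 \<partial>law N) \<longlonglongrightarrow> 0"
  "(\<lambda>N. \<integral>a. (cmod (mtr N (mmult N (cA N k a) (madj (cA N k' a))) / of_nat N - \<tau>c k k'))\<^sup>2 \<partial>law N) \<longlonglongrightarrow> 0"
proof -
  show "(\<lambda>N. \<integral>a. (cmod (mtr N (mmult N (cA N k a) (cA N k' a)) / of_nat N - \<tau> k k'))\<^sup>2 \<partial>law N) \<longlonglongrightarrow> 0"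
  proof (rule Lim_transform_eventually[OF c1[of k k', unfolded l2_conv_def, THEN conjunct2]], use eventually_ge_at_top[of 1] in eventually_elim)
    case (elim N)
    show ?case
      by (rule l2_law[OF elim, symmetric],
          intro borel_measurable_divide mtr_mmult_measurable cA_measurable borel_measurable_const)
         (simp add: obs_def mtr_ctr_mmult[OF elim] diff_divide_distrib)
  qed
  show "(\<lambda>N. \<integral>a. (cmod (mtr N (mmult N (cA N k a) (madj (cA N k' a))) / of_nat N - \<tau>c k k'))\<^sup>2 \<partial>law N) \<longlonglongrightarrow> 0"
  proof (rule Lim_transform_eventually[OF c2[of k k', unfolded l2_conv_def, THEN conjunct2]], use eventually_ge_at_top[of 1] in eventually_elim)
    case (elim N)
    show ?case
      by (rule l2_law[OF elim, symmetric],
          intro borel_measurable_divide mtr_mmult_measurable cA_measurable borel_measurable_const)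
         (simp add: obs_def madj_ctr mtr_ctr_mmult[OF elim] diff_divide_distrib)
  qed
qed

text \<open>Symmetry of \<tau> and \<open>\<tau>c\<close> is forced by uniqueness of limits rather
  than postulated; the Gaussian construction relies on it.\<close>

lemma l2_conv_unique:
  assumes "l2_conv \<Omega> X c" "l2_conv \<Omega> X c'" shows "c = c'"
proof -
  have le: "(cmod (c - c'))\<^sup>2 \<le> 2 * (\<integral>\<omega>. (cmod (X N \<omega> - c))\<^sup>2 \<partial>\<Omega> N) + 2 * (\<integral>\<omega>. (cmod (X N \<omega> - c'))\<^sup>2 \<partial>\<Omega> N)"
    if N: "N \<ge> 1" for N
  proof -
    interpret prob_space "\<Omega> N" by (rule prob[OF N])
    have i: "integrable (\<Omega> N) (\<lambda>\<omega>. (cmod (X N \<omega> - c))\<^sup>2)" "integrable (\<Omega> N) (\<lambda>\<omega>. (cmod (X N \<omega> - c'))\<^sup>2)"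
      using assms N by (auto simp: l2_conv_def)
    have "(cmod (c - c'))\<^sup>2 = (\<integral>\<omega>. (cmod (c - c'))\<^sup>2 \<partial>\<Omega> N)" using prob_space by simp
    also have "\<dots> \<le> (\<integral>\<omega>. 2 * (cmod (X N \<omega> - c))\<^sup>2 + 2 * (cmod (X N \<omega> - c'))\<^sup>2 \<partial>\<Omega> N)"
    proof (rule integral_mono)
      fix \<omega>
      have "cmod (c - c') \<le> cmod (X N \<omega> - c) + cmod (X N \<omega> - c')"
        using norm_triangle_ineq4[of "X N \<omega> - c'" "X N \<omega> - c"] by simp
      then have "(cmod (c - c'))\<^sup>2 \<le> (cmod (X N \<omega> - c) + cmod (X N \<omega> - c'))\<^sup>2" by (intro power_mono) auto
      also have "\<dots> \<le> 2 * (cmod (X N \<omega> - c))\<^sup>2 + 2 * (cmod (X N \<omega> - c'))\<^sup>2"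
        using sum_squares_bound[of "cmod (X N \<omega> - c)" "cmod (X N \<omega> - c')"] by (simp add: power2_sum)
      finally show "(cmod (c - c'))\<^sup>2 \<le> 2 * (cmod (X N \<omega> - c))\<^sup>2 + 2 * (cmod (X N \<omega> - c'))\<^sup>2" .
    qed (use i in auto)
    finally show ?thesis using i by simp
  qed
  have "(\<lambda>N. 2 * (\<integral>\<omega>. (cmod (X N \<omega> - c))\<^sup>2 \<partial>\<Omega> N) + 2 * (\<integral>\<omega>. (cmod (X N \<omega> - c'))\<^sup>2 \<partial>\<Omega> N)) \<longlonglongrightarrow> 2 * 0 + 2 * 0"
    using assms by (intro tendsto_intros) (auto simp: l2_conv_def)
  then have "(cmod (c - c'))\<^sup>2 \<le> 2 * 0 + 2 * 0"
    by (rule tendsto_lowerbound) (use le in \<open>auto intro: eventually_mono[OF eventually_ge_at_top[of 1]]\<close>)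
  then show ?thesis by simp
qed

lemma tau_sym: "\<tau> k k' = \<tau> k' k" "\<tau>c k k' = cnj (\<tau>c k' k)"
proof -
  show "\<tau> k k' = \<tau> k' k"
    using c1[of k k'] c1[of k' k] by (intro l2_conv_unique) (simp_all add: mtr_cyclic[of _ "A _ k _"] mult.commute)
  have "l2_conv \<Omega> (\<lambda>N \<omega>. mtr N (mmult N (A N k \<omega>) (madj (A N k' \<omega>))) / of_nat N
                 - mtr N (A N k \<omega>) / of_nat N * (mtr N (madj (A N k' \<omega>)) / of_nat N)) (cnj (\<tau>c k' k))"
  proof -
    have "cmod (mtr N (mmult N (A N k \<omega>) (madj (A N k' \<omega>))) / of_nat N
        - mtr N (A N k \<omega>) / of_nat N * (mtr N (madj (A N k' \<omega>)) / of_nat N) - cnj (\<tau>c k' k))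
      = cmod (mtr N (mmult N (A N k' \<omega>) (madj (A N k \<omega>))) / of_nat N
        - mtr N (A N k' \<omega>) / of_nat N * (mtr N (madj (A N k \<omega>)) / of_nat N) - \<tau>c k' k)" for N \<omega>
      using complex_mod_cnj[of "mtr N (mmult N (A N k' \<omega>) (madj (A N k \<omega>))) / of_nat N
        - mtr N (A N k' \<omega>) / of_nat N * (mtr N (madj (A N k \<omega>)) / of_nat N) - \<tau>c k' k"]
      by (simp add: mult.commute flip: mtr_madj)
    then show ?thesis using c2[of k' k] by (simp add: l2_conv_def)
  qed
  then show "\<tau>c k k' = cnj (\<tau>c k' k)" using c2 l2_conv_unique by blast
qed

lemma eta_limits:
  "(\<lambda>N. mtr N (mmult N (ctr N (M N l)) (ctr N (M N l'))) / of_nat N) \<longlonglongrightarrow> \<eta> l l'"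
  "(\<lambda>N. mtr N (mmult N (ctr N (M N l)) (madj (ctr N (M N l')))) / of_nat N) \<longlonglongrightarrow> \<beta> l l'"
proof -
  show "(\<lambda>N. mtr N (mmult N (ctr N (M N l)) (ctr N (M N l'))) / of_nat N) \<longlonglongrightarrow> \<eta> l l'"
    by (rule Lim_transform_eventually[OF d1], use eventually_ge_at_top[of 1] in eventually_elim)
       (simp add: mtr_ctr_mmult diff_divide_distrib)
  show "(\<lambda>N. mtr N (mmult N (ctr N (M N l)) (madj (ctr N (M N l')))) / of_nat N) \<longlonglongrightarrow> \<beta> l l'"
    by (rule Lim_transform_eventually[OF d2], use eventually_ge_at_top[of 1] in eventually_elim)
       (simp add: madj_ctr mtr_ctr_mmult diff_divide_distrib)
qed

lemma eta_sym: "\<eta> l l' = \<eta> l' l" "\<beta> l l' = cnj (\<beta> l' l)"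
proof -
  show "\<eta> l l' = \<eta> l' l"
    using eta_limits(1)[of l l'] eta_limits(1)[of l' l] by (subst (asm) mtr_cyclic) (rule LIMSEQ_unique)
  have "(\<lambda>N. cnj (mtr N (mmult N (ctr N (M N l')) (madj (ctr N (M N l)))) / of_nat N)) \<longlonglongrightarrow> cnj (\<beta> l' l)"
    by (intro tendsto_cnj eta_limits)
  then have "(\<lambda>N. mtr N (mmult N (ctr N (M N l)) (madj (ctr N (M N l')))) / of_nat N) \<longlonglongrightarrow> cnj (\<beta> l' l)"
    by (simp flip: mtr_madj)
  then show "\<beta> l l' = cnj (\<beta> l' l)" using eta_limits(2) LIMSEQ_unique by blast
qed

text \<open>A convergent sequence is bounded, and the diagonal case of (d) is the squared norm
  divided by \<open>N\<close>. Operator norms of \<open>M\<close> are not controlled by this, so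
  deterministic factors are measured in the Hilbert--Schmidt norm.\<close>

lemma M_hs_bound: "\<exists>C. \<forall>N\<ge>1. (hs N (ctr N (M N l)))\<^sup>2 \<le> C * real N"
proof -
  obtain C where C: "\<And>N. cmod (mtr N (mmult N (ctr N (M N l)) (madj (ctr N (M N l)))) / of_nat N) \<le> C"
    using convergent_imp_Bseq[OF convergentI[OF eta_limits(2)[of l l]]] by (auto simp: Bseq_def)
  have "(hs N (ctr N (M N l)))\<^sup>2 \<le> C * real N" if "N \<ge> 1" for N
    using C[of N] that unfolding hs_sq_mtr[symmetric] by (simp add: norm_divide divide_le_eq norm_power)
  then show ?thesis by blast
qed

text \<open>By Cauchy--Schwarz the fourth moment of \<open>kap\<close> is at most the root of its
  eighth, and that is \<open>N\<close> times a bounded normalised moment. The factor 2 comes from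
  \<open>op_bound_ctr\<close>.\<close>

lemma kap_bound:
  assumes S: "finite S"
  shows "\<exists>C. \<forall>N\<ge>1. (\<integral>a. (2 * (\<Sum>k\<in>S. kap N (a k))) ^ 4 \<partial>law N) \<le> C * sqrt (real N)"
proof -
  obtain c where c: "c \<ge> 0" "\<And>x :: 'k \<Rightarrow> real. (\<And>k. k \<in> S \<Longrightarrow> 0 \<le> x k) \<Longrightarrow> (\<Sum>k\<in>S. x k) ^ 4 \<le> c * (\<Sum>k\<in>S. x k ^ 4)"
    using sum_power_bound[OF S, of 3] by (auto simp: numeral_eq_Suc)
  have "\<exists>C. \<forall>N\<ge>1. (\<integral>a. kap N (a k) ^ 4 \<partial>law N) \<le> sqrt C * sqrt (real N)" if k: "k \<in> S" for k
  proof -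
    obtain C where C: "\<And>N. N \<ge> 1 \<Longrightarrow> (\<integral>\<omega>. (cmod (mtr N (mpow N (mmult N (A N k \<omega>) (madj (A N k \<omega>))) 4) / of_nat N)) ^ 1 \<partial>\<Omega> N) \<le> C"
      using b_bdd[of 4 1 k] by auto
    have "(\<integral>a. kap N (a k) ^ 4 \<partial>law N) \<le> sqrt C * sqrt (real N)" if N: "N \<ge> 1" for N
    proof -
      interpret ens "law N" N S by (rule ens_law[OF N S])
      have "(\<integral>a. kap N (a k) ^ 4 \<partial>law N) = (\<integral>a. \<bar>kap N (a k) ^ 4\<bar> \<partial>law N)" by simp
      also have "\<dots> \<le> sqrt (\<integral>a. (kap N (a k) ^ 4)\<^sup>2 \<partial>law N)"
        by (intro integral_norm_le_sqrt rpbd_power kap_rpbd k)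
      also have "(\<integral>a. (kap N (a k) ^ 4)\<^sup>2 \<partial>law N) = (\<integral>\<omega>. kap N (A N k \<omega>) ^ 8 \<partial>\<Omega> N)"
        using borel_measurable_power[OF kap_measurable, of N k 8]
        by (subst integral_law[OF N]) (simp_all add: obs_def flip: power_mult)
      also have "\<dots> = (\<integral>\<omega>. real N * cmod (mtr N (mpow N (mmult N (A N k \<omega>) (madj (A N k \<omega>))) 4) / of_nat N) \<partial>\<Omega> N)"
        using N unfolding kap_pow8[symmetric] by (simp add: norm_divide norm_power)
      also have "\<dots> \<le> real N * C" using C[OF N] N by simp
      finally show ?thesis by (simp add: real_sqrt_mult mult.commute)
    qed
    then show ?thesis by blast
  qed
  then obtain C where C: "\<And>k N. k \<in> S \<Longrightarrow> N \<ge> 1 \<Longrightarrow> (\<integral>a. kap N (a k) ^ 4 \<partial>law N) \<le> sqrt (C k) * sqrt (real N)"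
    by metis
  have "(\<integral>a. (2 * (\<Sum>k\<in>S. kap N (a k))) ^ 4 \<partial>law N) \<le> (16 * c * (\<Sum>k\<in>S. sqrt (C k))) * sqrt (real N)" if N: "N \<ge> 1" for N
  proof -
    interpret ens "law N" N S by (rule ens_law[OF N S])
    have i: "integrable (law N) (\<lambda>a. kap N (a k) ^ 4)" if "k \<in> S" for k
      by (intro rpbd_integrable rpbd_power kap_rpbd that)
    have "(\<integral>a. (2 * (\<Sum>k\<in>S. kap N (a k))) ^ 4 \<partial>law N) \<le> (\<integral>a. 16 * c * (\<Sum>k\<in>S. kap N (a k) ^ 4) \<partial>law N)"
    proof (rule integral_mono)
      show "integrable (law N) (\<lambda>a. (2 * (\<Sum>k\<in>S. kap N (a k))) ^ 4)"
        by (intro rpbd_integrable rpbd_power rpbd_mult rpbd_const rpbd_sum kap_rpbd)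
      show "integrable (law N) (\<lambda>a. 16 * c * (\<Sum>k\<in>S. kap N (a k) ^ 4))"
        using i by simp
      show "(2 * (\<Sum>k\<in>S. kap N (a k))) ^ 4 \<le> 16 * c * (\<Sum>k\<in>S. kap N (a k) ^ 4)" for a
        using c(2)[of "\<lambda>k. kap N (a k)"] by (simp add: power_mult_distrib mult.assoc)
    qed
    also have "\<dots> = 16 * c * (\<Sum>k\<in>S. \<integral>a. kap N (a k) ^ 4 \<partial>law N)"
      using i by (simp add: Bochner_Integration.integral_sum)
    also have "\<dots> \<le> 16 * c * (\<Sum>k\<in>S. sqrt (C k) * sqrt (real N))"
      using c(1) C N by (intro mult_left_mono sum_mono) auto
    finally show ?thesis by (simp add: sum_distrib_right mult.assoc)
  qed
  then show ?thesis by blast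
qed

definition \<Gamma> :: "'k \<times> 'l \<Rightarrow> 'k \<times> 'l \<Rightarrow> complex" where "\<Gamma> i j = \<eta> (snd i) (snd j) * \<tau> (fst i) (fst j)"
definition \<Delta> :: "'k \<times> 'l \<Rightarrow> 'k \<times> 'l \<Rightarrow> complex" where "\<Delta> i j = \<beta> (snd i) (snd j) * \<tau>c (fst i) (fst j)"

lemma cov_sym: "\<Gamma> i j = \<Gamma> j i" "\<Delta> i j = cnj (\<Delta> j i)"
  unfolding \<Gamma>_def \<Delta>_def
  using tau_sym[of "fst i" "fst j"] eta_sym[of "snd i" "snd j"] by simp_all

definition fluct :: "nat \<Rightarrow> 'k \<times> 'l \<Rightarrow> ('k \<Rightarrow> cmat) \<Rightarrow> complex" where
  "fluct N i a = mtr N (mmult N (ctr N (M N (snd i))) (cA N (fst i) a))"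

text \<open>The index is doubled by \<open>bool\<close>, \<open>True\<close> marking the adjoint
  pair, so that the sum of the traces is the real phase. \<open>q\<close> and \<open>b\<close> list
  the limits for the four combinations of original and adjoint, and their pairing collapses to
  \<open>gauss_form\<close>.\<close>

lemma charfun_limit:
  assumes F: "finite F"
    and h: "\<And>N. N \<ge> 1 \<Longrightarrow> h N \<in> borel_measurable fam_space" "\<And>N a. N \<ge> 1 \<Longrightarrow> cmod (h N a) \<le> H"
      "\<And>N U a. N \<ge> 1 \<Longrightarrow> unitary N U \<Longrightarrow> h N (cj N U a) = h N a"
  shows "(\<lambda>N. (\<integral>a. h N a * iexp (trig_phase F c (\<lambda>i. fluct N i a)) \<partial>law N)
     - of_real (exp (- gauss_form \<Gamma> \<Delta> F c / 2)) * (\<integral>a. h N a \<partial>law N)) \<longlonglongrightarrow> 0"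
proof -
  define S where "S = fst ` F"
  have S: "finite S" using F by (simp add: S_def)
  define J where "J = F \<times> (UNIV :: bool set)"
  have bs: "(\<Sum>p\<in>J. f p) = (\<Sum>i\<in>F. f (i, False) + f (i, True))" for f :: "('k \<times> 'l) \<times> bool \<Rightarrow> complex"
    using F by (simp add: J_def sum.cartesian_product' UNIV_bool)
  define B where "B N p a = (if snd p then madj (cA N (fst (fst p)) a) else cA N (fst (fst p)) a)" for N and p :: "('k \<times> 'l) \<times> bool" and a
  \<comment> \<open>The factor 1/2 is that of \<open>Re z = (z + cnj z) / 2\<close>.\<close>
  define Q0 where "Q0 N i = smm (c i / 2) (ctr N (M N (snd i)))" for N i
  define Q where "Q N p = (if snd p then madj (Q0 N (fst p)) else Q0 N (fst p))" for N p
  define b where "b p r = (let t = \<tau> (fst (fst p)) (fst (fst r)); u = \<tau>c (fst (fst p)) (fst (fst r)) in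
    if snd p then (if snd r then cnj t else cnj u) else (if snd r then u else t))" for p r :: "('k \<times> 'l) \<times> bool"
  define q where "q p r = (let t = c (fst p) * c (fst r) / 4 * \<eta> (snd (fst p)) (snd (fst r));
      u = c (fst p) * cnj (c (fst r)) / 4 * \<beta> (snd (fst p)) (snd (fst r)) in
    if snd p then (if snd r then cnj t else cnj u) else (if snd r then u else t))" for p r :: "('k \<times> 'l) \<times> bool"
  have pair: "(\<Sum>p\<in>J. mtr N (mmult N (Q N p) (B N p a))) = of_real (trig_phase F c (\<lambda>i. fluct N i a))" for N a
  proof -
    have "mtr N (mmult N (madj X) (madj Y)) = cnj (mtr N (mmult N X Y))" for X Y
      using mtr_madj[of N "mmult N Y X"] by (simp add: mtr_cyclic[of N X])
    then have "mtr N (mmult N (Q N (i, False)) (B N (i, False) a)) + mtr N (mmult N (Q N (i, True)) (B N (i, True) a))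
        = of_real (Re (c i * fluct N i a))" for i
      by (simp add: Q_def B_def Q0_def fluct_def complex_eq_iff add_divide_distrib diff_divide_distrib)
    then show ?thesis
      unfolding bs trig_phase_def by simp
  qed
  have cnj_mtr: "mtr N (mmult N (madj X) Y) = cnj (mtr N (mmult N X (madj Y)))"
     "mtr N (mmult N (madj X) (madj Y)) = cnj (mtr N (mmult N X Y))" for N X Y
    using mtr_madj[of N "mmult N X (madj Y)"] mtr_madj[of N "mmult N X Y"]
    by (simp_all add: mtr_cyclic[of N "madj X"])
  obtain CM where CM: "\<And>l N. N \<ge> 1 \<Longrightarrow> (hs N (ctr N (M N l)))\<^sup>2 \<le> CM l * real N"
    using M_hs_bound by metis
  define C where "C = (\<Sum>i\<in>F. (cmod (c i / 2))\<^sup>2 * \<bar>CM (snd i)\<bar>)"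
  obtain C' where C': "\<And>N. N \<ge> 1 \<Longrightarrow> (\<integral>a. (2 * (\<Sum>k\<in>S. kap N (a k))) ^ 4 \<partial>law N) \<le> C' * sqrt (real N)"
    using kap_bound[OF S] by blast
  have main: "(\<lambda>N. (\<integral>a. h N a * exp (\<i> * (\<Sum>p\<in>J. mtr N (mmult N (Q N p) (B N p a)))) \<partial>law N)
     - exp (- (\<Sum>p\<in>J. \<Sum>r\<in>J. q r p * b p r) / 2) * (\<integral>a. h N a \<partial>law N)) \<longlonglongrightarrow> 0"
  proof (rule charfun_convergence[where S = S and K = "\<lambda>N a. 2 * (\<Sum>k\<in>S. kap N (a k))" and C = C and C' = C' and H = H])
    show "ens (law N) N S" if "N \<ge> 1" for N by (rule ens_law[OF that S])
    show "finite J" using F by (simp add: J_def)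
    fix N :: nat assume N: "N \<ge> 1"
    interpret ens "law N" N S by (rule ens_law[OF N S])
    show "rpbd (\<lambda>a. 2 * (\<Sum>k\<in>S. kap N (a k)))" by (intro rpbd_mult rpbd_const rpbd_sum kap_rpbd)
    show "(\<integral>a. (2 * (\<Sum>k\<in>S. kap N (a k))) ^ 4 \<partial>law N) \<le> C' * sqrt (real N)" by (rule C'[OF N])
    show "h N \<in> borel_measurable fam_space" "cmod (h N a) \<le> H" for a using h N by auto
    show "h N (cj N U a) = h N a" if "unitary N U" for U a using h(3)[OF N that] .
    show "Im (\<Sum>p\<in>J. mtr N (mmult N (Q N p) (B N p a))) = 0" for a unfolding pair by simp
    fix p assume p: "p \<in> J"
    then have kS: "fst (fst p) \<in> S" and pF: "fst p \<in> F" by (auto simp: J_def S_def)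
    have cc: "cov (cA N (fst (fst p)))" using cov_ctr[OF cov_proj[OF kS]] by simp
    show "cov (B N p)" unfolding B_def using cc cov_madj[OF cc] by (cases "snd p") simp_all
    show "mtr N (B N p a) = 0" for a by (simp add: B_def)
    show "mtr N (Q N p) = 0" by (simp add: Q_def Q0_def)
    show "op_bound N (B N p a) (2 * (\<Sum>k\<in>S. kap N (a k)))" for a
    proof -
      have "op_bound N (cA N (fst (fst p)) a) (2 * kap N (a (fst (fst p))))"
        by (rule op_bound_ctr[OF op_bound_kap])
      moreover have "kap N (a (fst (fst p))) \<le> (\<Sum>k\<in>S. kap N (a k))"
        using kS S by (intro member_le_sum) auto
      ultimately have "op_bound N (cA N (fst (fst p)) a) (2 * (\<Sum>k\<in>S. kap N (a k)))"
        by (elim op_bound_mono) simp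
      then show ?thesis by (auto simp: B_def intro: op_bound_madj)
    qed
    show "(hs N (Q N p))\<^sup>2 \<le> C * real N"
    proof -
      have "(hs N (Q N p))\<^sup>2 = (cmod (c (fst p) / 2))\<^sup>2 * (hs N (ctr N (M N (snd (fst p)))))\<^sup>2"
        unfolding power_mult_distrib[symmetric] by (auto simp: Q_def Q0_def simp del: madj_lin)
      also have "\<dots> \<le> (cmod (c (fst p) / 2))\<^sup>2 * (\<bar>CM (snd (fst p))\<bar> * real N)"
        using CM[OF N, of "snd (fst p)"] by (intro mult_left_mono order_trans[OF CM[OF N]] mult_right_mono) auto
      also have "\<dots> \<le> C * real N"
        unfolding C_def mult.assoc[symmetric]
        using pF F by (intro mult_right_mono member_le_sum[where f = "\<lambda>i. (cmod (c i / 2))\<^sup>2 * \<bar>CM (snd i)\<bar>"]) auto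
      finally show ?thesis .
    qed
  next
    fix p r assume p: "p \<in> J" and r: "r \<in> J"
    have e: "\<And>l l'. (\<lambda>N. cnj (mtr N (mmult N (ctr N (M N l)) (ctr N (M N l'))) / of_nat N)) \<longlonglongrightarrow> cnj (\<eta> l l')"
      "\<And>l l'. (\<lambda>N. cnj (mtr N (mmult N (ctr N (M N l)) (madj (ctr N (M N l')))) / of_nat N)) \<longlonglongrightarrow> cnj (\<beta> l l')"
      by (intro tendsto_cnj eta_limits)+
    let ?c = "c (fst p) / 2" and ?d = "c (fst r) / 2"
    let ?X = "\<lambda>N. ctr N (M N (snd (fst p)))" and ?Y = "\<lambda>N. ctr N (M N (snd (fst r)))"
    show "(\<lambda>N. mtr N (mmult N (Q N p) (Q N r)) / of_nat N) \<longlonglongrightarrow> q p r"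
    proof -
      consider "\<not> snd p" "\<not> snd r" | "\<not> snd p" "snd r" | "snd p" "\<not> snd r" | "snd p" "snd r" by blast
      then show ?thesis
      proof cases
        case 1
        have "(\<lambda>N. ?c * ?d * (mtr N (mmult N (?X N) (?Y N)) / of_nat N)) \<longlonglongrightarrow> ?c * ?d * \<eta> (snd (fst p)) (snd (fst r))"
          by (intro tendsto_intros eta_limits)
        then show ?thesis using 1 by (simp add: Q_def Q0_def q_def mult_ac)
      next
        case 2
        have "(\<lambda>N. ?c * cnj ?d * (mtr N (mmult N (?X N) (madj (?Y N))) / of_nat N)) \<longlonglongrightarrow> ?c * cnj ?d * \<beta> (snd (fst p)) (snd (fst r))"
          by (intro tendsto_intros eta_limits)
        then show ?thesis using 2 by (simp add: Q_def Q0_def q_def mult_ac)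
      next
        case 3
        have "(\<lambda>N. cnj ?c * ?d * cnj (mtr N (mmult N (?X N) (madj (?Y N))) / of_nat N)) \<longlonglongrightarrow> cnj ?c * ?d * cnj (\<beta> (snd (fst p)) (snd (fst r)))"
          by (intro tendsto_intros e)
        then show ?thesis using 3 by (simp add: Q_def Q0_def q_def mult_ac cnj_mtr)
      next
        case 4
        have "(\<lambda>N. cnj ?c * cnj ?d * cnj (mtr N (mmult N (?X N) (?Y N)) / of_nat N)) \<longlonglongrightarrow> cnj ?c * cnj ?d * cnj (\<eta> (snd (fst p)) (snd (fst r)))"
          by (intro tendsto_intros e)
        then show ?thesis using 4 by (simp add: Q_def Q0_def q_def mult_ac cnj_mtr)
      qed
    qed
    have cm: "cmod (cnj x / of_nat N - cnj y) = cmod (x / of_nat N - y)" for x y and N :: nat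
      using complex_mod_cnj[of "x / of_nat N - y"] by simp
    show "(\<lambda>N. \<integral>a. (cmod (mtr N (mmult N (B N p a) (B N r a)) / of_nat N - b p r))\<^sup>2 \<partial>law N) \<longlonglongrightarrow> 0"
      using tau_limits[of "fst (fst p)" "fst (fst r)"]
      by (cases "snd p"; cases "snd r") (simp_all add: B_def b_def cnj_mtr cm)
  qed
  have "(\<Sum>p\<in>J. \<Sum>r\<in>J. q r p * b p r) = of_real (gauss_form \<Gamma> \<Delta> F c)"
  proof -
    \<comment> \<open>The two factors 1/2 give quarters; the four terms form two conjugate pairs,
      which add up to half of the real parts.\<close>
    have e: "c j * c i / 4 * \<eta> (snd j) (snd i) * \<tau> (fst i) (fst j) = c i * c j * \<Gamma> i j / 4"
      "c j * cnj (c i) / 4 * \<beta> (snd j) (snd i) * cnj (\<tau>c (fst i) (fst j)) = cnj (c i * cnj (c j) * \<Delta> i j) / 4"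
      "cnj (c j * cnj (c i) / 4 * \<beta> (snd j) (snd i)) * \<tau>c (fst i) (fst j) = c i * cnj (c j) * \<Delta> i j / 4"
      "cnj (c j * c i / 4 * \<eta> (snd j) (snd i)) * cnj (\<tau> (fst i) (fst j)) = cnj (c i * c j * \<Gamma> i j) / 4" for i j
      using eta_sym[of "snd i" "snd j"] by (simp_all add: \<Gamma>_def \<Delta>_def)
    have "(\<Sum>p\<in>J. \<Sum>r\<in>J. q r p * b p r) = (\<Sum>i\<in>F. \<Sum>j\<in>F. of_real (Re (c i * c j * \<Gamma> i j + c i * cnj (c j) * \<Delta> i j)) / 2)"
      unfolding bs sum.distrib[symmetric]
    proof (intro sum.cong refl)
      fix i j
      have re: "of_real (Re z) = (z + cnj z) / 2" for z by (simp add: complex_eq_iff)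
      show "q (j, False) (i, False) * b (i, False) (j, False) + q (j, True) (i, False) * b (i, False) (j, True)
          + (q (j, False) (i, True) * b (i, True) (j, False) + q (j, True) (i, True) * b (i, True) (j, True))
        = of_real (Re (c i * c j * \<Gamma> i j + c i * cnj (c j) * \<Delta> i j)) / 2"
        unfolding re q_def b_def Let_def fst_conv snd_conv if_True if_False simp_thms e
        by (simp add: field_simps)
    qed
    then show ?thesis by (simp add: gauss_form_def sum_divide_distrib)
  qed
  then have "exp (- (\<Sum>p\<in>J. \<Sum>r\<in>J. q r p * b p r) / 2) = of_real (exp (- gauss_form \<Gamma> \<Delta> F c / 2))"
    by (simp flip: exp_of_real)
  with main show ?thesis unfolding pair by simp
qed

lemma fluct_measurable: "fluct N i \<in> borel_measurable fam_space"
  unfolding fluct_def by (rule mtr_mmult_measurable) (simp_all add: cA_measurable)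

lemma gauss_form_nonneg:
  assumes F: "finite F" shows "0 \<le> gauss_form \<Gamma> \<Delta> F c"
proof -
  have "(\<lambda>N. (\<integral>a. 1 * iexp (trig_phase F c (\<lambda>i. fluct N i a)) \<partial>law N)
     - of_real (exp (- gauss_form \<Gamma> \<Delta> F c / 2)) * (\<integral>a. 1 \<partial>law N)) \<longlonglongrightarrow> 0"
    by (rule charfun_limit[OF F, where H = 1]) auto
  then have "(\<lambda>N. cmod ((\<integral>a. 1 * iexp (trig_phase F c (\<lambda>i. fluct N i a)) \<partial>law N)
     - of_real (exp (- gauss_form \<Gamma> \<Delta> F c / 2)) * (\<integral>a. 1 \<partial>law N))) \<longlonglongrightarrow> 0"
    by (rule tendsto_norm_zero)
  moreover have "\<forall>\<^sub>F N in sequentially. exp (- gauss_form \<Gamma> \<Delta> F c / 2) - 1 \<le> cmod ((\<integral>a. 1 * iexp (trig_phase F c (\<lambda>i. fluct N i a)) \<partial>law N)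
     - of_real (exp (- gauss_form \<Gamma> \<Delta> F c / 2)) * (\<integral>a. 1 \<partial>law N))"
    using eventually_ge_at_top[of 1]
  proof eventually_elim
    case (elim N)
    interpret ens "law N" N "{}" by (rule ens_law[OF elim]) simp
    have "cmod (\<integral>a. 1 * iexp (trig_phase F c (\<lambda>i. fluct N i a)) \<partial>law N) \<le> (\<integral>a. cmod (1 * iexp (trig_phase F c (\<lambda>i. fluct N i a))) \<partial>law N)"
      by (rule integral_norm_bound)
    also have "\<dots> = 1" using prob_space by simp
    finally show ?case
      using norm_triangle_ineq2[of "complex_of_real (exp (- gauss_form \<Gamma> \<Delta> F c / 2)) * (\<integral>a. 1 \<partial>law N)" "\<integral>a. 1 * iexp (trig_phase F c (\<lambda>i. fluct N i a)) \<partial>law N"] prob_space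
      by (simp add: norm_minus_commute)
  qed
  ultimately have "exp (- gauss_form \<Gamma> \<Delta> F c / 2) - 1 \<le> 0"
    by (rule tendsto_lowerbound) simp
  then show ?thesis by simp
qed

text \<open>Source of tightness for the Gaussian coordinates. Both squared norms in
  \<open>variance_bound\<close> are of order \<open>N\<close>, which its factor
  \<open>1 / (real N)\<^sup>2\<close> compensates.\<close>

lemma fluct_second_moment: "\<exists>C. \<forall>N\<ge>1. integrable (\<Omega> N) (\<lambda>\<omega>. (cmod (fluct N i (obs N \<omega>)))\<^sup>2) \<and> (\<integral>\<omega>. (cmod (fluct N i (obs N \<omega>)))\<^sup>2 \<partial>\<Omega> N) \<le> C"
proof -
  obtain k l where i: "i = (k, l)" by (cases i)
  obtain C where C: "\<And>N. N \<ge> 1 \<Longrightarrow> (\<integral>\<omega>. ((hs N (A N k \<omega>))\<^sup>2 / real N) ^ 1 \<partial>\<Omega> N) \<le> C"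
    using hs_sq_moment[of 1 k] by auto
  obtain D where D: "\<And>N. N \<ge> 1 \<Longrightarrow> (hs N (ctr N (M N l)))\<^sup>2 \<le> D * real N" using M_hs_bound by blast
  have "integrable (\<Omega> N) (\<lambda>\<omega>. (cmod (fluct N i (obs N \<omega>)))\<^sup>2) \<and> (\<integral>\<omega>. (cmod (fluct N i (obs N \<omega>)))\<^sup>2 \<partial>\<Omega> N) \<le> 2 * D * C"
    if N: "N \<ge> 1" for N
  proof -
    interpret ens "law N" N "{k}" by (rule ens_law[OF N]) simp
    have Npos: "0 < real N" using N by simp
    have D0: "0 \<le> D" using order_trans[OF zero_le_power2 D[OF N]] Npos by (simp add: zero_le_mult_iff)
    have cc: "cov (cA N k)" using cov_ctr[OF cov_proj[of k]] by simp
    have pf: "pbd (fluct N i)" unfolding fluct_def i snd_conv fst_conv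
      by (intro pbd_mtr pbd_mmult pbd_const covD(2)[OF cc])
    have m: "(\<lambda>a. (cmod (fluct N i a))\<^sup>2) \<in> borel_measurable fam_space"
      using fluct_measurable[of N i] by simp
    have "integrable (law N) (\<lambda>a. (cmod (fluct N i a))\<^sup>2)" by (intro rpbd_integrable rpbd_power rpbd_norm pf)
    then have 1: "integrable (\<Omega> N) (\<lambda>\<omega>. (cmod (fluct N i (obs N \<omega>)))\<^sup>2)"
      using integrable_law[OF N m] by simp
    have "(\<integral>\<omega>. (cmod (fluct N i (obs N \<omega>)))\<^sup>2 \<partial>\<Omega> N) = (\<integral>a. 1 * (cmod (fluct N i a))\<^sup>2 \<partial>law N)"
      using integral_law[OF N m] by simp
    also have "\<dots> \<le> 2 * (hs N (ctr N (M N l)))\<^sup>2 * (\<integral>a. 1 * (hs N (cA N k a))\<^sup>2 \<partial>law N) / (real N)\<^sup>2"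
      unfolding fluct_def i snd_conv fst_conv
      by (rule variance_bound[OF cc]) (auto simp: rpbd_const)
    also have "\<dots> \<le> 2 * (D * real N) * (C * real N) / (real N)\<^sup>2"
    proof (intro divide_right_mono mult_mono mult_left_mono D N)
      have "(\<integral>a. 1 * (hs N (cA N k a))\<^sup>2 \<partial>law N) \<le> (\<integral>a. (hs N (a k))\<^sup>2 \<partial>law N)"
      proof (rule integral_mono)
        show "integrable (law N) (\<lambda>a. 1 * (hs N (cA N k a))\<^sup>2)"
          using covD(2)[OF cc] by (intro rpbd_integrable rpbd_mult rpbd_const rpbd_hs_sq)
        show "integrable (law N) (\<lambda>a. (hs N (a k))\<^sup>2)" by (rule mom) simp
        show "1 * (hs N (cA N k a))\<^sup>2 \<le> (hs N (a k))\<^sup>2" for a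
          using power_mono[OF hs_ctr_le[of N "a k"], of 2] by simp
      qed
      also have "\<dots> = (\<integral>\<omega>. real N * ((hs N (A N k \<omega>))\<^sup>2 / real N) \<partial>\<Omega> N)"
        using Npos by (subst integral_law[OF N]) (auto simp: obs_def)
      also have "\<dots> \<le> C * real N" using C[OF N] Npos by (simp add: divide_le_eq)
      finally show "(\<integral>a. 1 * (hs N (cA N k a))\<^sup>2 \<partial>law N) \<le> C * real N" .
    qed (use D0 in auto)
    also have "\<dots> = 2 * D * C" using Npos by (simp add: power2_eq_square)
    finally show ?thesis using 1 by simp
  qed
  then show ?thesis by blast
qed

end

section \<open>Convergence of the finite-dimensional marginals\<close>

lemma integral_prod_split:
  fixes f :: "'a \<Rightarrow> complex" and g :: "'b \<Rightarrow> complex"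
  assumes P: "prob_space P" and R: "prob_space R"
    and f: "f \<in> borel_measurable P" "\<And>x. cmod (f x) \<le> c" and g: "g \<in> borel_measurable R" "\<And>x. cmod (g x) \<le> d"
  shows "(\<integral>z. f (fst z) * g (snd z) \<partial>(P \<Otimes>\<^sub>M R)) = (\<integral>x. f x \<partial>P) * (\<integral>y. g y \<partial>R)"
proof -
  interpret P: prob_space P by (rule P)
  interpret R: prob_space R by (rule R)
  interpret pr: pair_prob_space P R ..
  have m: "(\<lambda>z. f (fst z) * g (snd z)) \<in> borel_measurable (P \<Otimes>\<^sub>M R)"
    by (intro borel_measurable_times measurable_compose[OF measurable_fst f(1)] measurable_compose[OF measurable_snd g(1)])
  have "integrable (P \<Otimes>\<^sub>M R) (\<lambda>z. f (fst z) * g (snd z))"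
  proof (rule pr.P.integrable_const_bound[OF _ m, where B = "\<bar>c\<bar> * \<bar>d\<bar>"])
    show "AE z in P \<Otimes>\<^sub>M R. norm (f (fst z) * g (snd z)) \<le> \<bar>c\<bar> * \<bar>d\<bar>"
      unfolding norm_mult using f(2) g(2)
      by (intro AE_I2 mult_mono) (auto intro: order_trans[OF _ abs_ge_self])
  qed
  from pr.integral_fst'[OF this] show ?thesis by simp
qed

text \<open>A weakly convergent sequence is tight: a continuous cutoff of the norm is compared with
  its value at the limit, which is tight as a single law.\<close>

lemma fdd_conv_tight:
  fixes T :: "'i \<Rightarrow> 'b \<Rightarrow> complex"
  assumes conv: "fdd_conv \<Omega> X P T" and P: "prob_space P" and T: "T k \<in> borel_measurable P"
    and \<Omega>: "\<And>N. N \<ge> 1 \<Longrightarrow> prob_space (\<Omega> N)" and X: "\<And>N. N \<ge> 1 \<Longrightarrow> X N k \<in> borel_measurable (\<Omega> N)"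
    and e: "e > 0"
  shows "\<exists>r. \<forall>\<^sub>F N in sequentially. measure (\<Omega> N) {\<omega>\<in>space (\<Omega> N). cmod (X N k \<omega>) > r} \<le> e"
proof -
  interpret P: prob_space P by (rule P)
  obtain r where r: "P.prob {\<omega>\<in>space P. cmod (T k \<omega>) > r} \<le> e / 2"
    using P.tight_single[OF T, of "e / 2"] e by auto
  define f where "f v = min 1 (max 0 (cmod (v k) - r))" for v :: "'i \<Rightarrow> complex"
  have fc: "continuous_on UNIV f" unfolding f_def by (intro continuous_intros continuous_on_coord)
  have f01: "0 \<le> f v" "f v \<le> 1" for v by (auto simp: f_def)
  have fb: "bounded (range f)" by (rule boundedI[where B = 1]) (use f01 in auto)
  have fk: "f (restr {k} v) = f v" for v by (simp add: f_def restr_def)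
  have lim: "(\<lambda>N. \<integral>\<omega>. f (restr {k} (\<lambda>i. X N i \<omega>)) \<partial>\<Omega> N) \<longlonglongrightarrow> (\<integral>\<omega>. f (restr {k} (\<lambda>i. T i \<omega>)) \<partial>P)"
    using conv fc fb unfolding fdd_conv_def by blast
  have bound: "(\<integral>\<omega>. f (restr {k} (\<lambda>i. T i \<omega>)) \<partial>P) \<le> e / 2"
  proof -
    let ?S = "{\<omega>\<in>space P. cmod (T k \<omega>) > r}"
    have S: "?S \<in> sets P" using T by measurable
    have "(\<integral>\<omega>. f (restr {k} (\<lambda>i. T i \<omega>)) \<partial>P) \<le> (\<integral>\<omega>. indicator ?S \<omega> \<partial>P)"
    proof (rule integral_mono)
      show "integrable P (\<lambda>\<omega>. f (restr {k} (\<lambda>i. T i \<omega>)))"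
        by (rule P.integrable_const_bound[where B = 1]) (use f01 T in \<open>auto intro!: restr_measurable fc\<close>)
      show "integrable P (\<lambda>\<omega>. indicator ?S \<omega> :: real)" using S by (simp add: P.emeasure_eq_measure)
      show "f (restr {k} (\<lambda>i. T i \<omega>)) \<le> indicator ?S \<omega>" if "\<omega> \<in> space P" for \<omega>
        unfolding fk using that by (auto simp: f_def indicator_def)
    qed
    then show ?thesis using r S by simp
  qed
  have "\<forall>\<^sub>F N in sequentially. (\<integral>\<omega>. f (restr {k} (\<lambda>i. X N i \<omega>)) \<partial>\<Omega> N) < e"
    by (rule order_tendstoD(2)[OF lim]) (use bound e in linarith)
  then have "\<forall>\<^sub>F N in sequentially. measure (\<Omega> N) {\<omega>\<in>space (\<Omega> N). cmod (X N k \<omega>) > r + 1} \<le> e"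
    using eventually_ge_at_top[of "1::nat"]
  proof eventually_elim
    case (elim N)
    interpret N: prob_space "\<Omega> N" by (rule \<Omega>[OF elim(2)])
    let ?S = "{\<omega>\<in>space (\<Omega> N). cmod (X N k \<omega>) > r + 1}"
    have S: "?S \<in> sets (\<Omega> N)" using X[OF elim(2)] by measurable
    have "measure (\<Omega> N) ?S = (\<integral>\<omega>. indicator ?S \<omega> \<partial>\<Omega> N)" using S by simp
    also have "\<dots> \<le> (\<integral>\<omega>. f (restr {k} (\<lambda>i. X N i \<omega>)) \<partial>\<Omega> N)"
    proof (rule integral_mono)
      show "integrable (\<Omega> N) (\<lambda>\<omega>. f (restr {k} (\<lambda>i. X N i \<omega>)))"
        by (rule N.integrable_const_bound[where B = 1]) (use f01 X[OF elim(2)] in \<open>auto intro!: restr_measurable fc\<close>)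
      show "integrable (\<Omega> N) (\<lambda>\<omega>. indicator ?S \<omega> :: real)" using S by (simp add: N.emeasure_eq_measure)
      show "indicator ?S \<omega> \<le> f (restr {k} (\<lambda>i. X N i \<omega>))" for \<omega>
        unfolding fk by (auto simp: f_def indicator_def)
    qed
    finally show ?case using elim(1) by linarith
  qed
  then show ?thesis by blast
qed

lemma (in prob_space) tight_second_moment:
  fixes Y :: "'a \<Rightarrow> complex"
  assumes Y: "integrable M (\<lambda>\<omega>. (cmod (Y \<omega>))\<^sup>2)" "Y \<in> borel_measurable M"
    and C: "(\<integral>\<omega>. (cmod (Y \<omega>))\<^sup>2 \<partial>M) \<le> C" and r: "r > 0" "C \<le> e * r\<^sup>2"
  shows "prob {\<omega>\<in>space M. cmod (Y \<omega>) > r} \<le> e"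
proof -
  have "prob {\<omega>\<in>space M. cmod (Y \<omega>) > r} \<le> prob {\<omega>\<in>space M. (cmod (Y \<omega>))\<^sup>2 \<ge> r\<^sup>2}"
  proof (rule finite_measure_mono)
    show "{\<omega>\<in>space M. cmod (Y \<omega>) > r} \<subseteq> {\<omega>\<in>space M. (cmod (Y \<omega>))\<^sup>2 \<ge> r\<^sup>2}"
      using r(1) by (auto intro!: power_mono)
    show "{\<omega>\<in>space M. (cmod (Y \<omega>))\<^sup>2 \<ge> r\<^sup>2} \<in> sets M" using Y(2) by measurable
  qed
  also have "\<dots> \<le> (\<integral>\<omega>. (cmod (Y \<omega>))\<^sup>2 \<partial>M) / r\<^sup>2"
    by (rule integral_Markov_inequality_measure[where A = "{}"]) (use Y(1) r in auto)
  also have "\<dots> \<le> e" using C r by (simp add: divide_le_eq)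
  finally show ?thesis .
qed

lemma tendsto_fun_family:
  fixes f :: "nat \<Rightarrow> 'i \<Rightarrow> complex"
  assumes "\<And>i. (\<lambda>n. f n i) \<longlonglongrightarrow> l i" shows "f \<longlonglongrightarrow> l"
proof -
  have "limitin (product_topology (\<lambda>_. euclidean) UNIV) f l sequentially"
    unfolding limitin_componentwise using assms by (simp add: limitin_canonical_iff)
  then show ?thesis by (simp add: euclidean_product_topology limitin_canonical_iff)
qed

context rm_model
begin

text \<open>Both matrices split into a centred and a scalar part, and the mixed traces vanish. After
  subtracting means the identity is still exact, because the centred part has mean zero.\<close>

lemma trace_decomposition:
  assumes N: "N \<ge> 1"
  shows "mtr N (mmult N (A N k \<omega>) (M N l)) - (\<integral>\<omega>'. mtr N (mmult N (A N k \<omega>') (M N l)) \<partial>\<Omega> N)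
    = fluct N (k, l) (obs N \<omega>) + mtr N (M N l) / of_nat N * (mtr N (A N k \<omega>) - (\<integral>\<omega>'. mtr N (A N k \<omega>') \<partial>\<Omega> N))"
proof -
  interpret ens "law N" N "{k}" by (rule ens_law[OF N]) simp
  have cp: "cov (\<lambda>a. msk N (a k))" by (rule cov_proj) simp
  have f: "fluct N (k, l) a = mtr N (mmult N (ctr N (M N l)) (ctr N (msk N (a k))))" for a
    by (simp add: fluct_def)
  have d: "mtr N (mmult N (A N k \<omega>) (M N l)) = fluct N (k, l) (obs N \<omega>) + mtr N (M N l) / of_nat N * mtr N (A N k \<omega>)" for \<omega>
    using mtr_ctr_mmult[OF N, of "M N l" "A N k \<omega>"] by (simp add: fluct_def obs_def mtr_cyclic[of N "A N k \<omega>"])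
  have pf: "pbd (fluct N (k, l))" unfolding f[abs_def]
    by (intro pbd_mtr pbd_mmult pbd_const covD(2)[OF cov_ctr[OF cp]])
  have pt: "pbd (\<lambda>a. mtr N (msk N (a k)))" by (intro pbd_mtr covD(2)[OF cp])
  have i: "integrable (\<Omega> N) (\<lambda>\<omega>. fluct N (k, l) (obs N \<omega>))" "integrable (\<Omega> N) (\<lambda>\<omega>. mtr N (A N k \<omega>))"
    using pbd_integrable[OF pf] pbd_integrable[OF pt] integrable_law[OF N pbd_meas[OF pf]] integrable_law[OF N pbd_meas[OF pt]]
    by (simp_all add: obs_def)
  have "(\<integral>\<omega>. fluct N (k, l) (obs N \<omega>) \<partial>\<Omega> N) = 0"
    using integral_law[OF N pbd_meas[OF pf]] expectation_mtr_ctr_zero[OF cp, of "ctr N (M N l)"] by (simp add: f)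
  then have "(\<integral>\<omega>'. mtr N (mmult N (A N k \<omega>') (M N l)) \<partial>\<Omega> N) = mtr N (M N l) / of_nat N * (\<integral>\<omega>'. mtr N (A N k \<omega>') \<partial>\<Omega> N)"
    unfolding d using i by simp
  then show ?thesis unfolding d by (simp add: algebra_simps)
qed

lemma mtr_measurable: "(\<lambda>a. mtr N (a k)) \<in> borel_measurable (fam_space :: ('k \<Rightarrow> cmat) measure)"
  unfolding mtr_def by measurable

text \<open>The centred parts, the centred traces and the normalised traces of \<open>M\<close>
  converge jointly, and the continuous map \<open>ev\<close> recombines them. The product measure
  \<open>P \<Otimes>\<^sub>M R\<close> carries the independence.\<close>

theorem fdd_limit:
  fixes P :: "'b measure" and T :: "'k \<Rightarrow> 'b \<Rightarrow> complex" and \<alpha> :: "'l \<Rightarrow> complex"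
  assumes probP: "prob_space P"
    and T_centered: "\<And>k. integrable P (T k) \<and> (\<integral>x. T k x \<partial>P) = 0"
    and e_T: "fdd_conv \<Omega> (\<lambda>N k \<omega>. mtr N (A N k \<omega>) - (\<integral>\<omega>'. mtr N (A N k \<omega>') \<partial>\<Omega> N)) P T"
    and e_alpha: "\<And>l. (\<lambda>N. mtr N (M N l) / of_nat N) \<longlonglongrightarrow> \<alpha> l"
    and R: "sets R = sets (PiM UNIV (\<lambda>_. borel :: complex measure))" "prob_space R"
    and ch: "\<And>F c. finite F \<Longrightarrow> (\<integral>g. iexp (trig_phase F c g) \<partial>R) = of_real (exp (- gauss_form \<Gamma> \<Delta> F c / 2))"
  shows "fdd_conv \<Omega>
       (\<lambda>N kl \<omega>. mtr N (mmult N (A N (fst kl) \<omega>) (M N (snd kl)))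
                 - (\<integral>\<omega>'. mtr N (mmult N (A N (fst kl) \<omega>') (M N (snd kl))) \<partial>\<Omega> N))
       (P \<Otimes>\<^sub>M R) (\<lambda>kl xg. snd xg kl + \<alpha> (snd kl) * T (fst kl) (fst xg))"
  unfolding fdd_conv_def
proof (intro allI impI)
  fix F :: "('k \<times> 'l) set" and f :: "('k \<times> 'l \<Rightarrow> complex) \<Rightarrow> real"
  assume F: "finite F" and fc: "continuous_on UNIV f" and fb: "bounded (range f)"
  let ?X = "\<lambda>N \<omega> kl. mtr N (mmult N (A N (fst kl) \<omega>) (M N (snd kl)))
    - (\<integral>\<omega>'. mtr N (mmult N (A N (fst kl) \<omega>') (M N (snd kl))) \<partial>\<Omega> N)"
  interpret P: prob_space P by (rule probP)
  interpret R: prob_space R by (rule R)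
  interpret PR: pair_prob_space P R ..
  define t where "t N k a = mtr N (a k) - (\<integral>\<omega>'. mtr N (A N k \<omega>') \<partial>\<Omega> N)" for N k and a :: "'k \<Rightarrow> cmat"
  define al where "al N l = mtr N (M N l) / of_nat N" for N l
  \<comment> \<open>The deterministic normalised traces of \<open>M\<close> are carried along as coordinates, which replaces Slutsky's lemma.\<close>
  define W where "W N i a = (case i of Inl kl \<Rightarrow> fluct N kl a | Inr (Inl k) \<Rightarrow> t N k a | Inr (Inr l) \<Rightarrow> al N l)" for N i and a :: "'k \<Rightarrow> cmat"
  define Y where "Y i xg = (case i of Inl kl \<Rightarrow> snd xg kl | Inr (Inl k) \<Rightarrow> T k (fst xg) | Inr (Inr l) \<Rightarrow> \<alpha> l)" for i and xg :: "'b \<times> ('k \<times> 'l \<Rightarrow> complex)"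
  define S where "S = fst ` F"
  define L where "L = snd ` F"
  define FF :: "('k \<times> 'l + 'k + 'l) set" where "FF = Inl ` F \<union> Inr ` (Inl ` S \<union> Inr ` L)"
  define GG :: "('k \<times> 'l + 'k + 'l) set" where "GG = Inl ` F"
  \<comment> \<open>Products suffice and match what is known: \<open>e_T\<close> handles functions
    of the traces alone, and the factor in the deterministic coordinates can be taken out of the
    expectation.\<close>
  define \<H> where "\<H> = {(\<lambda>v :: ('k \<times> 'l + 'k + 'l) \<Rightarrow> complex. h (\<lambda>k. v (Inr (Inl k))) * \<kappa> (\<lambda>l. v (Inr (Inr l)))) | h \<kappa>.
     continuous_on UNIV (h :: ('k \<Rightarrow> complex) \<Rightarrow> real) \<and> bounded (range h) \<and>
     continuous_on UNIV (\<kappa> :: ('l \<Rightarrow> complex) \<Rightarrow> real) \<and> bounded (range \<kappa>)}"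
  define ev where "ev v = restr F (\<lambda>kl. v (Inl kl) + v (Inr (Inr (snd kl))) * v (Inr (Inl (fst kl))))" for v :: "('k \<times> 'l + 'k + 'l) \<Rightarrow> complex"
  have fin: "finite FF" "GG \<subseteq> FF" using F by (auto simp: FF_def GG_def S_def L_def)
  have W_meas: "W N i \<in> borel_measurable fam_space" for N i
  proof -
    have "(\<lambda>a. W N i a) \<in> borel_measurable fam_space"
      unfolding W_def t_def
      by (cases i; (cases "projr i")?) (auto intro: fluct_measurable borel_measurable_diff mtr_measurable split: sum.split)
    then show ?thesis by simp
  qed
  have X_meas: "(\<lambda>\<omega>. W N i (obs N \<omega>)) \<in> borel_measurable (\<Omega> N)" if "N \<ge> 1" for N i
    by (rule measurable_compose[OF obs_measurable[OF that] W_meas])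
  have g_meas: "(\<lambda>g. g i) \<in> borel_measurable R" for i
    unfolding measurable_cong_sets[OF R(1) refl] by (rule measurable_component_singleton) simp
  have T_meas: "T k \<in> borel_measurable P" for k
    using T_centered[of k] by (intro borel_measurable_integrable) simp
  have Y_meas: "Y i \<in> borel_measurable (P \<Otimes>\<^sub>M R)" for i
  proof -
    have "(\<lambda>z. Y i z) \<in> borel_measurable (P \<Otimes>\<^sub>M R)"
      unfolding Y_def
      by (cases i; (cases "projr i")?)
         (auto intro: measurable_compose[OF measurable_snd g_meas] measurable_compose[OF measurable_fst T_meas] split: sum.split)
    then show ?thesis by simp
  qed
  have ev_cont: "continuous_on UNIV ev"
  proof (rule continuous_on_fun_family)
    show "continuous_on UNIV (\<lambda>v. ev v i)" for i
      unfolding ev_def restr_def by (cases "i \<in> F") (auto intro!: continuous_intros continuous_on_coord)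
  qed
  have t_obs: "t N k (obs N \<omega>) = mtr N (A N k \<omega>) - (\<integral>\<omega>'. mtr N (A N k \<omega>') \<partial>\<Omega> N)" for N k \<omega>
    by (simp add: t_def obs_def)
  have res: "restr FF v (Inl kl) = v (Inl kl)" "restr FF v (Inr (Inl (fst kl))) = v (Inr (Inl (fst kl)))"
     "restr FF v (Inr (Inr (snd kl))) = v (Inr (Inr (snd kl)))" if "kl \<in> F" for v kl
    using that by (auto simp: restr_def FF_def S_def L_def)
  have ev_res: "ev (restr FF v) = ev v" for v
    unfolding ev_def by (rule ext) (simp add: restr_def[of F] res)
  have tr_split: "trig_phase GG c v = trig_phase F (\<lambda>i. c (Inl i)) (\<lambda>i. v (Inl i))" for c v
    unfolding trig_phase_def GG_def by (subst sum.reindex) (auto simp: inj_on_def)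
  have restr_parts: "(\<lambda>k. restr FF v (Inr (Inl k))) = restr S (\<lambda>k. v (Inr (Inl k)))"
     "(\<lambda>l. restr FF v (Inr (Inr l))) = restr L (\<lambda>l. v (Inr (Inr l)))" for v
    by (auto simp: restr_def FF_def fun_eq_iff)
  have "(\<lambda>N. \<integral>\<omega>. (f \<circ> ev) (restr FF (\<lambda>i. W N i (obs N \<omega>))) \<partial>\<Omega> N) \<longlonglongrightarrow> (\<integral>z. (f \<circ> ev) (restr FF (\<lambda>i. Y i z)) \<partial>(P \<Otimes>\<^sub>M R))"
  proof (rule weak_convergence_trig[where \<H> = \<H> and G = GG and X = "\<lambda>N i \<omega>. W N i (obs N \<omega>)", OF fin prob X_meas])
    show "prob_space (P \<Otimes>\<^sub>M R)" by (rule PR.P.prob_space_axioms)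
    show "Y i \<in> borel_measurable (P \<Otimes>\<^sub>M R)" for i by (rule Y_meas)
    show "continuous_on UNIV (f \<circ> ev)"
      by (rule continuous_on_compose[OF ev_cont]) (rule continuous_on_subset[OF fc subset_UNIV])
    show "bounded (range (f \<circ> ev))" by (rule bounded_subset[OF fb]) auto
    show "(\<lambda>_. c) \<in> \<H>" for c
      unfolding \<H>_def by (rule CollectI, rule exI[of _ "\<lambda>_. c"], rule exI[of _ "\<lambda>_. 1"]) auto
    show "continuous_on UNIV p" if pH: "p \<in> \<H>" for p
    proof -
      obtain h \<kappa> where p: "p = (\<lambda>v. h (\<lambda>k. v (Inr (Inl k))) * \<kappa> (\<lambda>l. v (Inr (Inr l))))"
        and c: "continuous_on UNIV h" "continuous_on UNIV \<kappa>" using pH unfolding \<H>_def by blast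
      show ?thesis unfolding p
        by (intro continuous_on_mult continuous_on_compose2[OF c(1)] continuous_on_compose2[OF c(2)]
            continuous_on_fun_family continuous_on_coord subset_UNIV)
    qed
    have bmult: "bounded (range (\<lambda>v. p (u v) * q (w v)))" if pb: "bounded (range p)" and qb: "bounded (range q)"
      for p :: "'x \<Rightarrow> real" and q :: "'y \<Rightarrow> real" and u :: "'z \<Rightarrow> 'x" and w :: "'z \<Rightarrow> 'y"
    proof -
      obtain a b where ab: "\<And>x. \<bar>p x\<bar> \<le> a" "\<And>x. \<bar>q x\<bar> \<le> b"
        using pb qb unfolding bounded_iff by auto
      have "\<bar>p (u v) * q (w v)\<bar> \<le> a * b" for v
        unfolding abs_mult using ab(1)[of "u v"] ab(2)[of "w v"] by (intro mult_mono) auto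
      then show ?thesis by (intro boundedI[where B = "a * b"]) auto
    qed
    show "bounded (range p)" if pH: "p \<in> \<H>" for p
    proof -
      obtain h \<kappa> where p: "p = (\<lambda>v. h (\<lambda>k. v (Inr (Inl k))) * \<kappa> (\<lambda>l. v (Inr (Inr l))))"
        and c: "bounded (range h)" "bounded (range \<kappa>)" using pH unfolding \<H>_def by blast
      show ?thesis unfolding p by (rule bmult[OF c])
    qed
    show "(\<lambda>v. p v * q v) \<in> \<H>" if "p \<in> \<H>" "q \<in> \<H>" for p q
    proof -
      obtain h \<kappa> where p: "p = (\<lambda>v. h (\<lambda>k. v (Inr (Inl k))) * \<kappa> (\<lambda>l. v (Inr (Inr l))))"
        and c: "continuous_on UNIV h" "continuous_on UNIV \<kappa>" "bounded (range h)" "bounded (range \<kappa>)"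
        using \<open>p \<in> \<H>\<close> unfolding \<H>_def by blast
      obtain h' \<kappa>' where q: "q = (\<lambda>v. h' (\<lambda>k. v (Inr (Inl k))) * \<kappa>' (\<lambda>l. v (Inr (Inr l))))"
        and c': "continuous_on UNIV h'" "continuous_on UNIV \<kappa>'" "bounded (range h')" "bounded (range \<kappa>')"
        using \<open>q \<in> \<H>\<close> unfolding \<H>_def by blast
      show ?thesis unfolding \<H>_def
      proof (rule CollectI, rule exI[of _ "\<lambda>v. h v * h' v"], rule exI[of _ "\<lambda>v. \<kappa> v * \<kappa>' v"], intro conjI)
        show "continuous_on UNIV (\<lambda>v. h v * h' v)" "continuous_on UNIV (\<lambda>v. \<kappa> v * \<kappa>' v)"
          by (intro continuous_on_mult c c')+
        show "bounded (range (\<lambda>v. h v * h' v))" "bounded (range (\<lambda>v. \<kappa> v * \<kappa>' v))"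
          using bmult[OF c(3) c'(3), of "\<lambda>v. v" "\<lambda>v. v"] bmult[OF c(4) c'(4), of "\<lambda>v. v" "\<lambda>v. v"] by auto
      qed (auto simp: p q)
    qed
    show "\<exists>p\<in>\<H>. p v \<noteq> p w" if i: "i \<in> FF - GG" "v i \<noteq> w i" for v w i
    proof -
      \<comment> \<open>Real and imaginary parts under \<open>arctan\<close>: bounded, continuous
        and injective, hence separating.\<close>
      have at: "continuous_on UNIV (\<lambda>v. arctan (Re (v j)))" "continuous_on UNIV (\<lambda>v. arctan (Im (v j)))"
        "bounded (range (\<lambda>v. arctan (Re (v j))))" "bounded (range (\<lambda>v. arctan (Im (v j))))" for j :: 'j
      proof -
        show "continuous_on UNIV (\<lambda>v. arctan (Re (v j)))" "continuous_on UNIV (\<lambda>v. arctan (Im (v j)))"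
          by (intro continuous_intros continuous_on_coord)+
        have "\<bar>arctan x\<bar> \<le> pi / 2" for x using arctan_bounded[of x] by auto
        then show "bounded (range (\<lambda>v. arctan (Re (v j))))" "bounded (range (\<lambda>v. arctan (Im (v j))))"
          by (auto intro!: boundedI[where B = "pi / 2"])
      qed
      have one: "continuous_on UNIV (\<lambda>_. 1 :: real)" "bounded (range (\<lambda>_ :: 'j \<Rightarrow> complex. 1 :: real))" for j :: 'j by auto
      have k: "(\<lambda>v. h (\<lambda>k. v (Inr (Inl k)))) \<in> \<H>" if "continuous_on UNIV h" "bounded (range h)" for h
        unfolding \<H>_def by (rule CollectI, rule exI[of _ h], rule exI[of _ "\<lambda>_. 1"]) (use that in auto)
      have l: "(\<lambda>v. \<kappa> (\<lambda>l. v (Inr (Inr l)))) \<in> \<H>" if "continuous_on UNIV \<kappa>" "bounded (range \<kappa>)" for \<kappa>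
        unfolding \<H>_def by (rule CollectI, rule exI[of _ "\<lambda>_. 1"], rule exI[of _ \<kappa>]) (use that in auto)
      have ne: "arctan (Re (v i)) \<noteq> arctan (Re (w i)) \<or> arctan (Im (v i)) \<noteq> arctan (Im (w i))"
        using i(2) by (simp add: arctan_eq_iff complex_eq_iff)
      consider (K) j where "i = Inr (Inl j)" | (L) j where "i = Inr (Inr j)"
        using i(1) by (auto simp: FF_def GG_def)
      then show ?thesis
      proof cases
        case (K j)
        have "(\<lambda>v. arctan (Re (v (Inr (Inl j))))) \<in> \<H>" "(\<lambda>v. arctan (Im (v (Inr (Inl j))))) \<in> \<H>"
          using k[OF at(1,3)[of j]] k[OF at(2,4)[of j]] by simp_all
        then show ?thesis using ne K by (metis (no_types, lifting))
      next
        case (L j)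
        have "(\<lambda>v. arctan (Re (v (Inr (Inr j))))) \<in> \<H>" "(\<lambda>v. arctan (Im (v (Inr (Inr j))))) \<in> \<H>"
          using l[OF at(1,3)[of j]] l[OF at(2,4)[of j]] by simp_all
        then show ?thesis using ne L by (metis (no_types, lifting))
      qed
    qed
    show "\<exists>r. \<forall>\<^sub>F N in sequentially. measure (\<Omega> N) {\<omega>\<in>space (\<Omega> N). cmod (W N i (obs N \<omega>)) > r} \<le> e"
      if "i \<in> FF" and e: "e > 0" for i and e :: real
    proof (cases i)
      case (Inl kl)
      obtain C where C: "\<And>N. N \<ge> 1 \<Longrightarrow> integrable (\<Omega> N) (\<lambda>\<omega>. (cmod (fluct N kl (obs N \<omega>)))\<^sup>2)"
        "\<And>N. N \<ge> 1 \<Longrightarrow> (\<integral>\<omega>. (cmod (fluct N kl (obs N \<omega>)))\<^sup>2 \<partial>\<Omega> N) \<le> C"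
        using fluct_second_moment[of kl] by blast
      \<comment> \<open>Chebyshev radius; the summand 1 keeps it positive when \<open>C\<close> is
        0.\<close>
      define r where "r = sqrt (\<bar>C\<bar> / e + 1)"
      have r: "r > 0" "C \<le> e * r\<^sup>2"
      proof -
        have pos: "0 < \<bar>C\<bar> / e + 1" using e by (intro add_nonneg_pos divide_nonneg_pos) auto
        then show "r > 0" by (simp add: r_def)
        have "e * r\<^sup>2 = \<bar>C\<bar> + e" using e pos by (simp add: r_def distrib_left)
        then show "C \<le> e * r\<^sup>2" using e by linarith
      qed
      have "\<forall>\<^sub>F N in sequentially. measure (\<Omega> N) {\<omega>\<in>space (\<Omega> N). cmod (W N i (obs N \<omega>)) > r} \<le> e"
        using eventually_ge_at_top[of 1]
      proof eventually_elim
        case (elim N)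
        show ?case
          using prob_space.tight_second_moment[OF prob[OF elim] C(1)[OF elim] _ C(2)[OF elim] r]
            measurable_compose[OF obs_measurable[OF elim] fluct_measurable[of N kl]]
          by (simp add: W_def Inl)
      qed
      then show ?thesis by blast
    next
      case (Inr j)
      show ?thesis
      proof (cases j)
        case (Inl k)
        have m: "(\<lambda>\<omega>. mtr N (A N k \<omega>) - (\<integral>\<omega>'. mtr N (A N k \<omega>') \<partial>\<Omega> N)) \<in> borel_measurable (\<Omega> N)" if "N \<ge> 1" for N
          using X_meas[OF that, of "Inr (Inl k)"] by (simp add: W_def t_obs)
        show ?thesis
          using fdd_conv_tight[where k = k, OF e_T probP T_meas prob m e] by (simp add: W_def Inr Inl t_obs)
      next
        case (Inr l)
        \<comment> \<open>This coordinate is deterministic, so the event beyond its bound is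
          empty.\<close>
        obtain C where C: "\<And>N. cmod (al N l) \<le> C"
          using convergent_imp_Bseq[OF convergentI[OF e_alpha[of l]]] by (auto simp: Bseq_def al_def)
        have "{\<omega>\<in>space (\<Omega> N). cmod (W N i (obs N \<omega>)) > C} = {}" for N
          using C[of N] by (auto simp: W_def \<open>i = Inr j\<close> Inr not_less)
        then show ?thesis using e by (intro exI[of _ C]) (auto intro!: always_eventually simp del: Collect_empty_eq)
      qed
    qed
    show "(\<lambda>N. \<integral>\<omega>. complex_of_real (p (restr FF (\<lambda>i. W N i (obs N \<omega>)))) * iexp (trig_phase GG c (\<lambda>i. W N i (obs N \<omega>))) \<partial>\<Omega> N)
        \<longlonglongrightarrow> (\<integral>z. complex_of_real (p (restr FF (\<lambda>i. Y i z))) * iexp (trig_phase GG c (\<lambda>i. Y i z)) \<partial>(P \<Otimes>\<^sub>M R))"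
      if p: "p \<in> \<H>" for p c
    proof -
      obtain h \<kappa> where p: "p = (\<lambda>v. h (\<lambda>k. v (Inr (Inl k))) * \<kappa> (\<lambda>l. v (Inr (Inr l))))"
        and hk: "continuous_on UNIV h" "bounded (range h)" "continuous_on UNIV \<kappa>" "bounded (range \<kappa>)"
        using p unfolding \<H>_def by blast
      obtain bh where bh: "\<And>x. \<bar>h x\<bar> \<le> bh" using hk(2) by (auto simp: bounded_iff)
      obtain bk where bk: "\<And>x. \<bar>\<kappa> x\<bar> \<le> bk" using hk(4) by (auto simp: bounded_iff)
      let ?c = "\<lambda>i. c (Inl i)"
      have finS: "finite S" using F by (simp add: S_def)
      \<comment> \<open>A function of traces, hence invariant under conjugation and admissible as a
        weight in \<open>charfun_limit\<close>.\<close>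
      define h' where "h' N a = complex_of_real (h (restr S (\<lambda>k. t N k a)) * \<kappa> (restr L (al N)))" for N a
      define ex where "ex = complex_of_real (exp (- gauss_form \<Gamma> \<Delta> F ?c / 2))"
      have hm: "(\<lambda>a. h (restr S (\<lambda>k. t N k a))) \<in> borel_measurable fam_space" for N
        by (rule restr_measurable[OF finS _ hk(1)]) (auto simp: t_def intro!: borel_measurable_diff mtr_measurable)
      have h'm: "h' N \<in> borel_measurable fam_space" for N
        unfolding h'_def by (intro measurable_compose[OF _ borel_measurable_of_real] borel_measurable_times hm borel_measurable_const)
      have lim0: "(\<lambda>N. (\<integral>a. h' N a * iexp (trig_phase F ?c (\<lambda>i. fluct N i a)) \<partial>law N) - ex * (\<integral>a. h' N a \<partial>law N)) \<longlonglongrightarrow> 0"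
        unfolding ex_def
      proof (rule charfun_limit[OF F, where H = "bh * bk"])
        show "h' N \<in> borel_measurable fam_space" for N by (rule h'm)
        show "cmod (h' N a) \<le> bh * bk" for N a
          unfolding h'_def norm_of_real abs_mult by (intro mult_mono bh bk abs_ge_zero order_trans[OF abs_ge_zero bh])
        show "h' N (cj N U a) = h' N a" if "unitary N U" for N U a
          unfolding h'_def t_def cj_def mmult_assoc mtr_conj[OF that] ..
      qed
      have hlim: "(\<lambda>N. \<integral>\<omega>. h (restr S (\<lambda>k. t N k (obs N \<omega>))) \<partial>\<Omega> N) \<longlonglongrightarrow> (\<integral>x. h (restr S (\<lambda>k. T k x)) \<partial>P)"
        using e_T finS hk(1,2) unfolding fdd_conv_def t_obs by blast
      have klim: "(\<lambda>N. \<kappa> (restr L (al N))) \<longlonglongrightarrow> \<kappa> (restr L \<alpha>)"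
      proof -
        have "(\<lambda>N. restr L (al N)) \<longlonglongrightarrow> restr L \<alpha>"
        proof (rule tendsto_fun_family)
          show "(\<lambda>N. restr L (al N) l) \<longlonglongrightarrow> restr L \<alpha> l" for l
            using e_alpha[of l] by (cases "l \<in> L") (simp_all add: restr_def al_def)
        qed
        then show ?thesis
          by (rule continuous_on_tendsto_compose[OF hk(3)]) auto
      qed
      have mean: "(\<lambda>N. \<integral>a. h' N a \<partial>law N) \<longlonglongrightarrow> of_real ((\<integral>x. h (restr S (\<lambda>k. T k x)) \<partial>P) * \<kappa> (restr L \<alpha>))"
      proof (rule Lim_transform_eventually[OF tendsto_of_real[OF tendsto_mult[OF hlim klim]]], use eventually_ge_at_top[of 1] in eventually_elim)
        case (elim N)
        show ?case unfolding integral_law[OF elim h'm] unfolding h'_def integral_complex_of_real by simp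
      qed
      have "(\<lambda>N. \<integral>a. h' N a * iexp (trig_phase F ?c (\<lambda>i. fluct N i a)) \<partial>law N)
         \<longlonglongrightarrow> 0 + ex * of_real ((\<integral>x. h (restr S (\<lambda>k. T k x)) \<partial>P) * \<kappa> (restr L \<alpha>))"
        using tendsto_add[OF lim0 tendsto_mult[OF tendsto_const[of ex] mean]] by simp
      moreover have "0 + ex * of_real ((\<integral>x. h (restr S (\<lambda>k. T k x)) \<partial>P) * \<kappa> (restr L \<alpha>))
         = (\<integral>z. complex_of_real (p (restr FF (\<lambda>i. Y i z))) * iexp (trig_phase GG c (\<lambda>i. Y i z)) \<partial>(P \<Otimes>\<^sub>M R))"
      proof -
        have "(\<integral>z. complex_of_real (p (restr FF (\<lambda>i. Y i z))) * iexp (trig_phase GG c (\<lambda>i. Y i z)) \<partial>(P \<Otimes>\<^sub>M R))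
          = (\<integral>z. complex_of_real (h (restr S (\<lambda>k. T k (fst z))) * \<kappa> (restr L \<alpha>)) * iexp (trig_phase F ?c (snd z)) \<partial>(P \<Otimes>\<^sub>M R))"
          unfolding p restr_parts tr_split by (simp add: Y_def)
        also have "\<dots> = (\<integral>x. complex_of_real (h (restr S (\<lambda>k. T k x)) * \<kappa> (restr L \<alpha>)) \<partial>P) * (\<integral>g. iexp (trig_phase F ?c g) \<partial>R)"
        proof (rule integral_prod_split[OF probP R(2), where c = "bh * bk" and d = 1])
          show "(\<lambda>x. complex_of_real (h (restr S (\<lambda>k. T k x)) * \<kappa> (restr L \<alpha>))) \<in> borel_measurable P"
            by (intro measurable_compose[OF _ borel_measurable_of_real] borel_measurable_times borel_measurable_const
                restr_measurable finS hk T_meas)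
          show "cmod (complex_of_real (h (restr S (\<lambda>k. T k x)) * \<kappa> (restr L \<alpha>))) \<le> bh * bk" for x
            unfolding norm_of_real abs_mult by (intro mult_mono bh bk abs_ge_zero order_trans[OF abs_ge_zero bh])
          show "(\<lambda>g. iexp (trig_phase F ?c g)) \<in> borel_measurable R"
            using trig_phase_measurable[of F "\<lambda>i g. g i" R ?c] g_meas by simp
        qed simp
        also have "\<dots> = ex * of_real ((\<integral>x. h (restr S (\<lambda>k. T k x)) \<partial>P) * \<kappa> (restr L \<alpha>))"
          unfolding integral_complex_of_real ch[OF F] ex_def by simp
        finally show ?thesis by simp
      qed
      ultimately have lim: "(\<lambda>N. \<integral>a. h' N a * iexp (trig_phase F ?c (\<lambda>i. fluct N i a)) \<partial>law N)
         \<longlonglongrightarrow> (\<integral>z. complex_of_real (p (restr FF (\<lambda>i. Y i z))) * iexp (trig_phase GG c (\<lambda>i. Y i z)) \<partial>(P \<Otimes>\<^sub>M R))" by simp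
      show ?thesis
      proof (rule Lim_transform_eventually[OF lim], use eventually_ge_at_top[of 1] in eventually_elim)
        case (elim N)
        have m: "(\<lambda>a. h' N a * iexp (trig_phase F ?c (\<lambda>i. fluct N i a))) \<in> borel_measurable fam_space"
          using h'm[of N] trig_phase_measurable[of F "fluct N" fam_space ?c] fluct_measurable[of N] by simp
        show ?case
          unfolding integral_law[OF elim m] p restr_parts tr_split by (simp add: h'_def W_def)
      qed
    qed
  qed
  moreover have "\<forall>\<^sub>F N in sequentially. (\<integral>\<omega>. (f \<circ> ev) (restr FF (\<lambda>i. W N i (obs N \<omega>))) \<partial>\<Omega> N)
     = (\<integral>\<omega>. f (restr F (?X N \<omega>)) \<partial>\<Omega> N)"
    using eventually_ge_at_top[of 1]
  proof eventually_elim
    case (elim N)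
    have "ev (\<lambda>i. W N i (obs N \<omega>)) = restr F (?X N \<omega>)" for \<omega>
      unfolding trace_decomposition[OF elim] ev_def by (simp add: W_def t_obs al_def)
    then show ?case by (simp add: ev_res)
  qed
  ultimately have "(\<lambda>N. \<integral>\<omega>. f (restr F (?X N \<omega>)) \<partial>\<Omega> N)
      \<longlonglongrightarrow> (\<integral>z. (f \<circ> ev) (restr FF (\<lambda>i. Y i z)) \<partial>(P \<Otimes>\<^sub>M R))"
    by (rule Lim_transform_eventually)
  then show "(\<lambda>N. \<integral>\<omega>. f (restr F (?X N \<omega>)) \<partial>\<Omega> N)
      \<longlonglongrightarrow> (\<integral>z. f (restr F (\<lambda>kl. snd z kl + \<alpha> (snd kl) * T (fst kl) (fst z))) \<partial>(P \<Otimes>\<^sub>M R))"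
    by (simp add: ev_res) (simp add: ev_def Y_def)
qed

end

theorem theorem2p5:
  fixes \<Omega> :: "nat \<Rightarrow> 'a measure"
    and A :: "nat \<Rightarrow> 'k \<Rightarrow> 'a \<Rightarrow> cmat"
    and M :: "nat \<Rightarrow> 'l \<Rightarrow> cmat"
    and \<tau> \<tau>c :: "'k \<Rightarrow> 'k \<Rightarrow> complex"
    and \<eta> \<beta> :: "'l \<Rightarrow> 'l \<Rightarrow> complex"
    and \<alpha> :: "'l \<Rightarrow> complex"
    and P :: "'b measure"
    and T :: "'k \<Rightarrow> 'b \<Rightarrow> complex"
  assumes prob: "\<And>N. N \<ge> 1 \<Longrightarrow> prob_space (\<Omega> N)"
    and meas: "\<And>N k i j. N \<ge> 1 \<Longrightarrow> (\<lambda>\<omega>. A N k \<omega> i j) \<in> borel_measurable (\<Omega> N)"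
    and a_inv: "\<And>N U. N \<ge> 1 \<Longrightarrow> unitary N U \<Longrightarrow>
        distr (\<Omega> N) fam_space (\<lambda>\<omega> k. msk N (A N k \<omega>))
      = distr (\<Omega> N) fam_space (\<lambda>\<omega> k. mmult N (mmult N U (A N k \<omega>)) (madj U))"
    and b_bdd: "\<And>k p q. p \<ge> 1 \<Longrightarrow> q \<ge> 1 \<Longrightarrow> (\<exists>C. \<forall>N\<ge>1.
        integrable (\<Omega> N) (\<lambda>\<omega>. (cmod (mtr N (mpow N (mmult N (A N k \<omega>) (madj (A N k \<omega>))) p) / of_nat N)) ^ q)
      \<and> (\<integral>\<omega>. (cmod (mtr N (mpow N (mmult N (A N k \<omega>) (madj (A N k \<omega>))) p) / of_nat N)) ^ q \<partial>\<Omega> N) \<le> C)"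
    and c1: "\<And>k k'. l2_conv \<Omega> (\<lambda>N \<omega>. mtr N (mmult N (A N k \<omega>) (A N k' \<omega>)) / of_nat N
                 - mtr N (A N k \<omega>) / of_nat N * (mtr N (A N k' \<omega>) / of_nat N)) (\<tau> k k')"
    and c2: "\<And>k k'. l2_conv \<Omega> (\<lambda>N \<omega>. mtr N (mmult N (A N k \<omega>) (madj (A N k' \<omega>))) / of_nat N
                 - mtr N (A N k \<omega>) / of_nat N * (mtr N (madj (A N k' \<omega>)) / of_nat N)) (\<tau>c k k')"
    and d1: "\<And>l l'. (\<lambda>N. mtr N (mmult N (M N l) (M N l')) / of_nat N
                 - mtr N (M N l) / of_nat N * (mtr N (M N l') / of_nat N)) \<longlonglongrightarrow> \<eta> l l'"
    and d2: "\<And>l l'. (\<lambda>N. mtr N (mmult N (M N l) (madj (M N l'))) / of_nat N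
                 - mtr N (M N l) / of_nat N * (mtr N (madj (M N l')) / of_nat N)) \<longlonglongrightarrow> \<beta> l l'"
    and probP: "prob_space P"
    and T_centered: "\<And>k. integrable P (T k) \<and> (\<integral>x. T k x \<partial>P) = 0"
    and e_T: "fdd_conv \<Omega> (\<lambda>N k \<omega>. mtr N (A N k \<omega>) - (\<integral>\<omega>'. mtr N (A N k \<omega>') \<partial>\<Omega> N)) P T"
    and e_alpha: "\<And>l. (\<lambda>N. mtr N (M N l) / of_nat N) \<longlonglongrightarrow> \<alpha> l"
  shows "\<exists>R :: ('k \<times> 'l \<Rightarrow> complex) measure.
     prob_space R
   \<and> complex_centered_gaussian R (\<lambda>i g. g i)
   \<and> (\<forall>k l k' l'.
        integrable R (\<lambda>g. g (k, l) * g (k', l'))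
      \<and> (\<integral>g. g (k, l) * g (k', l') \<partial>R) = \<eta> l l' * \<tau> k k'
      \<and> integrable R (\<lambda>g. g (k, l) * cnj (g (k', l')))
      \<and> (\<integral>g. g (k, l) * cnj (g (k', l')) \<partial>R) = \<beta> l l' * \<tau>c k k')
   \<and> fdd_conv \<Omega>
       (\<lambda>N kl \<omega>. mtr N (mmult N (A N (fst kl) \<omega>) (M N (snd kl)))
                 - (\<integral>\<omega>'. mtr N (mmult N (A N (fst kl) \<omega>') (M N (snd kl))) \<partial>\<Omega> N))
       (P \<Otimes>\<^sub>M R)
       (\<lambda>kl xg. snd xg kl + \<alpha> (snd kl) * T (fst kl) (fst xg))"
proof -
  interpret rm: rm_model \<Omega> A M \<tau> \<tau>c \<eta> \<beta>
    by (rule rm_model.intro) (fact prob meas a_inv b_bdd c1 c2 d1 d2)+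
  \<comment> \<open>One law for the whole index set, since the claim quantifies over finite subsets
    only after \<open>R\<close> has been fixed.\<close>
  obtain R where R: "sets R = sets (PiM UNIV (\<lambda>_. borel :: complex measure))" "prob_space R"
    "\<And>F c. finite F \<Longrightarrow> (\<integral>g. iexp (trig_phase F c g) \<partial>R) = of_real (exp (- gauss_form rm.\<Gamma> rm.\<Delta> F c / 2))"
    using gaussian_process_exists[OF rm.cov_sym rm.gauss_form_nonneg] by blast
  note mom = gaussian_process_moments[OF rm.cov_sym rm.gauss_form_nonneg R]
  show ?thesis
  proof (intro exI[of _ R] conjI allI)
    show "prob_space R" by (rule R)
    show "complex_centered_gaussian R (\<lambda>i g. g i)" by (rule mom(1))
    fix k l k' l'
    show "integrable R (\<lambda>g. g (k, l) * g (k', l'))" "(\<integral>g. g (k, l) * g (k', l') \<partial>R) = \<eta> l l' * \<tau> k k'"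
      using mom(2)[of "(k, l)" "(k', l')"] by (simp_all add: rm.\<Gamma>_def)
    show "integrable R (\<lambda>g. g (k, l) * cnj (g (k', l')))" "(\<integral>g. g (k, l) * cnj (g (k', l')) \<partial>R) = \<beta> l l' * \<tau>c k k'"
      using mom(3)[of "(k, l)" "(k', l')"] by (simp_all add: rm.\<Delta>_def)
  qed (rule rm.fdd_limit[OF probP T_centered e_T e_alpha R])
qed

end
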